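(* Let $m$ be a fixed constant. For any scoring rule on $m$ candidates, the destructive weighted-protection problem can be solved in polynomial time.
   Context: Election model. There is a set $\mathcal{C}=\{c_1,\dots,c_m\}$ of candidates and a set $\mathcal{V}=\{v_1,\dots,v_n\}$ of voters. Each voter $v_j$ has a preference list $\tau_j$ (a linear order of $\mathcal{C}$), a weight $w_j\in\mathbb{Z}_{>0}$, an awarding price $p_j^a$ and a bribing price $p_j^b$. A scoring rule is a vector $\alpha=(\alpha_1,\dots,\alpha_m)$ of nonnegative integers with $\alpha_1\ge\cdots\ge\alpha_m$ (fixed); the candidate at position $z$ of $v_j$'s list receives $w_j\alpha_z$ points from $v_j$, and a candidate's total score is the sum over all voters. Bribery: given a set $\mathcal{V}_F$ of awarded voters, an attacker with budget $B\in\mathbb{Z}_{\ge 0}$ may choose any $\mathcal{V}_B\subseteq\mathcal{V}\setminus\mathcal{V}_F$ with $\sum_{v_j\in\mathcal{V}_B}p_j^b\le B$ and replace the list of each voter in $\mathcal{V}_B$ by an arbitrary preference list. Destructive protection problem: input: candidates, voters (weights, lists, prices), defense budget $F\in\mathbb{Z}_{\ge0}$, attack budget $B$, where $c_m$ has the maximum total score without bribery; question: is there $\mathcal{V}_F\subseteq\mathcal{V}$ with $\sum_{v_j\in\mathcal{V}_F}p_j^a\le F$ such that for every admissible bribery (every such $\mathcal{V}_B$ and every choice of new lists), no candidate $c\neq c_m$ obtains a total score strictly higher than $c_m$? The destructive weighted-protection problem is the special case in which $p_j^a=p_j^b=1$ for every voter $j$ (weights arbitrary, encoded in binary). *)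

theory Defs
  imports Main
begin

text \<open>Candidates are 0,...,m-1; the distinguished candidate c_m is m-1.
  A preference list is a list of length m listing all candidates (distinct);
  position z (0-based) of the list receives alpha ! z points (times the weight).
  A voter is a pair (weight, preference list).  In the weighted-protection problem
  all awarding and bribing prices are 1, so budgets bound the number of voters.\<close>

type_synonym voter = "nat \<times> nat list"

definition is_pref :: "nat \<Rightarrow> nat list \<Rightarrow> bool" where
  "is_pref m p \<longleftrightarrow> length p = m \<and> distinct p \<and> set p = {0..<m}"

definition voter_score :: "nat list \<Rightarrow> nat \<Rightarrow> nat list \<Rightarrow> nat \<Rightarrow> nat" where
  "voter_score alpha w p c = (\<Sum>z<length p. if p ! z = c then w * alpha ! z else 0)"

definition total_score :: "nat list \<Rightarrow> voter list \<Rightarrow> (nat \<Rightarrow> nat list) \<Rightarrow> nat \<Rightarrow> nat" where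
  "total_score alpha vs prefs c = (\<Sum>j<length vs. voter_score alpha (fst (vs ! j)) (prefs j) c)"

definition orig_prefs :: "voter list \<Rightarrow> nat \<Rightarrow> nat list" where
  "orig_prefs vs j = snd (vs ! j)"

record pinst =
  defB :: nat
  attB :: nat
  voters :: "voter list"

definition valid_instance :: "nat \<Rightarrow> nat list \<Rightarrow> pinst \<Rightarrow> bool" where
  "valid_instance m alpha I \<longleftrightarrow>
     (\<forall>j<length (voters I). fst (voters I ! j) > 0 \<and> is_pref m (snd (voters I ! j))) \<and>
     (\<forall>c<m. total_score alpha (voters I) (orig_prefs (voters I)) c
              \<le> total_score alpha (voters I) (orig_prefs (voters I)) (m - 1))"

definition protectable :: "nat \<Rightarrow> nat list \<Rightarrow> pinst \<Rightarrow> bool" where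
  "protectable m alpha I \<longleftrightarrow>
     (\<exists>VF. VF \<subseteq> {0..<length (voters I)} \<and> card VF \<le> defB I \<and>
       (\<forall>VB L. VB \<subseteq> {0..<length (voters I)} - VF \<longrightarrow> card VB \<le> attB I \<longrightarrow>
          (\<forall>j\<in>VB. is_pref m (L j)) \<longrightarrow>
          (let prefs = (\<lambda>j. if j \<in> VB then L j else orig_prefs (voters I) j) in
           \<forall>c<m. c \<noteq> m - 1 \<longrightarrow>
             total_score alpha (voters I) prefs c \<le> total_score alpha (voters I) prefs (m - 1))))"

text \<open>Input alphabet: 1 = bit 0, 2 = bit 1, 3 = separator; 0 is the blank.
  Numbers are written in binary (least significant bit first).\<close>

fun bits :: "nat \<Rightarrow> nat list" where
  "bits n = (if n < 2 then [n + 1] else (n mod 2 + 1) # bits (n div 2))"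

definition enc_num :: "nat \<Rightarrow> nat list" where
  "enc_num n = bits n @ [3]"

definition enc_voter :: "voter \<Rightarrow> nat list" where
  "enc_voter v = enc_num (fst v) @ concat (map enc_num (snd v))"

definition encode :: "pinst \<Rightarrow> nat list" where
  "encode I = enc_num (defB I) @ enc_num (attB I) @ concat (map enc_voter (voters I))"

record tm =
  nstates :: nat
  nsyms :: nat
  delta :: "nat \<Rightarrow> nat \<Rightarrow> nat \<times> nat \<times> int"
  q0 :: nat
  qacc :: nat
  qrej :: nat

definition wf_tm :: "tm \<Rightarrow> bool" where
  "wf_tm M \<longleftrightarrow> nsyms M \<ge> 4 \<and> q0 M < nstates M \<and> qacc M < nstates M \<and>
     qrej M < nstates M \<and> qacc M \<noteq> qrej M \<and>
     (\<forall>q<nstates M. \<forall>s<nsyms M. case delta M q s of (q', s', d) \<Rightarrow>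
        q' < nstates M \<and> s' < nsyms M \<and> d \<in> {-1, 0, 1})"

type_synonym config = "nat \<times> (int \<Rightarrow> nat) \<times> int"

definition tm_step :: "tm \<Rightarrow> config \<Rightarrow> config" where
  "tm_step M cfg = (case cfg of (q, tape, h) \<Rightarrow>
     if q = qacc M \<or> q = qrej M then cfg
     else (case delta M q (tape h) of (q', s', d) \<Rightarrow> (q', tape(h := s'), h + d)))"

definition init_config :: "tm \<Rightarrow> nat list \<Rightarrow> config" where
  "init_config M x = (q0 M, (\<lambda>i. if 0 \<le> i \<and> i < int (length x) then x ! nat i else 0), 0)"

definition run :: "tm \<Rightarrow> nat list \<Rightarrow> nat \<Rightarrow> config" where
  "run M x t = (tm_step M ^^ t) (init_config M x)"

definition halts_within :: "tm \<Rightarrow> nat list \<Rightarrow> nat \<Rightarrow> bool" where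
  "halts_within M x t \<longleftrightarrow> fst (run M x t) \<in> {qacc M, qrej M}"

definition accepts :: "tm \<Rightarrow> nat list \<Rightarrow> bool" where
  "accepts M x \<longleftrightarrow> (\<exists>t. fst (run M x t) = qacc M)"

definition poly_time_solvable :: "(pinst \<Rightarrow> bool) \<Rightarrow> (pinst \<Rightarrow> bool) \<Rightarrow> bool" where
  "poly_time_solvable valid P \<longleftrightarrow>
     (\<exists>M c k. wf_tm M \<and>
        (\<forall>x. set x \<subseteq> {1, 2, 3} \<longrightarrow> halts_within M x (c * length x ^ k + c)) \<and>
        (\<forall>I. valid I \<longrightarrow> (accepts M (encode I) \<longleftrightarrow> P I)))"

end

theory Submission
  imports Defs
begin

text \<open>The attacker's best reply in favour of a candidate c is to bribe, among the voters that are not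
  awarded, those with the largest value of weight times gain, where the gain of a voter depends only
  on its preference list. Exchanging an awarded voter for a heavier one with the same list never
  hurts, so an award is described by one counter for each of the m! lists, and there are only
  polynomially many candidates for it.

  The exhaustive search runs in polynomial time because it needs no memory besides a constant number
  of registers with values below C * (N + 1), where N is the input length: weights are never copied,
  and sums of multiples of weights are compared bit by bit from the least significant end with
  carries of linear size. A register is a mark on a tape cell, and every loop runs through all
  register values, so that the running time is read off the program text.\<close>

subsection \<open>Turing machines over arbitrary finite state and symbol types\<close>

text \<open>One award has to withstand the attacks in favour of all rivals at once, and the greedy
  orders of different rivals disagree. The exchange argument survives this because voters with the
  same list have the same gain for every rival, so a single replacement serves all of them.

  The machine must halt in time on every string, not only on encodings. Weights, lists and voters
  are therefore total functions of the string, and their intended meaning is proved for encodings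
  only. Budgets are binary too and may exceed every register, so counts are compared with them in
  the same way as scores are compared.

  The constant C comes from the column sums. If D bounds the coefficients, then an index contributes
  at most 2 * D to a column, a column and the carry into it are at most 2 * D * N each, and their
  sum fits into a register as soon as 4 * D < C. A further m + 3 makes room for computing the index
  of a number in the input.\<close>

definition gstep :: "('q \<Rightarrow> 's \<Rightarrow> 'q \<times> 's \<times> int) \<Rightarrow> 'q \<Rightarrow> 'q \<Rightarrow> 'q \<times> (int \<Rightarrow> 's) \<times> int \<Rightarrow> 'q \<times> (int \<Rightarrow> 's) \<times> int" where
  "gstep D acc rej cfg = (case cfg of (q, T, h) \<Rightarrow>
     if q = acc \<or> q = rej then cfg else (case D q (T h) of (q', s', d) \<Rightarrow> (q', T(h := s'), h + d)))"

definition ginit :: "(nat \<Rightarrow> 's) \<Rightarrow> 'q \<Rightarrow> nat list \<Rightarrow> 'q \<times> (int \<Rightarrow> 's) \<times> int" where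
  "ginit sy q x = (q, (\<lambda>i. if 0 \<le> i \<and> i < int (length x) then sy (x ! nat i) else sy 0), 0)"

text \<open>After numbering states and symbols the two machines run in lock step, related by
  \<open>en\<close> on configurations satisfying \<open>ok\<close>. The numbering must fix the
  symbols 0 to 3, in which the initial tape is written; the injection \<open>sy\<close> marks their
  counterparts in \<open>S\<close>.\<close>

lemma tm_of_finite_machine:
  fixes D :: "'q \<Rightarrow> 's \<Rightarrow> 'q \<times> 's \<times> int" and sy :: "nat \<Rightarrow> 's"
  assumes fin: "finite Q" "finite S"
    and states: "start \<in> Q" "acc \<in> Q" "rej \<in> Q" "acc \<noteq> rej"
    and sy: "inj_on sy {..<4}" "\<And>a. a < 4 \<Longrightarrow> sy a \<in> S"
    and closed: "\<And>q s q' s' d. q \<in> Q \<Longrightarrow> s \<in> S \<Longrightarrow> D q s = (q', s', d) \<Longrightarrow> q' \<in> Q \<and> s' \<in> S \<and> d \<in> {-1, 0, 1}"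
  shows "\<exists>M. wf_tm M \<and> (\<forall>x t. set x \<subseteq> {1, 2, 3} \<longrightarrow>
     (fst (run M x t) = qacc M \<longleftrightarrow> fst ((gstep D acc rej ^^ t) (ginit sy start x)) = acc) \<and>
     (fst (run M x t) = qrej M \<longleftrightarrow> fst ((gstep D acc rej ^^ t) (ginit sy start x)) = rej))"
proof -
  obtain eq where eq: "bij_betw eq Q {0..<card Q}"
    using ex_bij_betw_finite_nat[OF fin(1)] by blast
  obtain h where h: "bij_betw h S {0..<card S}"
    using ex_bij_betw_finite_nat[OF fin(2)] by blast
  \<comment> \<open>Codes below 4 belong to the input symbols and the blank. All other symbols are
    moved up by 4, which leaves gaps.\<close>
  define es where "es s = (if s \<in> sy ` {..<4} then inv_into {..<4} sy s else 4 + h s)" for s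
  have es_sy: "es (sy a) = a" if "a < 4" for a
    using that sy(1) by (simp add: es_def)
  have es_inj: "inj_on es S"
  proof (rule inj_onI)
    fix a b assume ab: "a \<in> S" "b \<in> S" "es a = es b"
    have lt: "inv_into {..<4} sy s < 4" if "s \<in> sy ` {..<4}" for s
      using inv_into_into[OF that] by simp
    consider "a \<in> sy ` {..<4}" "b \<in> sy ` {..<4}" | "a \<notin> sy ` {..<4}" "b \<notin> sy ` {..<4}"
      using ab(3) lt[of a] lt[of b] unfolding es_def by (auto split: if_splits)
    then show "a = b"
    proof cases
      case 1 then show ?thesis using ab(3) unfolding es_def by (auto intro: inv_into_injective)
    next
      case 2 then show ?thesis using ab h unfolding es_def bij_betw_def inj_on_def by auto
    qed
  qed
  have es_lt: "es s < 4 + card S" if "s \<in> S" for s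
  proof (cases "s \<in> sy ` {..<4}")
    case True then show ?thesis using inv_into_into[OF True] by (simp add: es_def)
  next
    case False then show ?thesis using bij_betwE[OF h] that by (auto simp: es_def)
  qed
  \<comment> \<open>\<open>wf_tm\<close> constrains \<open>delta\<close> on every code, so the gaps
    have to decode to something in \<open>S\<close>; the blank is chosen.\<close>
  define ds where "ds n = (if n \<in> es ` S then inv_into S es n else sy 0)" for n
  have ds_S: "ds n \<in> S" for n
    unfolding ds_def using sy(2)[of 0] by (auto intro: inv_into_into)
  have ds_es: "ds (es s) = s" if "s \<in> S" for s
    using that es_inj by (simp add: ds_def)
  define dq where "dq = inv_into Q eq"
  have dq_Q: "dq n \<in> Q" if "n < card Q" for n
    using that eq unfolding dq_def by (metis atLeast0LessThan bij_betw_def inv_into_into lessThan_iff)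
  have dq_eq: "dq (eq q) = q" if "q \<in> Q" for q
    using that eq unfolding dq_def bij_betw_def by simp
  have eq_lt: "eq q < card Q" if "q \<in> Q" for q
    using bij_betwE[OF eq] that by auto
  have eq_iff: "eq p = eq q \<longleftrightarrow> p = q" if "p \<in> Q" "q \<in> Q" for p q
    using that dq_eq by metis
  define M where "M = \<lparr>nstates = card Q, nsyms = 4 + card S,
     delta = (\<lambda>n s. case D (dq n) (ds s) of (q', s', d) \<Rightarrow> (eq q', es s', d)),
     q0 = eq start, qacc = eq acc, qrej = eq rej\<rparr>"
  have wf: "wf_tm M"
    unfolding wf_tm_def using states eq_lt eq_iff es_lt
    by (auto simp: M_def split: prod.splits dest!: closed[OF dq_Q ds_S])
  define en where "en cfg = (case cfg of (q, T, h) \<Rightarrow> (eq q, es \<circ> T, h))" for cfg :: "'q \<times> (int \<Rightarrow> 's) \<times> int"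
  define ok where "ok cfg \<longleftrightarrow> fst cfg \<in> Q \<and> (\<forall>i. fst (snd cfg) i \<in> S)" for cfg :: "'q \<times> (int \<Rightarrow> 's) \<times> int"
  have step: "ok (gstep D acc rej cfg) \<and> tm_step M (en cfg) = en (gstep D acc rej cfg)" if ok: "ok cfg" for cfg
  proof (cases cfg)
    case (fields q T h)
    then have q: "q \<in> Q" and T: "\<And>i. T i \<in> S" using ok by (auto simp: ok_def)
    obtain q' s' d where D: "D q (T h) = (q', s', d)" by (cases "D q (T h)") auto
    show ?thesis
      using closed[OF q T D] q T D states
      by (auto simp: fields gstep_def tm_step_def en_def ok_def M_def eq_iff dq_eq ds_es)
  qed
  have "ok ((gstep D acc rej ^^ t) (ginit sy start x)) \<and>
        run M x t = en ((gstep D acc rej ^^ t) (ginit sy start x))" if x: "set x \<subseteq> {1, 2, 3}" for x t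
  proof (induction t)
    case 0
    have lt: "x ! nat i < 4" if "0 \<le> i" "i < int (length x)" for i
    proof -
      have "x ! nat i \<in> set x" using that by (intro nth_mem) auto
      then show ?thesis using x by auto
    qed
    show ?case using lt sy(2) states es_sy
      by (auto simp: ok_def ginit_def run_def en_def init_config_def M_def fun_eq_iff)
  next
    case (Suc t) then show ?case using step by (simp add: run_def)
  qed
  then have "(\<forall>x t. set x \<subseteq> {1, 2, 3} \<longrightarrow>
     (fst (run M x t) = qacc M \<longleftrightarrow> fst ((gstep D acc rej ^^ t) (ginit sy start x)) = acc) \<and>
     (fst (run M x t) = qrej M \<longleftrightarrow> fst ((gstep D acc rej ^^ t) (ginit sy start x)) = rej))"
    using eq_iff states by (fastforce simp: en_def ok_def M_def split: prod.splits)
  then show ?thesis using wf by blast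
qed

subsection \<open>A register language and its machine\<close>

datatype test = TEq nat nat | TSym nat nat | TZero nat

text \<open>Loop i c repeats c until incrementing i, which is done modulo the number of register values, wraps
  around to 0.\<close>

datatype com = Skip | Zero nat | Copy nat nat | Inc nat | Seq com com | Cond test com com | Loop nat com

definition sym_at :: "nat list \<Rightarrow> nat \<Rightarrow> nat" where
  "sym_at x p = (if p < length x then x ! p else 0)"

text \<open>The number of values of a register. The added one counts the blank cell that ends the
  input.\<close>

definition width :: "nat \<Rightarrow> nat list \<Rightarrow> nat" where
  "width C x = C * (length x + 1)"

text \<open>A symbol test fails beyond the blank that ends the input: such values are marked in a
  higher band and point to no symbol.\<close>

fun holds :: "nat list \<Rightarrow> test \<Rightarrow> (nat \<Rightarrow> nat) \<Rightarrow> bool" where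
  "holds x (TEq a b) s \<longleftrightarrow> s a = s b"
| "holds x (TSym r v) s \<longleftrightarrow> s r \<le> length x \<and> sym_at x (s r) = v"
| "holds x (TZero r) s \<longleftrightarrow> s r = 0"

definition bump :: "nat \<Rightarrow> nat \<Rightarrow> (nat \<Rightarrow> nat) \<Rightarrow> nat \<Rightarrow> nat" where
  "bump W r s = s(r := (s r + 1) mod W)"

text \<open>The number of rounds of a loop is fixed on entry. This agrees with looping until the
  counter wraps around only if the body leaves the counter alone, as \<open>well_formed\<close>
  demands.\<close>

fun exec :: "nat \<Rightarrow> nat list \<Rightarrow> com \<Rightarrow> (nat \<Rightarrow> nat) \<Rightarrow> nat \<Rightarrow> nat" where
  "exec C x Skip s = s"
| "exec C x (Zero r) s = s(r := 0)"
| "exec C x (Copy r q) s = s(r := s q)"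
| "exec C x (Inc r) s = bump (width C x) r s"
| "exec C x (Seq c d) s = exec C x d (exec C x c s)"
| "exec C x (Cond t c d) s = (if holds x t s then exec C x c s else exec C x d s)"
| "exec C x (Loop i c) s = ((\<lambda>s. bump (width C x) i (exec C x c s)) ^^ (width C x - s i)) s"

fun writes :: "com \<Rightarrow> nat set" where
  "writes Skip = {}"
| "writes (Zero r) = {r}"
| "writes (Copy r q) = {r}"
| "writes (Inc r) = {r}"
| "writes (Seq c d) = writes c \<union> writes d"
| "writes (Cond t c d) = writes c \<union> writes d"
| "writes (Loop i c) = insert i (writes c)"

fun well_formed :: "com \<Rightarrow> bool" where
  "well_formed (Seq c d) \<longleftrightarrow> well_formed c \<and> well_formed d"
| "well_formed (Cond t c d) \<longleftrightarrow> well_formed c \<and> well_formed d"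
| "well_formed (Loop i c) \<longleftrightarrow> well_formed c \<and> i \<notin> writes c"
| "well_formed _ \<longleftrightarrow> True"

fun test_regs :: "test \<Rightarrow> nat set" where
  "test_regs (TEq a b) = {a, b}"
| "test_regs (TSym r v) = {r}"
| "test_regs (TZero r) = {r}"

fun regs :: "com \<Rightarrow> nat set" where
  "regs Skip = {}"
| "regs (Zero r) = {r}"
| "regs (Copy r q) = {r, q}"
| "regs (Inc r) = {r}"
| "regs (Seq c d) = regs c \<union> regs d"
| "regs (Cond t c d) = test_regs t \<union> regs c \<union> regs d"
| "regs (Loop i c) = insert i (regs c)"

text \<open>The unit is one sweep over the tape, that is \<open>2 * length x + 3\<close> steps, and
  \<open>W\<close> is the number of register values. Both branches of a conditional and the full
  range of a loop are charged, so the bound does not depend on the state.\<close>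

fun cost :: "com \<Rightarrow> nat \<Rightarrow> nat" where
  "cost (Seq c d) W = 1 + cost c W + cost d W"
| "cost (Cond t c d) W = 1 + cost c W + cost d W"
| "cost (Loop i c) W = 1 + W * (cost c W + 4)"
| "cost _ W = 1"

lemma exec_unwritten: "r \<notin> writes c \<Longrightarrow> exec C x c s r = s r"
proof (induction c arbitrary: s)
  case (Loop i c)
  have "((\<lambda>s. bump (width C x) i (exec C x c s)) ^^ n) s r = s r" for n
    by (induction n) (use Loop in \<open>auto simp: bump_def\<close>)
  then show ?case by simp
qed (auto simp: bump_def)

lemma exec_bound: "0 < C \<Longrightarrow> \<forall>r. s r < width C x \<Longrightarrow> \<forall>r. exec C x c s r < width C x"
proof (induction c arbitrary: s)
  case (Loop i c)
  have W: "0 < width C x" using Loop.prems by (simp add: width_def)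
  have "\<forall>r. ((\<lambda>s. bump (width C x) i (exec C x c s)) ^^ n) s r < width C x" for n
  proof (induction n)
    case (Suc n)
    then show ?case using Loop.IH[OF Loop.prems(1) Suc] W by (simp add: bump_def)
  qed (use Loop in simp)
  then show ?case by simp
qed (auto simp: bump_def width_def split: if_splits)

lemma finite_regs: "finite (regs c)"
proof -
  have "finite (test_regs t)" for t by (cases t) auto
  then show ?thesis by (induction c) auto
qed

section \<open>Continuations as a finite control\<close>

fun unfold_loop :: "nat \<Rightarrow> com \<Rightarrow> com list \<Rightarrow> com list" where
  "unfold_loop i c K = Inc i # Cond (TZero i) Skip (Loop i c) # K"

fun nxt :: "com list \<Rightarrow> nat \<Rightarrow> com list" where
  "nxt [] n = []"
| "nxt (Seq c d # K) n = c # d # K"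
| "nxt (Cond t c d # K) n = (if n = 1 then c # K else d # K)"
| "nxt (Loop i c # K) n = c # unfold_loop i c K"
| "nxt (c # K) n = K"

text \<open>These are the continuations that can occur between the start of \<open>c\<close> and the
  arrival at \<open>K\<close>. A loop is re-entered with the continuation that it had at first, so
  the stack does not grow from round to round and the set is finite. \<open>K\<close> itself belongs
  to the surrounding program.\<close>

fun conts :: "com \<Rightarrow> com list \<Rightarrow> com list set" where
  "conts (Seq c d) K = {Seq c d # K} \<union> conts c (d # K) \<union> conts d K"
| "conts (Cond t c d) K = {Cond t c d # K} \<union> conts c K \<union> conts d K"
| "conts (Loop i c) K = {Loop i c # K, unfold_loop i c K, tl (unfold_loop i c K), Skip # K}
      \<union> conts c (unfold_loop i c K)"
| "conts c K = {c # K}"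

lemma finite_conts: "finite (conts c K)"
  by (induction c arbitrary: K) auto

lemma conts_self: "c # K \<in> conts c K"
  by (cases c) auto

lemma nxt_conts: "k \<in> conts c K \<Longrightarrow> nxt k n \<in> conts c K \<union> {K}"
proof (induction c arbitrary: K)
  case (Loop i c)
  from Loop.prems consider "k = Loop i c # K" | "k = unfold_loop i c K" | "k = tl (unfold_loop i c K)"
    | "k = Skip # K" | "k \<in> conts c (unfold_loop i c K)" by auto
  then show ?case
  proof cases
    case 5 then show ?thesis using Loop.IH[OF 5] by auto
  qed (use conts_self[of c "unfold_loop i c K"] in auto)
next
  case (Seq c d) then show ?case using conts_self[of c "d # K"] conts_self[of d K] by fastforce
next
  case (Cond t c d) then show ?case using conts_self[of c K] conts_self[of d K] by (fastforce split: if_splits)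
qed auto

lemma regs_conts: "k \<in> conts c K \<Longrightarrow> k \<noteq> [] \<and> regs (hd k) \<subseteq> regs c"
  by (induction c arbitrary: K) fastforce+

text \<open>The continuation of the program serves as the finite control: Go K starts the execution of K at
  cell 0, while Rt and Lf sweep over the tape to the right and back, remembering one number.\<close>

datatype ctl = Start | Acc | Rej | Go "com list" | Rt "com list" nat | Lf "com list" nat

type_synonym cell = "nat \<times> (nat \<times> nat) set"

fun cell_test :: "test \<Rightarrow> cell \<Rightarrow> bool" where
  "cell_test (TEq a b) (z, M) \<longleftrightarrow> (\<exists>k. (Suc a, k) \<in> M \<and> (Suc b, k) \<in> M)"
| "cell_test (TSym r v) (z, M) \<longleftrightarrow> z = v \<and> (Suc r, 0) \<in> M"
| "cell_test (TZero r) (z, M) \<longleftrightarrow> (0, 0) \<in> M \<and> (Suc r, 0) \<in> M"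

definition unmark :: "nat \<Rightarrow> (nat \<times> nat) set \<Rightarrow> (nat \<times> nat) set" where
  "unmark r M = {y \<in> M. fst y \<noteq> Suc r}"

text \<open>The action of a pass to the right on one cell, where \<open>n\<close> is the remembered
  number. For \<open>Inc\<close>, 0 means that nothing is carried and \<open>Suc k\<close> that a
  mark of band \<open>k\<close> was picked up in the previous cell and is put down in this one. For
  \<open>Cond\<close>, 1 records that some cell has passed the test.\<close>

fun sweep :: "com \<Rightarrow> nat \<Rightarrow> cell \<Rightarrow> nat \<times> (nat \<times> nat) set" where
  "sweep (Zero r) n (z, M) = (n, unmark r M \<union> (if (0, 0) \<in> M then {(Suc r, 0)} else {}))"
| "sweep (Copy r q) n (z, M) = (n, unmark r M \<union> {(Suc r, k) | k. (Suc q, k) \<in> M})"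
| "sweep (Inc r) n (z, M) =
     (if \<exists>k. (Suc r, k) \<in> M then (Suc (LEAST k. (Suc r, k) \<in> M), unmark r M)
      else (0, if n = 0 then M else insert (Suc r, n - 1) M))"
| "sweep (Cond t c d) n (z, M) = (if cell_test t (z, M) then 1 else n, M)"
| "sweep _ n (z, M) = (n, M)"

text \<open>A mark picked up in the last cell is still carried when the head is back at cell 0,
  where it reappears one band higher. As \<open>n\<close> is \<open>Suc k\<close>, the new band is
  \<open>n mod C\<close>, and the top band wraps around to 0.\<close>

fun finish :: "nat \<Rightarrow> com \<Rightarrow> nat \<Rightarrow> (nat \<times> nat) set \<Rightarrow> (nat \<times> nat) set" where
  "finish C (Inc r) n M = (if n = 0 then M else insert (Suc r, n mod C) M)"
| "finish C _ n M = M"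

fun is_sweep :: "com \<Rightarrow> bool" where
  "is_sweep (Zero r) = True"
| "is_sweep (Copy r q) = True"
| "is_sweep (Inc r) = True"
| "is_sweep (Cond t c d) = True"
| "is_sweep _ = False"

text \<open>The right end of the tape is recognised by the blank and the left end by the mark
  \<open>(0, 0)\<close>. The start sets all registers to 0 by marking cell 0, and the verdict also
  needs only cell 0: the mark \<open>(1, 0)\<close> there says that register 0 is zero.\<close>

fun mdelta :: "nat \<Rightarrow> nat \<Rightarrow> com \<Rightarrow> ctl \<Rightarrow> cell \<Rightarrow> ctl \<times> cell \<times> int" where
  "mdelta C R P Start (z, M) = (Go [P], (z, insert (0, 0) ((\<lambda>r. (Suc r, 0)) ` {..<R})), 0)"
| "mdelta C R P (Go K) (z, M) =
     (if K = [] then (if (1, 0) \<in> M then Rej else Acc, (z, M), 0)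
      else if is_sweep (hd K) then (Rt K 0, (z, M), 0) else (Go (nxt K 0), (z, M), 0))"
| "mdelta C R P (Rt K n) (z, M) =
     (case sweep (hd K) n (z, M) of (n', M') \<Rightarrow> if z = 0 then (Lf K n', (z, M'), 0) else (Rt K n', (z, M'), 1))"
| "mdelta C R P (Lf K n) (z, M) =
     (if (0, 0) \<in> M then (Go (nxt K n), (z, finish C (hd K) n M), 0) else (Lf K n, (z, M), -1))"
| "mdelta C R P q c = (q, c, 0)"

text \<open>Cells 0 to N are in use. Register r holds k * (N + 1) + p when cell p carries the mark (Suc r, k);
  the mark (0, 0) identifies cell 0.\<close>

definition marks :: "nat \<Rightarrow> nat \<Rightarrow> nat list \<Rightarrow> (nat \<Rightarrow> nat) \<Rightarrow> nat \<Rightarrow> (nat \<times> nat) set" where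
  "marks C R x s p = (if p = 0 then {(0, 0)} else {}) \<union>
     {(Suc r, k) | r k. r < R \<and> k < C \<and> s r = k * (length x + 1) + p}"

definition tape :: "nat list \<Rightarrow> (nat \<Rightarrow> (nat \<times> nat) set) \<Rightarrow> int \<Rightarrow> cell" where
  "tape x f i = (if 0 \<le> i \<and> i \<le> int (length x) then (sym_at x (nat i), f (nat i)) else (0, {}))"

abbreviation mstep :: "nat \<Rightarrow> nat \<Rightarrow> com \<Rightarrow> ctl \<times> (int \<Rightarrow> cell) \<times> int \<Rightarrow> ctl \<times> (int \<Rightarrow> cell) \<times> int" where
  "mstep C R P \<equiv> gstep (mdelta C R P) Acc Rej"

section \<open>Simulation of register programs by sweeps\<close>

lemma tape_upd: "p \<le> length x \<Longrightarrow> (tape x f)(int p := (sym_at x p, M)) = tape x (f(p := M))"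
  by (auto simp: tape_def fun_eq_iff)

lemma tape_at: "p \<le> length x \<Longrightarrow> tape x f (int p) = (sym_at x p, f p)"
  by (simp add: tape_def)

text \<open>\<open>g p\<close> is the number remembered on arrival at cell \<open>p\<close>, and
  \<open>f'\<close> are the marks left behind; each instruction supplies both in closed form. Input
  symbols are nonzero, so the pass does not turn early.\<close>

lemma sweep_right:
  assumes x: "set x \<subseteq> {1, 2, 3}"
    and sw: "\<And>p. p \<le> length x \<Longrightarrow> sweep (hd K) (g p) (sym_at x p, f p) = (g (Suc p), f' p)"
    and p: "p \<le> length x"
  shows "(mstep C R P ^^ p) (Rt K (g 0), tape x f, 0) =
         (Rt K (g p), tape x (\<lambda>i. if i < p then f' i else f i), int p)"
  using p
proof (induction p)
  case (Suc p)
  have nz: "sym_at x p \<noteq> 0"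
  proof -
    have "x ! p \<in> set x" using Suc.prems by (intro nth_mem) auto
    then have "x ! p \<in> {1, 2, 3}" using x by blast
    then show ?thesis using Suc.prems by (auto simp: sym_at_def)
  qed
  have eq: "(\<lambda>i. if i < p then f' i else f i)(p := f' p) = (\<lambda>i. if i < Suc p then f' i else f i)"
    by (auto simp: fun_eq_iff less_Suc_eq)
  have p: "p \<le> length x" using Suc.prems by simp
  show ?case using Suc.IH Suc.prems sw[of p] nz
    by (simp add: gstep_def tape_at tape_upd[OF p, of _ "f' p"] eq algebra_simps)
qed simp

lemma sweep_left:
  assumes home: "\<And>p. p \<le> length x \<Longrightarrow> (0, 0) \<in> f p \<longleftrightarrow> p = 0"
    and p: "p \<le> length x"
  shows "(mstep C R P ^^ Suc p) (Lf K n, tape x f, int p) =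
         (Go (nxt K n), tape x (f(0 := finish C (hd K) n (f 0))), 0)"
  using p
proof (induction p)
  case 0
  have "(0, 0) \<in> f 0" using home[of 0] by simp
  then show ?case using tape_upd[of 0 x f] tape_at[of 0 x f] by (simp add: gstep_def fun_upd_def)
next
  case (Suc p)
  have "(0, 0) \<notin> f (Suc p)" using home[of "Suc p"] Suc.prems by simp
  then have step: "mstep C R P (Lf K n, tape x f, int (Suc p)) = (Lf K n, tape x f, int p)"
    using tape_at[OF Suc.prems, of f] tape_upd[OF Suc.prems, of f "f (Suc p)"] by (simp add: gstep_def)
  have "(mstep C R P ^^ Suc p) (Lf K n, tape x f, int p) =
         (Go (nxt K n), tape x (f(0 := finish C (hd K) n (f 0))), 0)"
    using Suc.IH Suc.prems by linarith
  then show ?case by (subst funpow_Suc_right) (simp only: o_apply step)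
qed

lemma full_sweep:
  assumes x: "set x \<subseteq> {1, 2, 3}"
    and K: "K \<noteq> []" "is_sweep (hd K)"
    and sw: "\<And>p. p \<le> length x \<Longrightarrow> sweep (hd K) (g p) (sym_at x p, f p) = (g (Suc p), f' p)"
    and g0: "g 0 = 0"
    and home: "\<And>p. p \<le> length x \<Longrightarrow> (0, 0) \<in> f' p \<longleftrightarrow> p = 0"
    and f: "\<And>p. p \<le> length x \<Longrightarrow> f'' p = (f'(0 := finish C (hd K) (g (length x + 1)) (f' 0))) p"
  shows "(mstep C R P ^^ (2 * length x + 3)) (Go K, tape x f, 0) =
         (Go (nxt K (g (length x + 1))), tape x f'', 0)"
proof -
  let ?N = "length x"
  have 1: "mstep C R P (Go K, tape x f, 0) = (Rt K (g 0), tape x f, 0)"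
    using K g0 tape_at[of 0 x f] tape_upd[of 0 x f "f 0"] by (simp add: gstep_def)
  have 2: "(mstep C R P ^^ ?N) (Rt K (g 0), tape x f, 0) =
         (Rt K (g ?N), tape x (\<lambda>i. if i < ?N then f' i else f i), int ?N)"
    by (rule sweep_right[OF x sw order.refl])
  have 3: "mstep C R P (Rt K (g ?N), tape x (\<lambda>i. if i < ?N then f' i else f i), int ?N) =
        (Lf K (g (?N + 1)), tape x f', int ?N)"
  proof -
    have "(\<lambda>i. if i < ?N then f' i else f i)(?N := f' ?N) = (\<lambda>i. if i \<le> ?N then f' i else f i)"
      by (auto simp: fun_eq_iff)
    moreover have "tape x (\<lambda>i. if i \<le> ?N then f' i else f i) = tape x f'"
      by (auto simp: tape_def fun_eq_iff)
    moreover have "sym_at x ?N = 0" by (simp add: sym_at_def)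
    moreover have "sweep (hd K) (g ?N) (sym_at x ?N, f ?N) = (g (Suc ?N), f' ?N)" using sw[of ?N] by simp
    ultimately show ?thesis
      using tape_upd[of ?N x "\<lambda>i. if i < ?N then f' i else f i" "f' ?N"]
      by (simp add: gstep_def tape_at)
  qed
  have 4: "(mstep C R P ^^ Suc ?N) (Lf K (g (?N + 1)), tape x f', int ?N) =
         (Go (nxt K (g (?N + 1))), tape x (f'(0 := finish C (hd K) (g (?N + 1)) (f' 0))), 0)"
    by (rule sweep_left[OF home order.refl])
  have 5: "tape x (f'(0 := finish C (hd K) (g (?N + 1)) (f' 0))) = tape x f''"
    using f by (auto simp: tape_def fun_eq_iff)
  \<comment> \<open>One step to begin, \<open>?N\<close> steps to the right, one step to turn at the
    blank, and \<open>Suc ?N\<close> steps to return and dispatch.\<close>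
  have "2 * ?N + 3 = Suc ?N + (1 + (?N + 1))" by simp
  moreover have "mstep C R P ^^ 1 = mstep C R P" by (simp add: fun_eq_iff)
  ultimately show ?thesis
    by (simp only: funpow_add o_apply 1 2 3 4 5)
qed

text \<open>Division with remainder by \<open>length x + 1\<close> gives each value below
  \<open>width\<close> exactly one band and one cell, so each register below \<open>R\<close> owns
  exactly one mark.\<close>

lemma mark_iff:
  assumes "s r < width C x" "p \<le> length x"
  shows "(Suc r, k) \<in> marks C R x s p \<longleftrightarrow>
         r < R \<and> k = s r div (length x + 1) \<and> p = s r mod (length x + 1)"
proof -
  have "s r div (length x + 1) < C"
    using assms(1) by (simp add: width_def less_mult_imp_div_less)
  moreover have "s r = k * (length x + 1) + p \<longleftrightarrow> k = s r div (length x + 1) \<and> p = s r mod (length x + 1)"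
  proof
    assume s: "s r = k * (length x + 1) + p"
    have "(k * (length x + 1) + p) div (length x + 1) = k"
      using assms(2) by (intro div_nat_eqI) (auto simp: algebra_simps)
    moreover have "(k * (length x + 1) + p) mod (length x + 1) = p"
      using assms(2) by (simp only: mod_mult_self3) simp
    ultimately show "k = s r div (length x + 1) \<and> p = s r mod (length x + 1)" using s by simp
  next
    assume "k = s r div (length x + 1) \<and> p = s r mod (length x + 1)"
    then show "s r = k * (length x + 1) + p" by (metis div_mult_mod_eq)
  qed
  ultimately show ?thesis unfolding marks_def by auto
qed

lemma home_mark_iff: "(0, k) \<in> marks C R x s p \<longleftrightarrow> k = 0 \<and> p = 0"
  by (auto simp: marks_def)

lemma marks_eqI:
  assumes "\<And>k. (0, k) \<in> A \<longleftrightarrow> k = 0 \<and> p = 0"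
    and "\<And>r k. (Suc r, k) \<in> A \<longleftrightarrow> r < R \<and> k = s r div (length x + 1) \<and> p = s r mod (length x + 1)"
    and "\<forall>r. s r < width C x" "p \<le> length x"
  shows "A = marks C R x s p"
proof (rule set_eqI)
  fix y show "y \<in> A \<longleftrightarrow> y \<in> marks C R x s p"
    using assms by (cases y, cases "fst y") (auto simp: mark_iff home_mark_iff)
qed

lemma unmark_iff: "(a, k) \<in> unmark r M \<longleftrightarrow> (a, k) \<in> M \<and> a \<noteq> Suc r"
  by (auto simp: unmark_def)

lemma sim_zero:
  assumes x: "set x \<subseteq> {1, 2, 3}" and s: "\<forall>r. s r < width C x" and C: "0 < C" and r: "r < R"
  shows "(mstep C R P ^^ (2 * length x + 3)) (Go (Zero r # K), tape x (marks C R x s), 0) =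
         (Go K, tape x (marks C R x (s(r := 0))), 0)"
proof -
  have s': "\<forall>q. (s(r := 0)) q < width C x" using s C by (simp add: width_def)
  have "(mstep C R P ^^ (2 * length x + 3)) (Go (Zero r # K), tape x (marks C R x s), 0) =
         (Go (nxt (Zero r # K) ((\<lambda>_. 0) (length x + 1))), tape x (marks C R x (s(r := 0))), 0)"
  proof (rule full_sweep[OF x])
    fix p assume p: "p \<le> length x"
    have "unmark r (marks C R x s p) \<union> (if (0, 0) \<in> marks C R x s p then {(Suc r, 0)} else {})
          = marks C R x (s(r := 0)) p"
      by (rule marks_eqI) (use s s' p r C in \<open>auto simp: unmark_iff home_mark_iff mark_iff\<close>)
    then show "sweep (hd (Zero r # K)) 0 (sym_at x p, marks C R x s p) = (0, marks C R x (s(r := 0)) p)"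
      by simp
  qed (auto simp: home_mark_iff fun_upd_def)
  then show ?thesis by simp
qed

lemma sim_copy:
  assumes x: "set x \<subseteq> {1, 2, 3}" and s: "\<forall>r. s r < width C x" and r: "r < R" "q < R"
  shows "(mstep C R P ^^ (2 * length x + 3)) (Go (Copy r q # K), tape x (marks C R x s), 0) =
         (Go K, tape x (marks C R x (s(r := s q))), 0)"
proof -
  have s': "\<forall>a. (s(r := s q)) a < width C x" using s by simp
  have "(mstep C R P ^^ (2 * length x + 3)) (Go (Copy r q # K), tape x (marks C R x s), 0) =
         (Go (nxt (Copy r q # K) ((\<lambda>_. 0) (length x + 1))), tape x (marks C R x (s(r := s q))), 0)"
  proof (rule full_sweep[OF x])
    fix p assume p: "p \<le> length x"
    have "unmark r (marks C R x s p) \<union> {(Suc r, k) |k. (Suc q, k) \<in> marks C R x s p}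
          = marks C R x (s(r := s q)) p"
      by (rule marks_eqI) (use s s' p r in \<open>auto simp: unmark_iff home_mark_iff mark_iff\<close>)
    then show "sweep (hd (Copy r q # K)) 0 (sym_at x p, marks C R x s p) = (0, marks C R x (s(r := s q)) p)"
      by simp
  qed (auto simp: home_mark_iff fun_upd_def)
  then show ?thesis by simp
qed

text \<open>Incrementing a two-digit number whose low digit counts modulo \<open>n + 1\<close> and
  whose high digit counts modulo \<open>C\<close>. This is the movement of a mark under
  \<open>Inc\<close>.\<close>

lemma succ_div_mod:
  fixes v n C :: nat
  assumes v: "v < C * (n + 1)"
  shows "((v + 1) mod (C * (n + 1))) div (n + 1) =
         (if v mod (n + 1) = n then Suc (v div (n + 1)) mod C else v div (n + 1))"
    and "((v + 1) mod (C * (n + 1))) mod (n + 1) = (if v mod (n + 1) = n then 0 else v mod (n + 1) + 1)"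
proof -
  have 2: "((v + 1) mod (C * (n + 1))) mod (n + 1) = (v + 1) mod (n + 1)"
    by (simp only: mod_mult_self3 mod_mod_cancel[of "n + 1" "C * (n + 1)"] dvd_triv_right)
  then show "((v + 1) mod (C * (n + 1))) mod (n + 1) = (if v mod (n + 1) = n then 0 else v mod (n + 1) + 1)"
    by (simp add: mod_Suc)
  have q: "(v + 1) div (n + 1) = (if v mod (n + 1) = n then Suc (v div (n + 1)) else v div (n + 1))"
    by (simp add: div_Suc mod_Suc)
  have lt: "v div (n + 1) < C" using v by (simp add: less_mult_imp_div_less)
  have "((v + 1) mod (C * (n + 1))) div (n + 1) = ((v + 1) div (n + 1)) mod C"
  proof (cases "v + 1 = C * (n + 1)")
    case True
    then have "(v + 1) div (n + 1) = C" by (simp only: True) (rule nonzero_mult_div_cancel_right, simp)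
    then show ?thesis using True by simp
  next
    case False
    then have "v + 1 < C * (n + 1)" using v by linarith
    then have "(v + 1) mod (C * (n + 1)) = v + 1" "(v + 1) div (n + 1) < C"
      by (simp_all add: less_mult_imp_div_less del: mult_Suc_right)
    then show ?thesis by simp
  qed
  then show "((v + 1) mod (C * (n + 1))) div (n + 1) =
         (if v mod (n + 1) = n then Suc (v div (n + 1)) mod C else v div (n + 1))"
    using q lt by simp
qed

lemma sim_inc:
  assumes x: "set x \<subseteq> {1, 2, 3}" and s: "\<forall>r. s r < width C x" and r: "r < R"
  shows "(mstep C R P ^^ (2 * length x + 3)) (Go (Inc r # K), tape x (marks C R x s), 0) =
         (Go K, tape x (marks C R x (bump (width C x) r s)), 0)"
proof -
  let ?n = "length x + 1" and ?s = "bump (width C x) r s"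
  define p0 where "p0 = s r mod ?n"
  define k0 where "k0 = s r div ?n"
  \<comment> \<open>The mark is carried only from cell \<open>p0\<close> to its right neighbour.
    \<open>f'\<close> describes the marks before \<open>finish\<close>, which takes over when
    \<open>p0\<close> is the last cell and has no neighbour.\<close>
  define g where "g p = (if p = Suc p0 then Suc k0 else 0)" for p
  define f' where "f' p = unmark r (marks C R x s p) \<union> (if p = Suc p0 then {(Suc r, k0)} else {})" for p
  have W: "0 < width C x" using s by (metis gr_zeroI not_less_zero)
  have s': "\<forall>a. ?s a < width C x" using s W by (simp add: bump_def)
  have p0: "p0 \<le> length x" unfolding p0_def using mod_less_divisor[of ?n "s r"] by linarith
  have mk: "(Suc r, k) \<in> marks C R x s p \<longleftrightarrow> k = k0 \<and> p = p0" if "p \<le> length x" for k p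
    using mark_iff[of s r C x p k R] that s r by (simp add: p0_def k0_def)
  have "(mstep C R P ^^ (2 * length x + 3)) (Go (Inc r # K), tape x (marks C R x s), 0) =
         (Go (nxt (Inc r # K) (g (length x + 1))), tape x (marks C R x ?s), 0)"
  proof (rule full_sweep[OF x, where f' = f'])
    fix p assume p: "p \<le> length x"
    show "sweep (hd (Inc r # K)) (g p) (sym_at x p, marks C R x s p) = (g (Suc p), f' p)"
    proof (cases "p = p0")
      case True
      then have "(LEAST k. (Suc r, k) \<in> marks C R x s p) = k0"
        using mk[OF p] by (simp add: Least_equality)
      then show ?thesis using True mk[OF p] by (simp add: g_def f'_def)
    next
      case False
      then have "unmark r (marks C R x s p) = marks C R x s p"
        using mk[OF p] by (auto simp: unmark_def)
      then show ?thesis using False mk[OF p] by (simp add: g_def f'_def)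
    qed
    show "(0, 0) \<in> f' p \<longleftrightarrow> p = 0" by (auto simp: f'_def unmark_iff home_mark_iff)
    have v: "s r < C * (length x + 1)" using s by (simp add: width_def)
    have sr: "?s r div ?n = (if p0 = length x then Suc k0 mod C else k0)"
      "?s r mod ?n = (if p0 = length x then 0 else p0 + 1)"
      using succ_div_mod[OF v] by (simp_all add: bump_def width_def p0_def k0_def)
    have so: "?s a = s a" if "a \<noteq> r" for a using that by (simp add: bump_def)
    have F: "(f'(0 := finish C (hd (Inc r # K)) (g (length x + 1)) (f' 0))) p =
        unmark r (marks C R x s p) \<union> (if p = Suc p0 then {(Suc r, k0)} else {}) \<union>
        (if p = 0 \<and> p0 = length x then {(Suc r, Suc k0 mod C)} else {})"
      by (cases "p = 0"; cases "p0 = length x") (simp_all add: f'_def g_def)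
    have "(f'(0 := finish C (hd (Inc r # K)) (g (length x + 1)) (f' 0))) p = marks C R x ?s p"
      unfolding F
    proof (rule marks_eqI[OF _ _ s' p], goal_cases)
      case 1 show ?case by (auto simp: unmark_iff home_mark_iff)
    next
      case (2 q k)
      show ?case
      proof (cases "q = r")
        case True
        show ?thesis
        proof (cases "p0 = length x")
          case True
          show ?thesis unfolding \<open>q = r\<close> sr using True r p by (simp add: unmark_iff)
        next
          case False
          show ?thesis unfolding \<open>q = r\<close> sr using False r by (simp add: unmark_iff)
        qed
      next
        case False
        then show ?thesis using so[OF False] mark_iff[of s q C x p k R] s p by (auto simp: unmark_iff)
      qed
    qed
    then show "marks C R x ?s p = (f'(0 := finish C (hd (Inc r # K)) (g (length x + 1)) (f' 0))) p" ..
  qed (auto simp: g_def)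
  then show ?thesis by simp
qed

text \<open>Since a register has a single mark, each test can be recognised inside one cell, and a
  sweep has to remember only whether some cell passed.\<close>

lemma cell_test_iff:
  assumes s: "\<forall>r. s r < width C x" and t: "test_regs t \<subseteq> {..<R}"
  shows "(\<exists>p < length x + 1. cell_test t (sym_at x p, marks C R x s p)) \<longleftrightarrow> holds x t s"
proof -
  have mk: "(Suc r, k) \<in> marks C R x s p \<longleftrightarrow>
         r < R \<and> k = s r div (length x + 1) \<and> p = s r mod (length x + 1)" if "p < length x + 1" for r k p
    using that s by (intro mark_iff) auto
  have mod: "s r mod (length x + 1) < length x + 1" for r by simp
  have eq: "a = b" if "a div (length x + 1) = b div (length x + 1)" "a mod (length x + 1) = b mod (length x + 1)"
    for a b by (metis that div_mult_mod_eq)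
  have div0: "a div (length x + 1) = 0 \<longleftrightarrow> a \<le> length x" for a
    by (simp add: div_eq_0_iff less_Suc_eq_le)
  have mod': "a mod (length x + 1) = a" if "a \<le> length x" for a using that by simp
  show ?thesis
  proof (cases t)
    case (TEq a b)
    have "(\<exists>p < length x + 1. cell_test t (sym_at x p, marks C R x s p)) \<longleftrightarrow>
       (\<exists>p < length x + 1. s a div (length x + 1) = s b div (length x + 1) \<and>
           p = s a mod (length x + 1) \<and> p = s b mod (length x + 1))"
    proof -
      have "cell_test t (sym_at x p, marks C R x s p) \<longleftrightarrow>
          s a div (length x + 1) = s b div (length x + 1) \<and>
           p = s a mod (length x + 1) \<and> p = s b mod (length x + 1)" if "p < length x + 1" for p
        using TEq t mk[OF that] by auto
      then show ?thesis by blast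
    qed
    also have "\<dots> \<longleftrightarrow> s a = s b" using eq mod by metis
    finally show ?thesis using TEq by simp
  next
    case (TSym r v)
    have "(\<exists>p < length x + 1. cell_test t (sym_at x p, marks C R x s p)) \<longleftrightarrow>
       (\<exists>p < length x + 1. sym_at x p = v \<and> s r div (length x + 1) = 0 \<and> p = s r mod (length x + 1))"
    proof -
      have "cell_test t (sym_at x p, marks C R x s p) \<longleftrightarrow>
          sym_at x p = v \<and> s r div (length x + 1) = 0 \<and> p = s r mod (length x + 1)" if "p < length x + 1" for p
        using TSym t mk[OF that] by auto
      then show ?thesis by blast
    qed
    also have "\<dots> \<longleftrightarrow> s r \<le> length x \<and> sym_at x (s r) = v"
      unfolding div0 using mod' mod by metis
    finally show ?thesis using TSym by simp
  next
    case (TZero r)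
    have "(\<exists>p < length x + 1. cell_test t (sym_at x p, marks C R x s p)) \<longleftrightarrow>
       (s r div (length x + 1) = 0 \<and> 0 = s r mod (length x + 1))"
      using TZero t mk by (auto simp: home_mark_iff)
    also have "\<dots> \<longleftrightarrow> s r = 0"
      unfolding div0 using mod' by (metis le0)
    finally show ?thesis using TZero by simp
  qed
qed

lemma sim_cond:
  assumes x: "set x \<subseteq> {1, 2, 3}" and s: "\<forall>r. s r < width C x" and t: "test_regs t \<subseteq> {..<R}"
  shows "(mstep C R P ^^ (2 * length x + 3)) (Go (Cond t c d # K), tape x (marks C R x s), 0) =
         (Go ((if holds x t s then c else d) # K), tape x (marks C R x s), 0)"
proof -
  define g :: "nat \<Rightarrow> nat" where
    "g p = (if \<exists>i<p. cell_test t (sym_at x i, marks C R x s i) then 1 else 0)" for p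
  have "(mstep C R P ^^ (2 * length x + 3)) (Go (Cond t c d # K), tape x (marks C R x s), 0) =
         (Go (nxt (Cond t c d # K) (g (length x + 1))), tape x (marks C R x s), 0)"
    by (rule full_sweep[OF x]) (auto simp: g_def home_mark_iff less_Suc_eq)
  moreover have "g (length x + 1) = (if holds x t s then 1 else 0)"
    unfolding g_def cell_test_iff[OF s t] ..
  ultimately show ?thesis by simp
qed

lemma funpow_chain: "(f ^^ a) u = v \<Longrightarrow> (f ^^ b) v = w \<Longrightarrow> (f ^^ (a + b)) u = w"
  by (metis add.commute comp_apply funpow_add)

lemma sim_exec:
  assumes x: "set x \<subseteq> {1, 2, 3}" and C: "0 < C"
  shows "well_formed c \<Longrightarrow> regs c \<subseteq> {..<R} \<Longrightarrow> \<forall>r. s r < width C x \<Longrightarrow>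
    \<exists>t \<le> cost c (width C x) * (2 * length x + 3).
      (mstep C R P ^^ t) (Go (c # K), tape x (marks C R x s), 0) =
      (Go K, tape x (marks C R x (exec C x c s)), 0)"
proof (induction c arbitrary: s K)
  case Skip
  have "(mstep C R P ^^ 1) (Go (Skip # K), tape x (marks C R x s), 0) = (Go K, tape x (marks C R x s), 0)"
    using tape_at[of 0 x "marks C R x s"] tape_upd[of 0 x "marks C R x s" "marks C R x s 0"]
    by (simp add: gstep_def)
  moreover have "1 \<le> cost Skip (width C x) * (2 * length x + 3)" by simp
  ultimately show ?case by (metis exec.simps(1))
next
  case (Zero r)
  have "(mstep C R P ^^ (2 * length x + 3)) (Go (Zero r # K), tape x (marks C R x s), 0) =
         (Go K, tape x (marks C R x (exec C x (Zero r) s)), 0)"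
    using sim_zero[OF x _ C, of s r R P K] Zero by simp
  moreover have "2 * length x + 3 \<le> cost (Zero r) (width C x) * (2 * length x + 3)" by simp
  ultimately show ?case by blast
next
  case (Copy r q)
  have "(mstep C R P ^^ (2 * length x + 3)) (Go (Copy r q # K), tape x (marks C R x s), 0) =
         (Go K, tape x (marks C R x (exec C x (Copy r q) s)), 0)"
    using sim_copy[OF x, of s C r R q P K] Copy by simp
  moreover have "2 * length x + 3 \<le> cost (Copy r q) (width C x) * (2 * length x + 3)" by simp
  ultimately show ?case by blast
next
  case (Inc r)
  have "(mstep C R P ^^ (2 * length x + 3)) (Go (Inc r # K), tape x (marks C R x s), 0) =
         (Go K, tape x (marks C R x (exec C x (Inc r) s)), 0)"
    using sim_inc[OF x, of s C r R P K] Inc by simp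
  moreover have "2 * length x + 3 \<le> cost (Inc r) (width C x) * (2 * length x + 3)" by simp
  ultimately show ?case by blast
next
  case (Seq c d)
  have 1: "(mstep C R P ^^ 1) (Go (Seq c d # K), tape x (marks C R x s), 0) =
      (Go (c # d # K), tape x (marks C R x s), 0)"
    using tape_at[of 0 x "marks C R x s"] tape_upd[of 0 x "marks C R x s" "marks C R x s 0"]
    by (simp add: gstep_def)
  obtain t1 where t1: "t1 \<le> cost c (width C x) * (2 * length x + 3)"
      "(mstep C R P ^^ t1) (Go (c # d # K), tape x (marks C R x s), 0) =
      (Go (d # K), tape x (marks C R x (exec C x c s)), 0)"
    using Seq.IH(1)[of s "d # K"] Seq.prems by auto
  obtain t2 where t2: "t2 \<le> cost d (width C x) * (2 * length x + 3)"
      "(mstep C R P ^^ t2) (Go (d # K), tape x (marks C R x (exec C x c s)), 0) =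
      (Go K, tape x (marks C R x (exec C x d (exec C x c s))), 0)"
    using Seq.IH(2)[of "exec C x c s" K] Seq.prems exec_bound[OF C] by auto
  have "(mstep C R P ^^ (1 + (t1 + t2))) (Go (Seq c d # K), tape x (marks C R x s), 0) =
      (Go K, tape x (marks C R x (exec C x (Seq c d) s)), 0)"
    unfolding exec.simps by (rule funpow_chain[OF 1 funpow_chain[OF t1(2) t2(2)]])
  moreover have "1 + (t1 + t2) \<le> cost (Seq c d) (width C x) * (2 * length x + 3)"
    using t1(1) t2(1) by (simp add: algebra_simps)
  ultimately show ?case by blast
next
  case (Cond t c d)
  define e where "e = (if holds x t s then c else d)"
  have 1: "(mstep C R P ^^ (2 * length x + 3)) (Go (Cond t c d # K), tape x (marks C R x s), 0) =
         (Go (e # K), tape x (marks C R x s), 0)"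
    unfolding e_def using sim_cond[OF x, of s C t R P c d K] Cond.prems by simp
  obtain t1 where t1: "t1 \<le> cost e (width C x) * (2 * length x + 3)"
      "(mstep C R P ^^ t1) (Go (e # K), tape x (marks C R x s), 0) =
      (Go K, tape x (marks C R x (exec C x e s)), 0)"
    using Cond.IH(1)[of s "K"] Cond.IH(2)[of s K] Cond.prems unfolding e_def
    by (cases "holds x t s") auto
  have "exec C x (Cond t c d) s = exec C x e s" by (simp add: e_def)
  then have "(mstep C R P ^^ (2 * length x + 3 + t1)) (Go (Cond t c d # K), tape x (marks C R x s), 0) =
      (Go K, tape x (marks C R x (exec C x (Cond t c d) s)), 0)"
    by (simp only:) (rule funpow_chain[OF 1 t1(2)])
  moreover have "2 * length x + 3 + t1 \<le> cost (Cond t c d) (width C x) * (2 * length x + 3)"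
  proof -
    have "cost e (width C x) * (2 * length x + 3) \<le>
        (cost c (width C x) + cost d (width C x)) * (2 * length x + 3)"
      by (rule mult_le_mono1) (simp add: e_def)
    then show ?thesis using t1(1) by (simp add: algebra_simps)
  qed
  ultimately show ?case by blast
next
  case (Loop i c)
  let ?W = "width C x" and ?D = "2 * length x + 3"
  let ?body = "\<lambda>s. bump (width C x) i (exec C x c s)"
  \<comment> \<open>\<open>n\<close> counts the rounds left. The body does not touch
    \<open>i\<close>, so the increment yields 0 exactly in the last round, where the machine leaves
    the loop. There is at least one round because every register value is below
    \<open>?W\<close>.\<close>
  have "\<exists>t \<le> (1 + n * (cost c ?W + 4)) * ?D.
      (mstep C R P ^^ t) (Go (Loop i c # K), tape x (marks C R x s), 0) =
      (Go K, tape x (marks C R x ((?body ^^ n) s)), 0)"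
    if "0 < n" "n + s i = ?W" "\<forall>r. s r < ?W" for n s
    using that
  proof (induction n arbitrary: s)
    case (Suc n)
    let ?s1 = "exec C x c s" and ?s2 = "?body s"
    have s1: "\<forall>r. ?s1 r < ?W" using exec_bound[OF C] Suc.prems by blast
    have s2: "\<forall>r. ?s2 r < ?W" using s1 Suc.prems by (auto simp: bump_def)
    have i: "?s1 i = s i" using Loop.prems by (intro exec_unwritten) auto
    have 1: "(mstep C R P ^^ 1) (Go (Loop i c # K), tape x (marks C R x s), 0) =
        (Go (c # unfold_loop i c K), tape x (marks C R x s), 0)"
      using tape_at[of 0 x "marks C R x s"] tape_upd[of 0 x "marks C R x s" "marks C R x s 0"]
      by (simp add: gstep_def)
    obtain t1 where t1: "t1 \<le> cost c ?W * ?D"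
      "(mstep C R P ^^ t1) (Go (c # unfold_loop i c K), tape x (marks C R x s), 0) =
      (Go (unfold_loop i c K), tape x (marks C R x ?s1), 0)"
      using Loop.IH[of s "unfold_loop i c K"] Loop.prems Suc.prems by auto
    have 2: "(mstep C R P ^^ ?D) (Go (unfold_loop i c K), tape x (marks C R x ?s1), 0) =
      (Go (Cond (TZero i) Skip (Loop i c) # K), tape x (marks C R x ?s2), 0)"
      using sim_inc[OF x s1, of i R P] Loop.prems by simp
    have 3: "(mstep C R P ^^ ?D) (Go (Cond (TZero i) Skip (Loop i c) # K), tape x (marks C R x ?s2), 0) =
      (Go ((if ?s2 i = 0 then Skip else Loop i c) # K), tape x (marks C R x ?s2), 0)"
      using sim_cond[OF x s2, of "TZero i" R P] Loop.prems by simp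
    have "\<exists>t \<le> (1 + n * (cost c ?W + 4)) * ?D.
      (mstep C R P ^^ t) (Go ((if ?s2 i = 0 then Skip else Loop i c) # K), tape x (marks C R x ?s2), 0) =
      (Go K, tape x (marks C R x ((?body ^^ n) ?s2)), 0)"
    proof (cases "n = 0")
      case True
      then have "?s2 i = 0" using Suc.prems i by (simp add: bump_def)
      moreover have "(mstep C R P ^^ 1) (Go (Skip # K), tape x (marks C R x ?s2), 0) =
          (Go K, tape x (marks C R x ?s2), 0)"
        using tape_at[of 0 x "marks C R x ?s2"] tape_upd[of 0 x "marks C R x ?s2" "marks C R x ?s2 0"]
        by (simp add: gstep_def)
      ultimately show ?thesis using True by (intro exI[of _ 1]) simp
    next
      case False
      then have v: "?s2 i = s i + 1" using Suc.prems i by (simp add: bump_def)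
      then show ?thesis using Suc.IH[OF _ _ s2] False Suc.prems by simp
    qed
    then obtain t2 where t2: "t2 \<le> (1 + n * (cost c ?W + 4)) * ?D"
      "(mstep C R P ^^ t2) (Go ((if ?s2 i = 0 then Skip else Loop i c) # K), tape x (marks C R x ?s2), 0) =
      (Go K, tape x (marks C R x ((?body ^^ n) ?s2)), 0)" by blast
    have "(mstep C R P ^^ (1 + (t1 + (?D + (?D + t2))))) (Go (Loop i c # K), tape x (marks C R x s), 0) =
      (Go K, tape x (marks C R x ((?body ^^ Suc n) s)), 0)"
      unfolding funpow_Suc_right o_apply
      by (rule funpow_chain[OF 1 funpow_chain[OF t1(2) funpow_chain[OF 2 funpow_chain[OF 3 t2(2)]]]])
    moreover have "1 + (t1 + (?D + (?D + t2))) \<le> (1 + Suc n * (cost c ?W + 4)) * ?D"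
      using t1(1) t2(1) by (simp add: algebra_simps)
    ultimately show ?case by blast
  qed simp
  from this[of "?W - s i" s] obtain t where t: "t \<le> (1 + (?W - s i) * (cost c ?W + 4)) * ?D"
      "(mstep C R P ^^ t) (Go (Loop i c # K), tape x (marks C R x s), 0) =
      (Go K, tape x (marks C R x ((?body ^^ (?W - s i)) s)), 0)"
    using Loop.prems(3) by (auto simp: less_imp_le)
  have "(1 + (?W - s i) * (cost c ?W + 4)) * ?D \<le> cost (Loop i c) ?W * ?D"
    by (intro mult_le_mono1) simp
  from order.trans[OF t(1) this] t(2) show ?case unfolding exec.simps by blast
qed

subsection \<open>Polynomial time\<close>

text \<open>With base \<open>n + 1\<close> every power is at least 1, so sums and products keep this
  form by adding the exponents.\<close>

definition poly_bounded :: "(nat \<Rightarrow> nat) \<Rightarrow> bool" where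
  "poly_bounded f \<longleftrightarrow> (\<exists>a k. \<forall>n. f n \<le> a * (n + 1) ^ k)"

lemma poly_bounded_const: "poly_bounded (\<lambda>n. c)"
  unfolding poly_bounded_def by (rule exI[of _ c], rule exI[of _ 0]) simp

lemma poly_bounded_id: "poly_bounded (\<lambda>n. n)"
  unfolding poly_bounded_def by (rule exI[of _ 1], rule exI[of _ 1]) simp

lemma poly_bounded_mult: "poly_bounded f \<Longrightarrow> poly_bounded g \<Longrightarrow> poly_bounded (\<lambda>n. f n * g n)"
proof -
  assume "poly_bounded f" "poly_bounded g"
  then obtain a k b l where "\<And>n. f n \<le> a * (n + 1) ^ k" "\<And>n. g n \<le> b * (n + 1) ^ l"
    unfolding poly_bounded_def by blast
  then have "f n * g n \<le> (a * (n + 1) ^ k) * (b * (n + 1) ^ l)" for n by (rule mult_le_mono)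
  then have "f n * g n \<le> (a * b) * (n + 1) ^ (k + l)" for n
    by (metis (no_types, lifting) power_add mult.assoc mult.left_commute)
  then show ?thesis unfolding poly_bounded_def by blast
qed

lemma poly_bounded_add: "poly_bounded f \<Longrightarrow> poly_bounded g \<Longrightarrow> poly_bounded (\<lambda>n. f n + g n)"
proof -
  assume "poly_bounded f" "poly_bounded g"
  then obtain a k b l where f: "\<And>n. f n \<le> a * (n + 1) ^ k" and g: "\<And>n. g n \<le> b * (n + 1) ^ l"
    unfolding poly_bounded_def by blast
  have "f n + g n \<le> (a + b) * (n + 1) ^ (k + l)" for n
  proof -
    have "a * (n + 1) ^ k \<le> a * (n + 1) ^ (k + l)" "b * (n + 1) ^ l \<le> b * (n + 1) ^ (k + l)"
      by (intro mult_le_mono2 power_increasing; simp)+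
    then show ?thesis using f[of n] g[of n] unfolding add_mult_distrib by linarith
  qed
  then show ?thesis unfolding poly_bounded_def by blast
qed

lemma poly_bounded_cost: "poly_bounded (\<lambda>n. cost c (C * (n + 1)))"
  by (induction c)
    (simp_all add: poly_bounded_const poly_bounded_add poly_bounded_mult poly_bounded_id
      del: One_nat_def add_Suc_right)

lemma poly_bounded_standard:
  assumes "poly_bounded f"
  obtains c k where "\<And>n. f n \<le> c * n ^ k + c"
proof -
  obtain a k where f: "\<And>n. f n \<le> a * (n + 1) ^ k" using assms unfolding poly_bounded_def by blast
  \<comment> \<open>For positive \<open>n\<close> this follows from
    \<open>n + 1 \<le> 2 * n\<close>; the separate summand covers \<open>n = 0\<close>.\<close>
  have "(n + 1) ^ k \<le> 2 ^ k * n ^ k + 2 ^ k" for n :: nat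
  proof (cases "n = 0")
    case False
    then have "(n + 1) ^ k \<le> (2 * n) ^ k" by (intro power_mono) auto
    then show ?thesis by (simp add: power_mult_distrib)
  qed (simp add: trans_le_add2)
  then have "a * (n + 1) ^ k \<le> a * (2 ^ k * n ^ k + 2 ^ k)" for n by (rule mult_le_mono2)
  then have "f n \<le> (a * 2 ^ k) * n ^ k + a * 2 ^ k" for n
    using f[of n] by (metis (no_types, lifting) add_mult_distrib2 mult.assoc order.trans)
  then show thesis using that by blast
qed

text \<open>The largest number that a sweep remembers is \<open>Suc k\<close> for a band
  \<open>k < C\<close>, so the memory stays within \<open>{..C}\<close>.\<close>

lemma mdelta_closed:
  assumes C: "0 < C" and R: "regs P \<subseteq> {..<R}"
    and q: "q \<in> {Start, Acc, Rej} \<union> Go ` insert [] (conts P []) \<union>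
       (\<lambda>(K, n). Rt K n) ` (conts P [] \<times> {..C}) \<union> (\<lambda>(K, n). Lf K n) ` (conts P [] \<times> {..C})" (is "q \<in> ?Q")
    and c: "c \<in> {..<4} \<times> Pow (insert (0, 0) ((Suc ` {..<R}) \<times> {..<C}))" (is "c \<in> {..<4} \<times> Pow ?U")
    and D: "mdelta C R P q c = (q', c', d)"
  shows "q' \<in> ?Q \<and> c' \<in> {..<4} \<times> Pow ?U \<and> d \<in> {-1, 0, 1}"
proof -
  obtain z M where zM: "c = (z, M)" by (cases c)
  then have z: "z < 4" and M: "M \<subseteq> ?U" using c by auto
  have nxt: "nxt K n \<in> insert [] (conts P [])" if "K \<in> conts P []" for K n
    using nxt_conts[OF that] by auto
  from q consider "q = Start" | "q = Acc" | "q = Rej" | "q = Go []"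
    | K where "q = Go K" "K \<in> conts P []" | K n where "q = Rt K n" "K \<in> conts P []" "n \<le> C"
    | K n where "q = Lf K n" "K \<in> conts P []" "n \<le> C" by auto
  then show ?thesis
  proof cases
    case 1 then show ?thesis using D zM z M conts_self[of P "[]"] C by auto
  next
    case 5
    then show ?thesis using D zM z M C nxt[of K 0] regs_conts[of K P "[]"] by (auto split: if_splits)
  next
    case (6 K n)
    obtain n' M' where sw: "sweep (hd K) n (z, M) = (n', M')" by (cases "sweep (hd K) n (z, M)")
    have r: "regs (hd K) \<subseteq> {..<R}" using regs_conts[OF 6(2)] R by blast
    have "n' \<le> C \<and> M' \<subseteq> ?U"
    proof (cases "hd K")
      case (Inc r)
      show ?thesis
      proof (cases "\<exists>k. (Suc r, k) \<in> M")
        case True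
        then have "(Suc r, LEAST k. (Suc r, k) \<in> M) \<in> M" by (auto intro: LeastI)
        then have "(LEAST k. (Suc r, k) \<in> M) < C" using M by auto
        then show ?thesis using sw Inc True M by (auto simp: unmark_def)
      next
        case False
        then show ?thesis using sw Inc r M C \<open>n \<le> C\<close> by (auto split: if_splits)
      qed
    qed (use sw r M C 6(3) in \<open>auto simp: unmark_def split: if_splits\<close>)
    then show ?thesis using D zM z sw 6 by (auto split: if_splits)
  next
    case (7 K n)
    have r: "regs (hd K) \<subseteq> {..<R}" using regs_conts[OF 7(2)] R by blast
    have "finish C (hd K) n M \<subseteq> ?U"
      by (cases "hd K") (use r M C in auto)
    then show ?thesis using D zM z M 7 nxt[OF 7(2), of n] by (auto split: if_splits)
  qed (use D zM z M in \<open>auto split: if_splits\<close>)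
qed

theorem program_poly_time:
  assumes C: "0 < C" and P: "well_formed P"
  shows "\<exists>M c k. wf_tm M \<and> (\<forall>x. set x \<subseteq> {1, 2, 3} \<longrightarrow>
      halts_within M x (c * length x ^ k + c) \<and> (accepts M x \<longleftrightarrow> exec C x P (\<lambda>_. 0) 0 \<noteq> 0))"
proof -
  \<comment> \<open>Register 0 is included even if the program does not mention it, because the
    verdict is read from it.\<close>
  define R where "R = Suc (Max (insert 0 (regs P)))"
  have R: "regs P \<subseteq> {..<R}"
    using finite_regs[of P] by (auto simp: R_def less_Suc_eq_le)
  define Q where "Q = {Start, Acc, Rej} \<union> Go ` insert [] (conts P []) \<union>
       (\<lambda>(K, n). Rt K n) ` (conts P [] \<times> {..C}) \<union> (\<lambda>(K, n). Lf K n) ` (conts P [] \<times> {..C})"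
  define S :: "cell set" where "S = {..<4} \<times> Pow (insert (0, 0) ((Suc ` {..<R}) \<times> {..<C}))"
  have "\<exists>M. wf_tm M \<and> (\<forall>x t. set x \<subseteq> {1, 2, 3} \<longrightarrow>
     (fst (run M x t) = qacc M \<longleftrightarrow> fst ((mstep C R P ^^ t) (ginit (\<lambda>a. (a, {})) Start x)) = Acc) \<and>
     (fst (run M x t) = qrej M \<longleftrightarrow> fst ((mstep C R P ^^ t) (ginit (\<lambda>a. (a, {})) Start x)) = Rej))"
  proof (rule tm_of_finite_machine[where Q = Q and S = S])
    show "finite Q" "finite S" by (auto simp: Q_def S_def finite_conts)
    show "q' \<in> Q \<and> s' \<in> S \<and> d \<in> {-1, 0, 1}"
      if "q \<in> Q" "s \<in> S" "mdelta C R P q s = (q', s', d)" for q s q' s' d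
      by (rule mdelta_closed[OF C R, folded Q_def S_def, OF that])
  qed (auto simp: Q_def S_def inj_on_def)
  then obtain M where M: "wf_tm M" and sim: "\<And>x t. set x \<subseteq> {1, 2, 3} \<Longrightarrow>
     (fst (run M x t) = qacc M \<longleftrightarrow> fst ((mstep C R P ^^ t) (ginit (\<lambda>a. (a, {})) Start x)) = Acc) \<and>
     (fst (run M x t) = qrej M \<longleftrightarrow> fst ((mstep C R P ^^ t) (ginit (\<lambda>a. (a, {})) Start x)) = Rej)"
    by blast
  have "poly_bounded (\<lambda>n. cost P (C * (n + 1)) * (2 * n + 3) + 2)"
    by (intro poly_bounded_add poly_bounded_mult poly_bounded_cost poly_bounded_const poly_bounded_id)
  then obtain c k where ck: "\<And>n. cost P (C * (n + 1)) * (2 * n + 3) + 2 \<le> c * n ^ k + c"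
    by (rule poly_bounded_standard) blast
  have "halts_within M x (c * length x ^ k + c) \<and> (accepts M x \<longleftrightarrow> exec C x P (\<lambda>_. 0) 0 \<noteq> 0)"
    if x: "set x \<subseteq> {1, 2, 3}" for x
  proof -
    let ?s = "exec C x P (\<lambda>_. 0)"
    let ?A = "if ?s 0 \<noteq> 0 then Acc else Rej"
    let ?init = "ginit (\<lambda>a. (a, {})) Start x"
    have s0: "\<forall>r. (\<lambda>_. 0 :: nat) r < width C x" using C by (simp add: width_def)
    have s1: "\<forall>r. ?s r < width C x" using exec_bound[OF C s0] .
    have "(0 = k * n + p) \<longleftrightarrow> (k = 0 \<or> n = 0) \<and> p = 0" for k n p :: nat by auto
    then have m0: "marks C R x (\<lambda>_. 0) = (\<lambda>_. {})(0 := insert (0, 0) ((\<lambda>r. (Suc r, 0)) ` {..<R}))"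
      using C by (auto simp: marks_def fun_eq_iff)
    have "(tape x (\<lambda>_. {})) (0 := (sym_at x 0, insert (0, 0) ((\<lambda>r. (Suc r, 0)) ` {..<R})))
        = tape x (marks C R x (\<lambda>_. 0))"
      unfolding m0 using tape_upd[of 0 x "\<lambda>_. {}"] by simp
    moreover have "?init = (Start, tape x (\<lambda>_. {}), 0)"
      by (auto simp: ginit_def tape_def sym_at_def fun_eq_iff nat_less_iff)
    ultimately have 1: "(mstep C R P ^^ 1) ?init = (Go [P], tape x (marks C R x (\<lambda>_. 0)), 0)"
      using tape_at[of 0 x "\<lambda>_. {}"] by (simp add: gstep_def)
    obtain t where t: "t \<le> cost P (width C x) * (2 * length x + 3)"
      "(mstep C R P ^^ t) (Go [P], tape x (marks C R x (\<lambda>_. 0)), 0) = (Go [], tape x (marks C R x ?s), 0)"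
      using sim_exec[OF x C P R s0] by blast
    have "(Suc 0, 0) \<in> marks C R x ?s 0 \<longleftrightarrow> ?s 0 = 0"
      using C by (simp add: marks_def R_def)
    then have 3: "(mstep C R P ^^ 1) (Go [], tape x (marks C R x ?s), 0) = (?A, tape x (marks C R x ?s), 0)"
      using tape_at[of 0 x "marks C R x ?s"] tape_upd[of 0 x "marks C R x ?s" "marks C R x ?s 0"]
      by (simp add: gstep_def)
    have run: "(mstep C R P ^^ (1 + (t + 1))) ?init = (?A, tape x (marks C R x ?s), 0)"
      by (rule funpow_chain[OF 1 funpow_chain[OF t(2) 3]])
    have stay: "(mstep C R P ^^ n) (?A, T, h) = (?A, T, h)" for n T h
      by (induction n) (auto simp: gstep_def)
    \<comment> \<open>Halting states are absorbing, so the state at any later time, in particular at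
      the polynomial bound, is the verdict.\<close>
    have late: "fst ((mstep C R P ^^ n) ?init) = ?A" if "1 + (t + 1) \<le> n" for n
      using funpow_chain[OF run stay[of "n - (1 + (t + 1))"]] le_add_diff_inverse[OF that]
      by (simp only: fst_conv)
    have "1 + (t + 1) \<le> c * length x ^ k + c"
      using t(1) ck[of "length x"] unfolding width_def by linarith
    then have "fst ((mstep C R P ^^ (c * length x ^ k + c)) ?init) = ?A" by (rule late)
    then have halt: "halts_within M x (c * length x ^ k + c)"
      unfolding halts_within_def using sim[OF x] by (auto split: if_splits)
    have "accepts M x \<longleftrightarrow> (\<exists>n. fst ((mstep C R P ^^ n) ?init) = Acc)"
      unfolding accepts_def using sim[OF x] by blast
    also have "\<dots> \<longleftrightarrow> ?s 0 \<noteq> 0"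
    proof
      assume "\<exists>n. fst ((mstep C R P ^^ n) ?init) = Acc"
      then obtain n where n: "fst ((mstep C R P ^^ n) ?init) = Acc" by blast
      obtain T h where "(mstep C R P ^^ n) ?init = (Acc, T, h)"
        using n by (cases "(mstep C R P ^^ n) ?init") auto
      moreover have "(mstep C R P ^^ m) (Acc, T, h) = (Acc, T, h)" for m
        by (induction m) (auto simp: gstep_def)
      ultimately have "(mstep C R P ^^ (n + (1 + (t + 1)))) ?init = (Acc, T, h)"
        by (rule funpow_chain)
      then have "?A = Acc" using late[of "n + (1 + (t + 1))"] by simp
      then show "?s 0 \<noteq> 0" by (auto split: if_splits)
    next
      assume "?s 0 \<noteq> 0"
      then show "\<exists>n. fst ((mstep C R P ^^ n) ?init) = Acc" using late by (metis order.refl)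
    qed
    finally show ?thesis using halt by blast
  qed
  then show ?thesis using M by blast
qed

subsection \<open>Definable functions\<close>

text \<open>Environments work like de Bruijn indices: binding a variable conses its value, and
  \<open>drop n\<close> discards the \<open>n\<close> innermost bindings.\<close>

definition arg :: "nat list \<Rightarrow> nat \<Rightarrow> nat" where
  "arg e i = (if i < length e then e ! i else 0)"

lemma arg_Cons_0 [simp]: "arg (v # e) 0 = v"
  and arg_Cons_Suc [simp]: "arg (v # e) (Suc i) = arg e i"
  and arg_drop [simp]: "arg (drop n e) i = arg e (n + i)"
  by (auto simp: arg_def)

locale machine =
  fixes C :: nat
  assumes C: "3 \<le> C"
begin

text \<open>The generated program reads its arguments from the registers rs, puts the result into register b and
  writes to no register below b.\<close>

definition computes :: "(nat list \<Rightarrow> nat list \<Rightarrow> nat) \<Rightarrow> (nat list \<Rightarrow> nat \<Rightarrow> com) \<Rightarrow> bool" where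
  "computes f G \<longleftrightarrow> (\<forall>rs b. (\<forall>r\<in>set rs. r < b) \<longrightarrow>
     well_formed (G rs b) \<and> writes (G rs b) \<subseteq> {b..} \<and>
     (\<forall>x s. set x \<subseteq> {1, 2, 3} \<longrightarrow> (\<forall>r. s r < width C x) \<longrightarrow> exec C x (G rs b) s b = f x (map s rs)))"

definition definable :: "(nat list \<Rightarrow> nat list \<Rightarrow> nat) \<Rightarrow> bool" where
  "definable f \<longleftrightarrow> (\<exists>G. computes f G)"

definition decidable :: "(nat list \<Rightarrow> nat list \<Rightarrow> bool) \<Rightarrow> bool" where
  "decidable p \<longleftrightarrow> definable (\<lambda>x e. if p x e then 1 else 0)"

definition good :: "nat list \<Rightarrow> nat list \<Rightarrow> bool" where
  "good x e \<longleftrightarrow> set x \<subseteq> {1, 2, 3} \<and> (\<forall>v\<in>set e. v < width C x)"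

lemma C_le_width: "C \<le> width C x"
  by (simp add: width_def)

lemma computes_static:
  assumes "computes f G" "\<forall>r\<in>set rs. r < b"
  shows "well_formed (G rs b)" "writes (G rs b) \<subseteq> {b..}"
  using assms unfolding computes_def by blast+

lemma computes_exec:
  assumes "computes f G" "\<forall>r\<in>set rs. r < b" "set x \<subseteq> {1, 2, 3}" "\<forall>r. s r < width C x"
  shows "exec C x (G rs b) s b = f x (map s rs)"
    and "r < b \<Longrightarrow> exec C x (G rs b) s r = s r"
    and "\<forall>r. exec C x (G rs b) s r < width C x"
proof -
  show "exec C x (G rs b) s b = f x (map s rs)" using assms unfolding computes_def by blast
  show "exec C x (G rs b) s r = s r" if "r < b"
    using computes_static(2)[OF assms(1,2)] that by (intro exec_unwritten) auto
  show "\<forall>r. exec C x (G rs b) s r < width C x"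
    using exec_bound[OF _ assms(4)] C by simp
qed

lemma definableI:
  assumes "\<And>rs b. \<forall>r\<in>set rs. r < b \<Longrightarrow> well_formed (G rs b)"
    and "\<And>rs b. \<forall>r\<in>set rs. r < b \<Longrightarrow> writes (G rs b) \<subseteq> {b..}"
    and "\<And>rs b x s. \<forall>r\<in>set rs. r < b \<Longrightarrow> set x \<subseteq> {1, 2, 3} \<Longrightarrow> \<forall>r. s r < width C x \<Longrightarrow>
        exec C x (G rs b) s b = f x (map s rs)"
  shows "definable f"
  using assms unfolding definable_def computes_def by blast

text \<open>Agreement is required only where the arguments fit into registers. This is how
  arithmetic modulo \<open>width\<close> becomes exact arithmetic once a bound is known.\<close>

lemma definable_cong:
  assumes "definable f" "\<And>x e. good x e \<Longrightarrow> f x e = g x e"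
  shows "definable g"
proof -
  obtain G where G: "computes f G" using assms(1) unfolding definable_def by blast
  show ?thesis
  proof (rule definableI[of G])
    fix rs :: "nat list" and b :: nat and x :: "nat list" and s :: "nat \<Rightarrow> nat"
    assume *: "\<forall>r\<in>set rs. r < b" "set x \<subseteq> {1, 2, 3}" "\<forall>r. s r < width C x"
    then have "good x (map s rs)" by (auto simp: good_def)
    then show "exec C x (G rs b) s b = g x (map s rs)"
      using computes_exec(1)[OF G *] assms(2) by simp
  qed (use computes_static[OF G] in auto)
qed

lemma definable_arg: "definable (\<lambda>x e. arg e i)"
proof (rule definableI[of "\<lambda>rs b. if i < length rs then Copy b (rs ! i) else Zero b"])
qed (auto simp: arg_def)

lemma definable_const:
  assumes "n < C" shows "definable (\<lambda>x e. n)"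
  using assms
proof (induction n)
  case 0 show ?case by (rule definableI[of "\<lambda>rs b. Zero b"]) auto
next
  case (Suc n)
  then obtain G where G: "computes (\<lambda>x e. n) G" by (auto simp: definable_def)
  show ?case
  proof (rule definableI[of "\<lambda>rs b. Seq (G rs b) (Inc b)"], goal_cases)
    case (3 rs b x s)
    then have "exec C x (G rs b) s b = n" using computes_exec(1)[OF G] by simp
    moreover have "Suc n < width C x" using Suc.prems C_le_width[of x] by linarith
    ultimately show ?case by (simp add: bump_def)
  qed (use computes_static[OF G] in auto)
qed

lemma definable_Suc_mod:
  assumes "definable f" shows "definable (\<lambda>x e. Suc (f x e) mod width C x)"
proof -
  obtain G where G: "computes f G" using assms unfolding definable_def by blast
  show ?thesis
    by (rule definableI[of "\<lambda>rs b. Seq (G rs b) (Inc b)"])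
      (use computes_static[OF G] computes_exec(1)[OF G] in \<open>auto simp: bump_def\<close>)
qed

lemma definable_drop:
  assumes "definable f" shows "definable (\<lambda>x e. f x (drop n e))"
proof -
  obtain G where G: "computes f G" using assms unfolding definable_def by blast
  have sub: "\<forall>r\<in>set (drop n rs). r < b" if "\<forall>r\<in>set rs. r < b" for rs and b :: nat
    using that by (meson in_set_dropD)
  show ?thesis
    by (rule definableI[of "\<lambda>rs b. G (drop n rs) b"])
      (use computes_static[OF G sub] computes_exec(1)[OF G sub] in \<open>auto simp: drop_map\<close>)
qed

lemma definable_if_eq:
  assumes "definable f" "definable g" "definable h" "definable k"
  shows "definable (\<lambda>x e. if f x e = g x e then h x e else k x e)"
proof -
  obtain Gf Gg Gh Gk where G: "computes f Gf" "computes g Gg" "computes h Gh" "computes k Gk"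
    using assms unfolding definable_def by blast
  show ?thesis
  proof (rule definableI[of "\<lambda>rs b. Seq (Gf rs b) (Seq (Gg rs (Suc b)) (Cond (TEq b (Suc b)) (Gh rs b) (Gk rs b)))"], goal_cases)
    case (1 rs b)
    then have "\<forall>r\<in>set rs. r < Suc b" by (simp add: less_SucI)
    with 1 show ?case using G by (simp add: computes_static)
  next
    case (2 rs b)
    then have "\<forall>r\<in>set rs. r < Suc b" by (simp add: less_SucI)
    with 2 show ?case using computes_static(2)[OF G(1) 2] computes_static(2)[OF G(2), of rs "Suc b"]
        computes_static(2)[OF G(3) 2] computes_static(2)[OF G(4) 2] by fastforce
  next
    case (3 rs b x s)
    let ?s1 = "exec C x (Gf rs b) s" let ?s2 = "exec C x (Gg rs (Suc b)) ?s1"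
    have rs': "\<forall>r\<in>set rs. r < Suc b" using 3 by (simp add: less_SucI)
    note e1 = computes_exec[OF G(1) 3]
    note e2 = computes_exec[OF G(2) rs' 3(2) e1(3)]
    have m1: "map ?s1 rs = map s rs" using 3(1) e1(2) by simp
    have m2: "map ?s2 rs = map s rs" using 3(1) e1(2) e2(2) by (simp add: less_SucI)
    have "?s2 b = f x (map s rs)" "?s2 (Suc b) = g x (map s rs)"
      using e1(1) e2(1) e2(2)[of b] m1 by simp_all
    then show ?case
      using computes_exec(1)[OF G(3) 3(1,2) e2(3)] computes_exec(1)[OF G(4) 3(1,2) e2(3)] m2 by simp
  qed
qed

lemma definable_if_sym:
  assumes "definable f" "definable h" "definable k" "v \<noteq> 0"
  shows "definable (\<lambda>x e. if sym_at x (f x e) = v then h x e else k x e)"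
proof -
  obtain Gf Gh Gk where G: "computes f Gf" "computes h Gh" "computes k Gk"
    using assms unfolding definable_def by blast
  show ?thesis
  proof (rule definableI[of "\<lambda>rs b. Seq (Gf rs b) (Cond (TSym b v) (Gh rs b) (Gk rs b))"], goal_cases)
    case (1 rs b) then show ?case using G by (simp add: computes_static)
  next
    case (2 rs b)
    then show ?case using computes_static(2)[OF G(1) 2]
        computes_static(2)[OF G(2) 2] computes_static(2)[OF G(3) 2] by fastforce
  next
    case (3 rs b x s)
    let ?s1 = "exec C x (Gf rs b) s"
    note e1 = computes_exec[OF G(1) 3]
    have m1: "map ?s1 rs = map s rs" using 3(1) e1(2) by simp
    have "sym_at x p = v \<Longrightarrow> p \<le> length x" for p
      using assms(4) by (auto simp: sym_at_def split: if_splits)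
    then show ?case
      using computes_exec(1)[OF G(2) 3(1,2) e1(3)] computes_exec(1)[OF G(3) 3(1,2) e1(3)] m1 e1(1) by auto
  qed
qed

text \<open>The value of \<open>g\<close> stays in register \<open>b\<close> as a new argument while
  \<open>f\<close> is evaluated above it. Discarding \<open>n\<close> bindings at the same time
  allows a function that was shown definable in its own environment to be called under further bound
  variables.\<close>

lemma definable_let:
  assumes "definable f" "definable g"
  shows "definable (\<lambda>x e. f x (g x e # drop n e))"
proof -
  obtain Gf Gg where G: "computes f Gf" "computes g Gg"
    using assms unfolding definable_def by blast
  show ?thesis
  proof (rule definableI[of "\<lambda>rs b. Seq (Gg rs b) (Seq (Gf (b # drop n rs) (Suc b)) (Copy b (Suc b)))"], goal_cases)
    case (1 rs b)
    then have "\<forall>r\<in>set (b # drop n rs). r < Suc b" by (auto dest!: in_set_dropD simp: less_SucI)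
    with 1 show ?case using G by (simp add: computes_static)
  next
    case (2 rs b)
    then have "\<forall>r\<in>set (b # drop n rs). r < Suc b" by (auto dest!: in_set_dropD simp: less_SucI)
    then have "writes (Gf (b # drop n rs) (Suc b)) \<subseteq> {Suc b..}" by (rule computes_static(2)[OF G(1)])
    also have "{Suc b..} \<subseteq> {b..}" by auto
    finally show ?case using computes_static(2)[OF G(2) 2] by simp
  next
    case (3 rs b x s)
    let ?s1 = "exec C x (Gg rs b) s"
    have rs': "\<forall>r\<in>set (b # drop n rs). r < Suc b" using 3 by (auto dest!: in_set_dropD simp: less_SucI)
    note e1 = computes_exec[OF G(2) 3]
    have "map ?s1 (drop n rs) = drop n (map s rs)" using 3(1) e1(2) by (auto dest: in_set_dropD simp: drop_map)
    then show ?case using computes_exec(1)[OF G(1) rs' 3(2) e1(3)] e1(1) by (simp del: map_eq_conv)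
  qed
qed

lemma definable_comp1:
  assumes "definable (\<lambda>x e. F x (arg e 0))" "definable g"
  shows "definable (\<lambda>x e. F x (g x e))"
  using definable_let[OF assms, of 0] by simp

lemma definable_comp2:
  assumes "definable (\<lambda>x e. F x (arg e 0) (arg e 1))" "definable g" "definable h"
  shows "definable (\<lambda>x e. F x (g x e) (h x e))"
proof -
  \<comment> \<open>\<open>h\<close> is going to be bound first, so \<open>g\<close> has to skip one
    binding.\<close>
  have "definable (\<lambda>x e. F x (g x (drop 1 e)) (arg e 0))"
    using definable_let[OF assms(1) definable_drop[OF assms(2), of 1], of 0] by simp
  from definable_let[OF this assms(3), of 0] show ?thesis by simp
qed

text \<open>The only source of loops in the generated programs. Recursions of smaller range are
  obtained by a guard in the step function, see \<open>rec_nat_guarded\<close>, so the number of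
  rounds never depends on the data.\<close>

lemma definable_iter:
  assumes "definable a" "definable (\<lambda>x e. h x (drop 2 e) (arg e 0) (arg e 1))"
  shows "definable (\<lambda>x e. rec_nat (a x e) (\<lambda>k acc. h x e k acc) (width C x))"
proof -
  obtain Ga Gh where G: "computes a Ga" "computes (\<lambda>x e. h x (drop 2 e) (arg e 0) (arg e 1)) Gh"
    using assms unfolding definable_def by blast
  show ?thesis
  proof (rule definableI[of "\<lambda>rs b. Seq (Ga rs b) (Seq (Zero (Suc b)) (Loop (Suc b)
      (Seq (Gh (Suc b # b # rs) (Suc (Suc b))) (Copy b (Suc (Suc b))))))"], goal_cases)
    case (1 rs b)
    then have "\<forall>r\<in>set (Suc b # b # rs). r < Suc (Suc b)" by (simp add: less_SucI)
    note h = computes_static[OF G(2) this]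
    have "Suc b \<notin> writes (Gh (Suc b # b # rs) (Suc (Suc b)))" using h(2) by auto
    then show ?case using h(1) computes_static(1)[OF G(1) 1] by simp
  next
    case (2 rs b)
    then have "\<forall>r\<in>set (Suc b # b # rs). r < Suc (Suc b)" by (simp add: less_SucI)
    then have w: "writes (Gh (Suc b # b # rs) (Suc (Suc b))) \<subseteq> {Suc (Suc b)..}" by (rule computes_static(2)[OF G(2)])
    have "{Suc (Suc b)..} \<subseteq> {b..}" by auto
    with w have "writes (Gh (Suc b # b # rs) (Suc (Suc b))) \<subseteq> {b..}" by (rule order.trans)
    then show ?case using computes_static(2)[OF G(1) 2] by simp
  next
    case (3 rs b x s)
    let ?W = "width C x"
    let ?s1 = "(exec C x (Ga rs b) s)(Suc b := 0)"
    let ?H = "Gh (Suc b # b # rs) (Suc (Suc b))"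
    let ?body = "\<lambda>s. bump ?W (Suc b) (exec C x (Seq ?H (Copy b (Suc (Suc b)))) s)"
    have rs': "\<forall>r\<in>set (Suc b # b # rs). r < Suc (Suc b)" using 3 by (simp add: less_SucI)
    have W: "0 < ?W" using C by (simp add: width_def)
    note e1 = computes_exec[OF G(1) 3]
    define B where "B = ?body"
    define s1 where "s1 = ?s1"
    have B: "B t = bump ?W (Suc b) ((exec C x ?H t)(b := exec C x ?H t (Suc (Suc b))))" for t
      by (simp add: B_def)
    \<comment> \<open>The counter equals \<open>n\<close> until the final increment wraps it around
      to 0, hence the remainder.\<close>
    have "(B ^^ n) s1 b = rec_nat (a x (map s rs)) (h x (map s rs)) n \<and>
          (B ^^ n) s1 (Suc b) = n mod ?W \<and> (\<forall>r<b. (B ^^ n) s1 r = s r) \<and>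
          (\<forall>r. (B ^^ n) s1 r < ?W)" if "n \<le> ?W" for n
      using that
    proof (induction n)
      case 0 then show ?case using e1 W by (simp add: s1_def)
    next
      case (Suc n)
      let ?t = "(B ^^ n) s1"
      have IH: "?t b = rec_nat (a x (map s rs)) (h x (map s rs)) n" "?t (Suc b) = n"
        "\<forall>r<b. ?t r = s r" "\<forall>r. ?t r < ?W" using Suc by auto
      note e2 = computes_exec[OF G(2) rs' 3(2) IH(4)]
      have m: "map ?t (Suc b # b # rs) = n # ?t b # map s rs" using IH 3(1) by simp
      have e: "exec C x ?H ?t (Suc (Suc b)) = h x (map s rs) n (?t b)"
        using e2(1) unfolding m by simp
      have lt: "\<forall>r. exec C x ?H ?t r < ?W" by (rule e2(3))
      have k: "exec C x ?H ?t (Suc b) = n" using e2(2)[of "Suc b"] IH(2) by simp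
      have step: "(B ^^ Suc n) s1 = bump ?W (Suc b) ((exec C x ?H ?t)(b := exec C x ?H ?t (Suc (Suc b))))"
        by (simp add: B)
      show ?case unfolding step using e k e2(2) IH lt lt[rule_format, of "Suc (Suc b)"] W by (auto simp: bump_def)
    qed
    note inv = this[OF order.refl]
    have "exec C x (Seq (Ga rs b) (Seq (Zero (Suc b)) (Loop (Suc b) (Seq ?H (Copy b (Suc (Suc b))))))) s
        = (B ^^ ?W) s1"
      by (simp add: B_def s1_def)
    then show ?case using inv by simp
  qed
qed

end

section \<open>Recursions behind the loops, and binary addition with carries\<close>

lemma rec_nat_guarded:
  "N \<le> W \<Longrightarrow> rec_nat a (\<lambda>k acc. if k < N then g k acc else acc) W = rec_nat a g N"
proof (induction W)
  case (Suc W)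
  have "M \<le> N \<Longrightarrow> rec_nat a (\<lambda>k acc. if k < N then g k acc else acc) M = rec_nat a g M" for M
    by (induction M) auto
  then show ?case using Suc by (cases "N = Suc W") auto
qed simp

lemma rec_nat_sum_mod:
  "rec_nat 0 (\<lambda>k acc. (acc + h k) mod W) N = (\<Sum>i<N. h i :: nat) mod W"
  by (induction N) (auto simp: mod_simps)

text \<open>Counting upwards meets the larger of \<open>a\<close> and \<open>b\<close> last, so the
  most recent hit decides \<open>a < b\<close>. Testing \<open>a\<close> first settles the case of
  equality.\<close>

lemma rec_nat_last:
  fixes a b :: nat
  shows "rec_nat 0 (\<lambda>k acc. if k = a then 0 else if k = b then 1 else acc) K
    = (if b < K \<and> (a < b \<or> K \<le> a) then 1 else 0 :: nat)"
  by (induction K) auto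

lemma rec_nat_parity:
  "rec_nat 0 (\<lambda>k acc. if acc = 0 then 1 else 0) n = n mod (2 :: nat)"
  by (induction n) (auto simp: mod_Suc)

text \<open>Half of \<open>n\<close>, rounded down, is the number of odd numbers below
  \<open>n\<close>.\<close>

lemma rec_nat_half:
  "rec_nat 0 (\<lambda>k acc. if k mod 2 = Suc 0 then Suc acc else acc) n = n div (2 :: nat)"
proof (induction n)
  case (Suc n) then show ?case by simp presburger
qed simp

text \<open>The carry into binary place \<open>k\<close> in a long addition whose column totals are
  \<open>f 0\<close>, \<open>f 1\<close> and so on; a column total may exceed 1.\<close>

fun carry :: "(nat \<Rightarrow> nat) \<Rightarrow> nat \<Rightarrow> nat" where
  "carry f 0 = 0"
| "carry f (Suc k) = (carry f k + f k) div 2"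

lemma carry_eq: "carry f n = (\<Sum>k<n. 2 ^ k * f k) div 2 ^ n"
proof (induction n)
  case (Suc n)
  have "((\<Sum>k<n. 2 ^ k * f k) + 2 ^ n * f n) div 2 ^ Suc n = (((\<Sum>k<n. 2 ^ k * f k) + 2 ^ n * f n) div 2 ^ n) div 2"
    by (simp only: power_Suc2 div_mult2_eq)
  then show ?case using Suc by simp
qed simp

text \<open>Half of the sum of a carry and a column that are both at most \<open>D\<close> is again
  at most \<open>D\<close>. So carries stay as small as columns, however many places there
  are.\<close>

lemma carry_le: "(\<And>k. k < n \<Longrightarrow> f k \<le> D) \<Longrightarrow> carry f n \<le> D"
proof (induction n)
  case (Suc n)
  then have "carry f n \<le> D" "f n \<le> D" by auto
  then show ?case by simp
qed simp

lemma sum_mod_power_Suc: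
  fixes f :: "nat \<Rightarrow> nat"
  shows "(\<Sum>k<Suc n. 2 ^ k * f k) mod 2 ^ Suc n =
   (\<Sum>k<n. 2 ^ k * f k) mod 2 ^ n + 2 ^ n * ((carry f n + f n) mod 2)"
proof -
  let ?S = "\<Sum>k<n. 2 ^ k * f k"
  have "(?S + 2 ^ n * f n) mod (2 ^ n * 2) = 2 ^ n * ((?S + 2 ^ n * f n) div 2 ^ n mod 2) + (?S + 2 ^ n * f n) mod 2 ^ n"
    by (rule mod_mult2_eq)
  then show ?thesis by (simp add: carry_eq mult.commute add.commute)
qed

text \<open>Going upwards from the least significant place, each differing bit overrides the verdict
  of the places below it. The start value 1 stands for equality.\<close>

lemma rec_nat_compare:
  fixes f g :: "nat \<Rightarrow> nat"
  shows "rec_nat 1 (\<lambda>k acc. if (carry f k + f k) mod 2 = (carry g k + g k) mod 2 then acc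
       else if (carry f k + f k) mod 2 = 0 then 1 else 0) n =
    (if (\<Sum>k<n. 2 ^ k * f k) mod 2 ^ n \<le> (\<Sum>k<n. 2 ^ k * g k) mod 2 ^ n then 1 else 0 :: nat)"
proof (induction n)
  case (Suc n)
  let ?a = "(carry f n + f n) mod 2" and ?b = "(carry g n + g n) mod 2"
  let ?A = "(\<Sum>k<n. 2 ^ k * f k) mod 2 ^ n" and ?B = "(\<Sum>k<n. 2 ^ k * g k) mod 2 ^ n"
  have lt: "?A < 2 ^ n" "?B < 2 ^ n" by auto
  have "(A + d * a \<le> B + d * b) = (if a = b then A \<le> B else a = 0)"
    if "A < d" "B < d" "a < 2" "b < 2" for A B d a b :: nat
  proof -
    from that consider "a = b" | "a = 0" "b = 1" | "a = 1" "b = 0" by linarith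
    then show ?thesis by cases (use that in auto)
  qed
  from this[OF lt, of ?a ?b]
  have "(?A + 2 ^ n * ?a \<le> ?B + 2 ^ n * ?b) = (if ?a = ?b then ?A \<le> ?B else ?a = 0)"
    by simp
  then show ?case unfolding sum_mod_power_Suc[of f] sum_mod_power_Suc[of g] using Suc.IH by simp
qed simp

text \<open>Division with remainder by \<open>2 ^ n\<close>: the quotient is the final carry and
  decides first, the remainder is what \<open>rec_nat_compare\<close> scans.\<close>

lemma le_via_carry:
  fixes f g :: "nat \<Rightarrow> nat"
  shows "(\<Sum>k<n. 2 ^ k * f k) \<le> (\<Sum>k<n. 2 ^ k * g k) \<longleftrightarrow>
    carry f n < carry g n \<or> carry f n = carry g n \<and>
     (\<Sum>k<n. 2 ^ k * f k) mod 2 ^ n \<le> (\<Sum>k<n. 2 ^ k * g k) mod 2 ^ n"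
proof -
  have "a \<le> b \<longleftrightarrow> a div d < b div d \<or> a div d = b div d \<and> a mod d \<le> b mod d" for a b d :: nat
  proof -
    consider "a div d < b div d" | "a div d = b div d" | "b div d < a div d" by linarith
    then show ?thesis
    proof cases
      case 1 then show ?thesis using div_le_mono[of b a d] by linarith
    next
      case 2
      then have "a = (b div d) * d + a mod d" "b = (b div d) * d + b mod d"
        using div_mult_mod_eq[of a d] div_mult_mod_eq[of b d] by simp_all
      then show ?thesis using 2 by (metis add_le_cancel_left less_irrefl)
    next
      case 3 then show ?thesis using div_le_mono[of a b d] by linarith
    qed
  qed
  then show ?thesis unfolding carry_eq .
qed

section \<open>Closure properties of decidable predicates\<close>

context machine begin

lemma good_arg: "good x e \<Longrightarrow> arg e i < width C x"
  using C by (auto simp: good_def arg_def width_def)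

lemma length_less_width: "length x < width C x"
  using C mult_le_mono1[of 1 C "length x + 1"] by (simp add: width_def)

lemma decidable_cong: "decidable p \<Longrightarrow> (\<And>x e. good x e \<Longrightarrow> p x e = q x e) \<Longrightarrow> decidable q"
  unfolding decidable_def by (erule definable_cong) simp

lemma decidable_eq: "definable f \<Longrightarrow> definable g \<Longrightarrow> decidable (\<lambda>x e. f x e = g x e)"
  unfolding decidable_def using C by (intro definable_if_eq definable_const) auto

lemma definable_if:
  assumes "decidable p" "definable h" "definable k"
  shows "definable (\<lambda>x e. if p x e then h x e else k x e)"
proof -
  have "definable (\<lambda>x e. if (if p x e then 1 else 0) = (1 :: nat) then h x e else k x e)"
    using C by (intro definable_if_eq[OF assms(1)[unfolded decidable_def] _ assms(2,3)] definable_const) auto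
  then show ?thesis by (rule definable_cong) auto
qed

lemma decidable_if:
  assumes "decidable p" "decidable q" "decidable r"
  shows "decidable (\<lambda>x e. if p x e then q x e else r x e)"
  using definable_if[OF assms(1) assms(2)[unfolded decidable_def] assms(3)[unfolded decidable_def]]
  unfolding decidable_def by (rule definable_cong) auto

lemma decidable_const: "decidable (\<lambda>x e. P)"
  unfolding decidable_def using C definable_const[of 0] definable_const[of 1] by (cases P) auto

lemma decidable_not: "decidable p \<Longrightarrow> decidable (\<lambda>x e. \<not> p x e)"
  using decidable_if[OF _ decidable_const[of False] decidable_const[of True]]
  by (rule decidable_cong) auto

lemma decidable_conj: "decidable p \<Longrightarrow> decidable q \<Longrightarrow> decidable (\<lambda>x e. p x e \<and> q x e)"
  by (rule decidable_cong[OF decidable_if[OF _ _ decidable_const[of False], of p q]]) auto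

lemma decidable_disj: "decidable p \<Longrightarrow> decidable q \<Longrightarrow> decidable (\<lambda>x e. p x e \<or> q x e)"
  by (rule decidable_cong[OF decidable_if[OF _ decidable_const[of True], of p q]]) auto

lemma decidable_ball: "finite A \<Longrightarrow> (\<And>a. a \<in> A \<Longrightarrow> decidable (p a)) \<Longrightarrow> decidable (\<lambda>x e. \<forall>a\<in>A. p a x e)"
proof (induction A rule: finite_induct)
  case (insert a A)
  then have "decidable (\<lambda>x e. p a x e \<and> (\<forall>a\<in>A. p a x e))" by (intro decidable_conj) auto
  then show ?case by simp
qed (simp add: decidable_const)

lemma decidable_bex: "finite A \<Longrightarrow> (\<And>a. a \<in> A \<Longrightarrow> decidable (p a)) \<Longrightarrow> decidable (\<lambda>x e. \<exists>a\<in>A. p a x e)"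
proof (induction A rule: finite_induct)
  case (insert a A)
  then have "decidable (\<lambda>x e. p a x e \<or> (\<exists>a\<in>A. p a x e))" by (intro decidable_disj) auto
  then show ?case by simp
qed (simp add: decidable_const)

lemma decidable_sym: "definable f \<Longrightarrow> v \<noteq> 0 \<Longrightarrow> decidable (\<lambda>x e. sym_at x (f x e) = v)"
  unfolding decidable_def using C by (intro definable_if_sym definable_const) auto

text \<open>Input symbols are 1, 2 or 3 and everything outside is blank, so reading the symbol at a
  position tells whether it lies inside the input.\<close>

lemma decidable_less_length: "definable f \<Longrightarrow> decidable (\<lambda>x e. f x e < length x)"
proof -
  assume "definable f"
  then have "decidable (\<lambda>x e. \<exists>v\<in>{1, 2, 3}. sym_at x (f x e) = v)"
    by (intro decidable_bex decidable_sym) auto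
  then show ?thesis
  proof (rule decidable_cong)
    fix x e assume "good x e"
    then have "x ! i \<in> {1, 2, 3}" if "i < length x" for i
      using nth_mem[OF that] by (auto simp: good_def)
    then show "(\<exists>v\<in>{1, 2, 3}. sym_at x (f x e) = v) = (f x e < length x)"
      by (auto simp: sym_at_def)
  qed
qed

lemma decidable_let: "decidable p \<Longrightarrow> definable g \<Longrightarrow> decidable (\<lambda>x e. p x (g x e # drop n e))"
  unfolding decidable_def by (rule definable_let)

lemma decidable_comp2:
  "decidable (\<lambda>x e. p x (arg e 0) (arg e 1)) \<Longrightarrow> definable g \<Longrightarrow> definable h \<Longrightarrow> decidable (\<lambda>x e. p x (g x e) (h x e))"
  unfolding decidable_def by (rule definable_comp2[where F = "\<lambda>x v w. if p x v w then 1 else 0"])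

lemma decidable_less:
  assumes "definable f" "definable g"
  shows "decidable (\<lambda>x e. f x e < g x e)"
proof -
  have "definable (\<lambda>x e. rec_nat 0 (\<lambda>k acc. if k = arg e 0 then 0 else if k = arg e 1 then 1 else acc) (width C x))"
    using C by (intro definable_iter definable_if_eq definable_const) (auto intro: definable_arg)
  then have "decidable (\<lambda>x e. arg e 0 < arg e 1)"
    unfolding decidable_def
  proof (rule definable_cong)
    fix x e assume "good x e"
    then have "arg e 0 < width C x" "arg e 1 < width C x" by (auto simp: good_arg)
    then show "rec_nat 0 (\<lambda>k acc. if k = arg e 0 then 0 else if k = arg e 1 then 1 else acc) (width C x)
        = (if arg e 0 < arg e 1 then 1 else 0 :: nat)"
      unfolding rec_nat_last by auto
  qed
  then show ?thesis by (rule decidable_comp2[OF _ assms])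
qed

lemma definable_add_mod:
  assumes "definable f" "definable g"
  shows "definable (\<lambda>x e. (f x e + g x e) mod width C x)"
proof -
  have "definable (\<lambda>x e. rec_nat (arg e 0) (\<lambda>k acc. if k < arg e 1 then Suc acc mod width C x else acc) (width C x))"
    by (intro definable_iter definable_if decidable_less definable_Suc_mod definable_arg; unfold arg_drop; rule definable_arg)
  then have "definable (\<lambda>x e. (arg e 0 + arg e 1) mod width C x)"
  proof (rule definable_cong)
    fix x e assume "good x e"
    then have a: "arg e 0 < width C x" "arg e 1 \<le> width C x" by (auto simp: good_arg less_imp_le)
    have "rec_nat (arg e 0) (\<lambda>k acc. Suc acc mod width C x) n = (arg e 0 + n) mod width C x" for n
      using a(1) by (induction n) (auto simp: mod_Suc_eq)
    then show "rec_nat (arg e 0) (\<lambda>k acc. if k < arg e 1 then Suc acc mod width C x else acc) (width C x)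
        = (arg e 0 + arg e 1) mod width C x"
      unfolding rec_nat_guarded[OF a(2)] .
  qed
  then show ?thesis by (rule definable_comp2[OF _ assms])
qed

lemma definable_add:
  assumes "definable f" "definable g" "\<And>x e. good x e \<Longrightarrow> f x e + g x e < width C x"
  shows "definable (\<lambda>x e. f x e + g x e)"
  using definable_add_mod[OF assms(1,2)] by (rule definable_cong) (simp add: assms(3))

lemma definable_bound_var:
  assumes "definable (\<lambda>x e. h x (drop 1 e) (arg e 0))" "definable g"
  shows "definable (\<lambda>x e. h x (drop n e) (g x e))"
  using definable_let[OF assms, of n] by simp

lemma decidable_bound_var:
  assumes "decidable (\<lambda>x e. p x (drop 1 e) (arg e 0))" "definable g"
  shows "decidable (\<lambda>x e. p x (drop n e) (g x e))"
  using decidable_let[OF assms, of n] by simp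

lemma definable_sum_mod:
  assumes h: "definable (\<lambda>x e. h x (drop 1 e) (arg e 0))"
  shows "definable (\<lambda>x e. (\<Sum>i<length x. h x e i) mod width C x)"
proof -
  have "definable (\<lambda>x e. rec_nat 0 (\<lambda>k acc. if k < length x then (acc + h x e k) mod width C x else acc) (width C x))"
    using C by (intro definable_iter definable_const definable_if decidable_less_length definable_add_mod
        definable_arg definable_bound_var[OF h]) auto
  then show ?thesis
    by (rule definable_cong) (simp add: rec_nat_guarded less_imp_le[OF length_less_width] rec_nat_sum_mod)
qed

lemma definable_sum:
  assumes "definable (\<lambda>x e. h x (drop 1 e) (arg e 0))"
    and "\<And>x e. good x e \<Longrightarrow> (\<Sum>i<length x. h x e i) < width C x"
  shows "definable (\<lambda>x e. \<Sum>i<length x. h x e i)"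
  using definable_sum_mod[of h, OF assms(1)] by (rule definable_cong) (simp add: assms(2))

lemma definable_count:
  assumes "decidable (\<lambda>x e. p x (drop 1 e) (arg e 0))"
  shows "definable (\<lambda>x e. card {i. i < length x \<and> p x e i})"
proof -
  have eq: "(\<Sum>i<length x. if p x e i then 1 else 0) = card {i. i < length x \<and> p x e i}" for x e
    by (simp add: sum.If_cases Int_def)
  have "card {i. i < length x \<and> p x e i} \<le> card {..<length x}" for x e
    by (rule card_mono) auto
  then have lt: "card {i. i < length x \<and> p x e i} < width C x" for x e
    using order.strict_trans1[OF _ length_less_width[of x]] by simp
  have "definable (\<lambda>x e. \<Sum>i<length x. if p x e i then 1 else 0)"
    by (rule definable_sum) (use assms lt in \<open>auto simp: decidable_def eq\<close>)
  then show ?thesis unfolding eq .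
qed

lemma definable_length: "definable (\<lambda>x e. length x)"
  using definable_count[OF decidable_const[of True]] by simp

lemma decidable_ex:
  assumes "decidable (\<lambda>x e. p x (drop 1 e) (arg e 0))"
  shows "decidable (\<lambda>x e. \<exists>i<length x. p x e i)"
proof -
  have "decidable (\<lambda>x e. \<not> card {i. i < length x \<and> p x e i} = 0)"
    using C by (intro decidable_not decidable_eq definable_count[OF assms] definable_const) auto
  then show ?thesis by (rule decidable_cong) auto
qed

lemma decidable_ex_env: "decidable p \<Longrightarrow> decidable (\<lambda>x e. \<exists>i<length x. p x (i # e))"
  by (rule decidable_ex) (rule decidable_let[OF _ definable_arg])

lemma definable_parity: "definable f \<Longrightarrow> definable (\<lambda>x e. f x e mod 2)"
proof -
  have "definable (\<lambda>x e. rec_nat 0 (\<lambda>k acc. if k < arg e 0 then (if acc = 0 then 1 else 0) else acc) (width C x))"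
    using C by (intro definable_iter definable_if decidable_eq decidable_less definable_const definable_arg) (auto intro: definable_arg)
  then have "definable (\<lambda>x e. arg e 0 mod 2)"
    by (rule definable_cong) (simp add: rec_nat_guarded less_imp_le[OF good_arg] rec_nat_parity)
  then show "definable f \<Longrightarrow> definable (\<lambda>x e. f x e mod 2)" by (rule definable_comp1)
qed

lemma definable_half: "definable f \<Longrightarrow> definable (\<lambda>x e. f x e div 2)"
proof -
  have "definable (\<lambda>x e. rec_nat 0 (\<lambda>k acc. if k < arg e 0 then (if k mod 2 = Suc 0 then Suc acc mod width C x else acc) else acc) (width C x))"
    using C by (intro definable_iter definable_if decidable_eq decidable_less definable_const definable_arg definable_parity definable_Suc_mod) (auto intro: definable_arg)
  then have "definable (\<lambda>x e. arg e 0 div 2)"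
  proof (rule definable_cong)
    fix x e assume g: "good x e"
    have "n \<le> arg e 0 \<Longrightarrow> rec_nat 0 (\<lambda>k acc. if k mod 2 = Suc 0 then Suc acc mod width C x else acc) n =
          rec_nat 0 (\<lambda>k acc. if k mod 2 = Suc 0 then Suc acc else acc) n" for n
    proof (induction n)
      case (Suc n)
      have "Suc (n div 2) < width C x" if "odd n"
        using good_arg[OF g, of 0] Suc.prems that by (auto elim!: oddE)
      then show ?case using Suc by (auto simp: rec_nat_half odd_iff_mod_2_eq_one)
    qed simp
    then show "rec_nat 0 (\<lambda>k acc. if k < arg e 0 then (if k mod 2 = Suc 0 then Suc acc mod width C x else acc) else acc) (width C x)
      = arg e 0 div 2"
      by (simp add: rec_nat_guarded less_imp_le[OF good_arg[OF g]] rec_nat_half)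
  qed
  then show "definable f \<Longrightarrow> definable (\<lambda>x e. f x e div 2)" by (rule definable_comp1)
qed


text \<open>A column and the carry into it are each at most \<open>length x * D\<close>; with
  \<open>2 * D < C\<close> their sum still fits into a register.\<close>

lemma column_bounds:
  assumes "\<And>i. a i \<le> D" "2 * D < C"
  shows "2 * (\<Sum>i<length x. a i) < width C x" "(\<Sum>i<length x. a i) \<le> length x * D" "2 * (length x * D) < width C x"
proof -
  show 1: "(\<Sum>i<length x. a i) \<le> length x * D"
    using sum_bounded_above[of "{..<length x}" a D] assms(1) by simp
  have "length x * (2 * D) \<le> length x * C" using assms(2) by (intro mult_le_mono2) simp
  moreover have "width C x = length x * C + C" by (simp add: width_def)
  moreover have "2 * (length x * D) = length x * (2 * D)" by simp
  ultimately show 2: "2 * (length x * D) < width C x" using assms(2) by linarith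
  from 1 2 show "2 * (\<Sum>i<length x. a i) < width C x" by linarith
qed

text \<open>\<open>a x e k i\<close> is the contribution of index \<open>i\<close> to binary place
  \<open>k\<close>. The program adds modulo \<open>width\<close>, which is exact by
  \<open>sum_lt\<close>.\<close>

lemma definable_carry:
  assumes a: "definable (\<lambda>x e. a x (drop 2 e) (arg e 1) (arg e 0))"
    and D: "\<And>x e k i. a x e k i \<le> D" "2 * D < C"
  defines "col \<equiv> \<lambda>x e k. \<Sum>i<length x. a x e k i"
  shows "definable (\<lambda>x e. carry (col x (drop 1 e)) (arg e 0))"
    and "definable (\<lambda>x e. (carry (col x (drop 1 e)) (arg e 0) + col x (drop 1 e) (arg e 0)) mod 2)"
proof -
  have col_le: "col x e k \<le> length x * D" and width: "2 * (length x * D) < width C x" for x e k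
    unfolding col_def by (rule column_bounds[OF D])+
  have cr_le: "carry (col x e) n \<le> length x * D" for x e n
    by (intro carry_le col_le)
  have sum_lt: "carry (col x e) n + col x e k < width C x" for x e n k
    using cr_le[of x e n] col_le[of x e k] width[of x] by linarith
  have col: "definable (\<lambda>x e. col x (drop 1 e) (arg e 0))"
    unfolding col_def
  proof (rule definable_sum)
    show "definable (\<lambda>x e. a x (drop 1 (drop 1 e)) (arg (drop 1 e) 0) (arg e 0))"
      using a by (simp add: numeral_2_eq_2)
    show "(\<Sum>i<length x. a x (drop 1 e) (arg e 0) i) < width C x" for x e
      using column_bounds(1)[of "a x (drop 1 e) (arg e 0)" D x] D by simp
  qed
  have "definable (\<lambda>x e. rec_nat 0 (\<lambda>k c. if k < arg e 0 then ((c + col x (drop 1 e) k) mod width C x) div 2 else c) (width C x))"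
  proof (rule definable_iter)
    have "definable (\<lambda>x e. col x (drop 3 e) (arg e 0))" by (rule definable_bound_var[OF col definable_arg])
    then show "definable (\<lambda>x e. if arg e 0 < arg (drop 2 e) 0
        then ((arg e 1 + col x (drop 1 (drop 2 e)) (arg e 0)) mod width C x) div 2 else arg e 1)"
      by (intro definable_if decidable_less definable_half definable_add_mod definable_arg)
        (simp_all add: definable_arg numeral_3_eq_3)
  qed (use C definable_const in auto)
  then show carry: "definable (\<lambda>x e. carry (col x (drop 1 e)) (arg e 0))"
  proof (rule definable_cong)
    fix x e assume g: "good x e"
    have "rec_nat 0 (\<lambda>k c. ((c + col x (drop 1 e) k) mod width C x) div 2) n = carry (col x (drop 1 e)) n" for n
      by (induction n) (simp_all add: sum_lt)
    then show "rec_nat 0 (\<lambda>k c. if k < arg e 0 then ((c + col x (drop 1 e) k) mod width C x) div 2 else c) (width C x)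
      = carry (col x (drop 1 e)) (arg e 0)"
      by (simp add: rec_nat_guarded less_imp_le[OF good_arg[OF g]])
  qed
  show "definable (\<lambda>x e. (carry (col x (drop 1 e)) (arg e 0) + col x (drop 1 e) (arg e 0)) mod 2)"
    by (intro definable_parity definable_add carry col sum_lt)
qed

text \<open>The sums may be exponentially large, but a register only ever holds a column, a carry or
  the verdict. What overflows the \<open>length x\<close> places is contained in the final
  carries.\<close>

lemma decidable_binary_le:
  assumes a: "definable (\<lambda>x e. a x (drop 2 e) (arg e 1) (arg e 0))"
    and b: "definable (\<lambda>x e. b x (drop 2 e) (arg e 1) (arg e 0))"
    and D: "\<And>x e k i. a x e k i \<le> D" "\<And>x e k i. b x e k i \<le> D" "2 * D < C"
  shows "decidable (\<lambda>x e. (\<Sum>k<length x. 2 ^ k * (\<Sum>i<length x. a x e k i))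
                        \<le> (\<Sum>k<length x. 2 ^ k * (\<Sum>i<length x. b x e k i)))"
proof -
  define ca where "ca x e k = (\<Sum>i<length x. a x e k i)" for x e k
  define cb where "cb x e k = (\<Sum>i<length x. b x e k i)" for x e k
  define bita where "bita x e k = (carry (ca x e) k + ca x e k) mod 2" for x e k
  define bitb where "bitb x e k = (carry (cb x e) k + cb x e k) mod 2" for x e k
  have carrya: "definable (\<lambda>x e. carry (ca x (drop 1 e)) (arg e 0))"
    and bita: "definable (\<lambda>x e. bita x (drop 1 e) (arg e 0))"
    using definable_carry[where a = a, OF a D(1,3)] unfolding ca_def bita_def by (simp_all add: ca_def)
  have carryb: "definable (\<lambda>x e. carry (cb x (drop 1 e)) (arg e 0))"
    and bitb: "definable (\<lambda>x e. bitb x (drop 1 e) (arg e 0))"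
    using definable_carry[where a = b, OF b D(2,3)] unfolding cb_def bitb_def by (simp_all add: cb_def)
  have c2: "definable (\<lambda>x e. 0)" "definable (\<lambda>x e. 1)"
    using C by (auto intro: definable_const)
  have "definable (\<lambda>x e. rec_nat 1 (\<lambda>k acc. if k < length x then
       (if bita x e k = bitb x e k then acc else if bita x e k = 0 then 1 else 0) else acc) (width C x))"
    by (intro definable_iter c2 definable_if decidable_less_length decidable_eq definable_arg
        definable_bound_var[OF bita] definable_bound_var[OF bitb])
  then have cmp: "definable (\<lambda>x e. if (\<Sum>k<length x. 2 ^ k * ca x e k) mod 2 ^ length x
      \<le> (\<Sum>k<length x. 2 ^ k * cb x e k) mod 2 ^ length x then 1 else 0)"
    by (rule definable_cong)
      (simp only: rec_nat_guarded[OF less_imp_le[OF length_less_width]] bita_def bitb_def rec_nat_compare)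
  have cra: "definable (\<lambda>x e. carry (ca x e) (length x))"
    using definable_bound_var[OF carrya definable_length, of 0] by simp
  have crb: "definable (\<lambda>x e. carry (cb x e) (length x))"
    using definable_bound_var[OF carryb definable_length, of 0] by simp
  have "decidable (\<lambda>x e. carry (ca x e) (length x) < carry (cb x e) (length x) \<or>
      carry (ca x e) (length x) = carry (cb x e) (length x) \<and>
      (\<Sum>k<length x. 2 ^ k * ca x e k) mod 2 ^ length x \<le> (\<Sum>k<length x. 2 ^ k * cb x e k) mod 2 ^ length x)"
    by (intro decidable_disj decidable_conj decidable_less decidable_eq cra crb cmp[folded decidable_def])
  then show ?thesis
    unfolding le_via_carry[symmetric] unfolding ca_def cb_def .
qed

end

subsection \<open>Reading binary numbers\<close>

text \<open>The input is a sequence of numbers, each terminated by the symbol 3. For a position p, commas x p is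
  the index of its number and offset x p its place value there.\<close>

definition commas :: "nat list \<Rightarrow> nat \<Rightarrow> nat" where
  "commas x p = card {q. q < length x \<and> q < p \<and> sym_at x q = 3}"

definition offset :: "nat list \<Rightarrow> nat \<Rightarrow> nat" where
  "offset x p = card {q. q < length x \<and> q < p \<and> commas x q = commas x p}"

definition bit_at :: "nat list \<Rightarrow> nat \<Rightarrow> nat \<Rightarrow> bool" where
  "bit_at x i k \<longleftrightarrow> (\<exists>p<length x. sym_at x p = 2 \<and> commas x p = i \<and> offset x p = k)"

text \<open>Defined for arbitrary strings: a place without a digit counts as 0, and so does a number
  that is not there.\<close>

definition number :: "nat list \<Rightarrow> nat \<Rightarrow> nat" where
  "number x i = (\<Sum>k<length x. 2 ^ k * (if bit_at x i k then 1 else 0))"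

lemma card_split:
  "card {q. q < n + m \<and> P q} = card {q. q < n \<and> P q} + card {q. q < m \<and> P (n + q)}" for n m :: nat
proof -
  let ?A = "{q. q < n \<and> P q}" and ?B = "{q. q < m \<and> P (n + q)}"
  have "{q. q < n + m \<and> P q} = ?A \<union> (+) n ` ?B"
  proof (rule antisym)
    show "{q. q < n + m \<and> P q} \<subseteq> ?A \<union> (+) n ` ?B"
    proof
      fix q assume "q \<in> {q. q < n + m \<and> P q}"
      then have q: "q < n + m" "P q" by simp_all
      show "q \<in> ?A \<union> (+) n ` ?B"
      proof (cases "q < n")
        case False
        then have "n + (q - n) \<in> (+) n ` ?B" using q by (intro imageI) simp
        then show ?thesis using False by simp
      qed (use q in simp)
    qed
    show "?A \<union> (+) n ` ?B \<subseteq> {q. q < n + m \<and> P q}" by auto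
  qed
  moreover have "card (?A \<union> (+) n ` ?B) = card ?A + card ((+) n ` ?B)"
    by (rule card_Un_disjoint) auto
  moreover have "card ((+) n ` ?B) = card ?B"
    by (intro card_image) simp
  ultimately show ?thesis by presburger
qed

declare bits.simps [simp del]

lemma set_bits: "set (bits n) \<subseteq> {1, 2}"
proof (induction n rule: bits.induct)
  case (1 n) then show ?case by (subst bits.simps) auto
qed

lemma bits_value: "(\<Sum>k<length (bits n). 2 ^ k * (if bits n ! k = 2 then 1 else 0)) = n"
proof (induction n rule: bits.induct)
  case (1 n)
  show ?case
  proof (cases "n < 2")
    case True
    then have "bits n = [n + 1]" by (simp add: bits.simps[of n])
    moreover have "n = 0 \<or> n = 1" using True by linarith
    ultimately show ?thesis by auto
  next
    case False
    then have b: "bits n = (n mod 2 + 1) # bits (n div 2)" by (subst bits.simps) simp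
    have "(\<Sum>k<length (bits n). 2 ^ k * (if bits n ! k = 2 then 1 else 0)) =
        (if n mod 2 = 1 then 1 else 0 :: nat) + (\<Sum>k<length (bits (n div 2)). 2 ^ Suc k * (if bits (n div 2) ! k = 2 then 1 else 0))"
      unfolding b length_Cons sum.lessThan_Suc_shift by simp
    also have "(\<Sum>k<length (bits (n div 2)). 2 ^ Suc k * (if bits (n div 2) ! k = 2 then 1 else 0)) =
        2 * (\<Sum>k<length (bits (n div 2)). 2 ^ k * (if bits (n div 2) ! k = 2 then 1 else 0 :: nat))"
      by (simp only: sum_distrib_left power_Suc mult.assoc)
    also have "\<dots> = 2 * (n div 2)" unfolding 1[OF False] ..
    also have "(if n mod 2 = 1 then 1 else 0) + 2 * (n div 2) = n"
    proof -
      have "n mod 2 = 0 \<or> n mod 2 = 1" by linarith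
      then show ?thesis using div_mult_mod_eq[of n 2] by (elim disjE) simp_all
    qed
    finally show ?thesis .
  qed
qed

context
  fixes a :: nat and u y x :: "nat list"
  assumes u: "u = bits a @ [3]" and x: "x = u @ y"
begin

text \<open>In this context the first encoded number \<open>u\<close> is split off. Its last symbol
  is its only separator, so in the rest \<open>y\<close> all indices of numbers shift by one while
  the offsets stay the same. This is the induction step for reading encodings.\<close>

lemma sym_at_head: "p < length u \<Longrightarrow> sym_at x p = u ! p"
  and sym_at_tail: "sym_at x (length u + p) = sym_at y p"
  by (auto simp: sym_at_def x nth_append)

lemma length_split: "length x = length u + length y"
  by (simp add: x)

lemma head_comma: "p < length u \<Longrightarrow> u ! p = 3 \<longleftrightarrow> Suc p = length u"
proof -
  assume p: "p < length u"
  have "u ! p \<noteq> 3" if "p < length (bits a)"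
  proof -
    have "bits a ! p \<in> {1, 2}" using nth_mem[OF that] set_bits[of a] by blast
    then show ?thesis using that by (auto simp: u nth_append)
  qed
  then show ?thesis using p by (auto simp: u nth_append less_Suc_eq)
qed

lemma commas_head: "p < length u \<Longrightarrow> commas x p = 0"
proof -
  assume p: "p < length u"
  have "sym_at x q \<noteq> 3" if "q < p" for q
  proof -
    have q: "q < length u" "Suc q \<noteq> length u" using that p by simp_all
    then have "u ! q \<noteq> 3" using head_comma[OF q(1)] by blast
    then show ?thesis using sym_at_head[OF q(1)] by simp
  qed
  then have "{q. q < length x \<and> q < p \<and> sym_at x q = 3} = {}" by blast
  then show ?thesis by (simp add: commas_def)
qed

lemma commas_tail: "commas x (length u + p) = Suc (commas y p)"
proof -
  have len: "length u = Suc (length (bits a))" by (simp add: u)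
  have "q < length u \<and> (q < length u + p \<and> sym_at x q = 3) \<longleftrightarrow> q = length (bits a)" for q
  proof (cases "q < length u")
    case True
    then show ?thesis using sym_at_head[OF True] head_comma[OF True] len by simp
  next
    case False
    then show ?thesis using len by simp
  qed
  then have "card {q. q < length u \<and> (q < length u + p \<and> sym_at x q = 3)} = 1" by simp
  then show ?thesis
    unfolding commas_def length_split card_split[of "length u" "length y"] sym_at_tail by simp
qed

lemma offset_head: "p < length u \<Longrightarrow> offset x p = p"
proof -
  assume p: "p < length u"
  then have "{q. q < length x \<and> q < p \<and> commas x q = commas x p} = {..<p}"
    using commas_head by (auto simp: x)
  then show ?thesis by (simp add: offset_def)
qed

lemma offset_tail: "offset x (length u + p) = offset y p"
proof -
  have "{q. q < length u \<and> (q < length u + p \<and> commas x q = commas x (length u + p))} = {}"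
    using commas_head commas_tail by fastforce
  then show ?thesis
    unfolding offset_def length_split card_split[of "length u" "length y"] commas_tail by simp
qed

lemma ex_split: "(\<exists>p<length x. P p) \<longleftrightarrow> (\<exists>p<length u. P p) \<or> (\<exists>p<length y. P (length u + p))"
proof
  assume "\<exists>p<length x. P p"
  then obtain p where p: "p < length x" "P p" by blast
  show "(\<exists>p<length u. P p) \<or> (\<exists>p<length y. P (length u + p))"
  proof (cases "p < length u")
    case False
    then have "p - length u < length y" "P (length u + (p - length u))"
      using p by (simp_all add: length_split)
    then show ?thesis by blast
  qed (use p in blast)
next
  assume "(\<exists>p<length u. P p) \<or> (\<exists>p<length y. P (length u + p))"
  moreover have "p < length x" if "p < length u" for p using that by (simp add: length_split)
  moreover have "length u + p < length x" if "p < length y" for p using that by (simp add: length_split)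
  ultimately show "\<exists>p<length x. P p" by blast
qed

lemma bit_at_head: "bit_at x 0 k \<longleftrightarrow> k < length (bits a) \<and> bits a ! k = 2"
proof -
  have "bit_at x 0 k \<longleftrightarrow> k < length u \<and> u ! k = 2"
    unfolding bit_at_def ex_split using commas_head commas_tail offset_head sym_at_head by auto
  moreover have "length u = Suc (length (bits a))" by (simp add: u)
  moreover have "u ! k = bits a ! k" if "k < length (bits a)" using that by (simp add: u nth_append)
  moreover have "u ! k \<noteq> 2" if "k < length u" "\<not> k < length (bits a)"
  proof -
    have "Suc k = length u" using that by (simp add: u)
    then have "u ! k = 3" using head_comma[OF that(1)] by blast
    then show ?thesis by simp
  qed
  ultimately show ?thesis by (metis less_SucI)
qed

lemma bit_at_tail: "bit_at x (Suc i) k \<longleftrightarrow> bit_at y i k"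
  unfolding bit_at_def ex_split using commas_head commas_tail offset_tail sym_at_tail by auto

lemma number_head: "number x 0 = a"
proof -
  have "number x 0 = (\<Sum>k<length (bits a). 2 ^ k * (if bits a ! k = 2 then 1 else 0))"
    unfolding number_def bit_at_head by (rule sum.mono_neutral_cong_right) (auto simp: x u)
  then show ?thesis unfolding bits_value .
qed

lemma number_tail: "number x (Suc i) = number y i"
proof -
  \<comment> \<open>An offset counts earlier positions and is therefore below the length of
    \<open>y\<close>, so the additional places of the sum over \<open>length x\<close> contribute
    nothing.\<close>
  have lt: "k < length y" if bit: "bit_at y i k" for k
  proof -
    obtain p where p: "p < length y" "k = offset y p" using bit unfolding bit_at_def by blast
    have "offset y p \<le> card {..<p}" unfolding offset_def by (intro card_mono) auto
    then show ?thesis using p by simp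
  qed
  show ?thesis
    unfolding number_def bit_at_tail
    by (intro sum.mono_neutral_cong_right) (auto simp: length_split dest!: lt)
qed

lemma commas_length: "commas x (length x) = Suc (commas y (length y))"
  using commas_tail[of "length y"] by (simp add: length_split)

end

lemma number_concat: "i < length ns \<Longrightarrow> number (concat (map enc_num ns)) i = ns ! i"
proof (induction ns arbitrary: i)
  case (Cons a ns)
  have e: "enc_num a = bits a @ [3]" "concat (map enc_num (a # ns)) = enc_num a @ concat (map enc_num ns)"
    by (simp_all add: enc_num_def)
  show ?case
  proof (cases i)
    case 0 then show ?thesis using number_head[OF e] by simp
  next
    case (Suc j) then show ?thesis using number_tail[OF e, of j] Cons by simp
  qed
qed simp

lemma commas_concat: "commas (concat (map enc_num ns)) (length (concat (map enc_num ns))) = length ns"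
proof (induction ns)
  case (Cons a ns)
  have e: "enc_num a = bits a @ [3]" "concat (map enc_num (a # ns)) = enc_num a @ concat (map enc_num ns)"
    by (simp_all add: enc_num_def)
  show ?case using commas_length[OF e] Cons by simp
qed (simp add: commas_def)

lemma length_concat_enc_num: "2 * length ns \<le> length (concat (map enc_num ns))"
proof (induction ns)
  case (Cons a ns)
  have "1 \<le> length (bits a)" by (subst bits.simps) auto
  then show ?case using Cons by (simp add: enc_num_def)
qed simp

lemma set_concat_enc_num: "set (concat (map enc_num ns)) \<subseteq> {1, 2, 3}"
proof (induction ns)
  case (Cons a ns)
  have "set (enc_num a) = insert 3 (set (bits a))" by (simp add: enc_num_def)
  then have "set (enc_num a) \<subseteq> {1, 2, 3}" using set_bits[of a] by blast
  moreover have "set (concat (map enc_num (a # ns))) = set (enc_num a) \<union> set (concat (map enc_num ns))" by simp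
  ultimately show ?case using Cons by (simp only: Un_least)
qed simp

context machine begin

lemma definable_commas: "definable f \<Longrightarrow> definable (\<lambda>x e. commas x (f x e))"
proof (rule definable_comp1[of commas])
  show "definable (\<lambda>x e. commas x (arg e 0))"
    unfolding commas_def
    by (intro definable_count decidable_conj decidable_less decidable_sym definable_arg) (simp_all add: definable_arg)
qed

lemma definable_offset: "definable f \<Longrightarrow> definable (\<lambda>x e. offset x (f x e))"
proof (rule definable_comp1[of offset])
  show "definable (\<lambda>x e. offset x (arg e 0))"
    unfolding offset_def
    by (intro definable_count decidable_conj decidable_less decidable_eq definable_commas definable_arg)
      (simp_all add: definable_arg definable_commas)
qed

lemma decidable_bit_at: "definable f \<Longrightarrow> definable g \<Longrightarrow> decidable (\<lambda>x e. bit_at x (f x e) (g x e))"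
proof (rule decidable_comp2[of bit_at])
  show "decidable (\<lambda>x e. bit_at x (arg e 0) (arg e 1))"
    unfolding bit_at_def
    by (intro decidable_ex decidable_conj decidable_sym decidable_eq definable_commas definable_offset definable_arg)
      (simp_all add: definable_arg)
qed

text \<open>Summing by places or by numbers gives the same result. Column entries need not be bits,
  so an addend \<open>d i\<close> is put into place 0 as a whole; this place exists only for
  nonempty input.\<close>

lemma linear_form:
  assumes "0 < length x"
  shows "(\<Sum>k<length x. 2 ^ k * (\<Sum>i<length x. (if bit_at x (ix i) k then c i else 0) + (if k = 0 then d i else 0)))
    = (\<Sum>i<length x. c i * number x (ix i) + d i)"
proof -
  let ?N = "length x"
  have "(\<Sum>k<?N. 2 ^ k * (\<Sum>i<?N. (if bit_at x (ix i) k then c i else 0) + (if k = 0 then d i else 0)))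
    = (\<Sum>k<?N. \<Sum>i<?N. c i * (2 ^ k * (if bit_at x (ix i) k then 1 else 0)) + (if k = 0 then d i else 0))"
    unfolding sum_distrib_left by (intro sum.cong) (auto simp: algebra_simps)
  also have "\<dots> = (\<Sum>i<?N. \<Sum>k<?N. c i * (2 ^ k * (if bit_at x (ix i) k then 1 else 0)) + (if k = 0 then d i else 0))"
    by (rule sum.swap)
  also have "\<dots> = (\<Sum>i<?N. c i * number x (ix i) + d i)"
    unfolding number_def sum.distrib sum_distrib_left using assms by (simp add: sum.delta)
  finally show ?thesis .
qed

text \<open>An index contributes at most \<open>2 * D\<close> to a column, and
  \<open>decidable_binary_le\<close> needs twice its bound below \<open>C\<close>. This is the
  origin of \<open>4 * D < C\<close>.\<close>

lemma decidable_linear_le: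
  assumes c: "definable (\<lambda>x e. c x (drop 1 e) (arg e 0))" "definable (\<lambda>x e. c' x (drop 1 e) (arg e 0))"
    and d: "definable (\<lambda>x e. d x (drop 1 e) (arg e 0))" "definable (\<lambda>x e. d' x (drop 1 e) (arg e 0))"
    and ix: "definable (\<lambda>x e. ix x (drop 1 e) (arg e 0))" "definable (\<lambda>x e. ix' x (drop 1 e) (arg e 0))"
    and D: "\<And>x e i. c x e i \<le> D" "\<And>x e i. c' x e i \<le> D" "\<And>x e i. d x e i \<le> D" "\<And>x e i. d' x e i \<le> D" "4 * D < C"
  shows "decidable (\<lambda>x e. (\<Sum>i<length x. c x e i * number x (ix x e i) + d x e i)
      \<le> (\<Sum>i<length x. c' x e i * number x (ix' x e i) + d' x e i))"
proof -
  have lt: "a + b < width C x" if "a \<le> D" "b \<le> D" for a b x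
    using that D(5) C_le_width[of x] by linarith
  have c0: "definable (\<lambda>x e. 0)" using C by (intro definable_const) simp
  have "decidable (\<lambda>x e. (\<Sum>k<length x. 2 ^ k * (\<Sum>i<length x.
        (if bit_at x (ix x e i) k then c x e i else 0) + (if k = 0 then d x e i else 0)))
      \<le> (\<Sum>k<length x. 2 ^ k * (\<Sum>i<length x.
        (if bit_at x (ix' x e i) k then c' x e i else 0) + (if k = 0 then d' x e i else 0))))"
  proof (rule decidable_binary_le)
    show "definable (\<lambda>x e. (if bit_at x (ix x (drop 2 e) (arg e 0)) (arg e 1) then c x (drop 2 e) (arg e 0) else 0)
        + (if arg e 1 = 0 then d x (drop 2 e) (arg e 0) else 0))"
      by (intro definable_add definable_if decidable_bit_at decidable_eq c0 definable_arg
          definable_bound_var[OF c(1)] definable_bound_var[OF d(1)] definable_bound_var[OF ix(1)] lt)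
        (auto simp: D)
    show "definable (\<lambda>x e. (if bit_at x (ix' x (drop 2 e) (arg e 0)) (arg e 1) then c' x (drop 2 e) (arg e 0) else 0)
        + (if arg e 1 = 0 then d' x (drop 2 e) (arg e 0) else 0))"
      by (intro definable_add definable_if decidable_bit_at decidable_eq c0 definable_arg
          definable_bound_var[OF c(2)] definable_bound_var[OF d(2)] definable_bound_var[OF ix(2)] lt)
        (auto simp: D)
    show "(if bit_at x (ix x e i) k then c x e i else 0) + (if k = 0 then d x e i else 0) \<le> 2 * D" for x e k i
      using D(1)[of x e i] D(3)[of x e i] by simp
    show "(if bit_at x (ix' x e i) k then c' x e i else 0) + (if k = 0 then d' x e i else 0) \<le> 2 * D" for x e k i
      using D(2)[of x e i] D(4)[of x e i] by simp
    show "2 * (2 * D) < C" using D(5) by simp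
  qed
  then show ?thesis
  proof (rule decidable_cong, goal_cases)
    case (1 x e)
    show ?case
    proof (cases "length x = 0")
      case False then show ?thesis by (simp add: linear_form)
    qed simp
  qed
qed

text \<open>Concentrating the coefficients at index 0 lets the comparison of linear forms also treat
  a single scaled number or a constant.\<close>

lemma sum_first:
  fixes g :: "nat \<Rightarrow> nat"
  assumes "0 < n"
  shows "(\<Sum>i<n. (if i = 0 then a else 0) * g i + (if i = 0 then b else 0)) = a * g 0 + b"
  using assms by (simp add: sum.distrib if_distrib[where f = "\<lambda>c. c * _"] sum.delta cong: if_cong)

lemma number_eq_0: "length x = 0 \<Longrightarrow> number x i = 0"
  by (simp add: number_def)

lemma decidable_scaled_le:
  assumes c: "definable c" "definable c'" "definable f" "definable g"
    and D: "\<And>x e. c x e \<le> D" "\<And>x e. c' x e \<le> D" "4 * D < C"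
  shows "decidable (\<lambda>x e. c x e * number x (f x e) \<le> c' x e * number x (g x e))"
proof -
  have c0: "definable (\<lambda>x e. 0)" using C by (intro definable_const) simp
  have "decidable (\<lambda>x e. (\<Sum>i<length x. (if i = 0 then c x e else 0) * number x (f x e) + 0)
      \<le> (\<Sum>i<length x. (if i = 0 then c' x e else 0) * number x (g x e) + 0))"
    by (rule decidable_linear_le[where D = D])
      (use D in \<open>auto intro!: definable_if decidable_eq c0 definable_arg definable_drop c\<close>)
  then show ?thesis
  proof (rule decidable_cong, goal_cases)
    case (1 x e)
    show ?case
    proof (cases "length x = 0")
      case False
      then show ?thesis
        using sum_first[of "length x" "c x e" "\<lambda>_. number x (f x e)" 0]
          sum_first[of "length x" "c' x e" "\<lambda>_. number x (g x e)" 0] by simp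
    qed (simp add: number_eq_0)
  qed
qed

lemma decidable_number_eq_const:
  assumes f: "definable f" and v: "v \<le> D" "0 < D" "4 * D < C"
  shows "decidable (\<lambda>x e. number x (f x e) = v)"
proof -
  have c: "definable (\<lambda>x e. 0)" "definable (\<lambda>x e. 1)" "definable (\<lambda>x e. v)"
    using C v by (auto intro: definable_const)
  have 1: "decidable (\<lambda>x e. (\<Sum>i<length x. (if i = 0 then 1 else 0) * number x (f x e) + 0)
      \<le> (\<Sum>i<length x. 0 * number x 0 + (if i = 0 then v else 0)))"
    by (rule decidable_linear_le[where D = D])
      (use v in \<open>auto intro!: definable_if decidable_eq c c[unfolded One_nat_def] definable_arg definable_drop f\<close>)
  have 2: "decidable (\<lambda>x e. (\<Sum>i<length x. 0 * number x 0 + (if i = 0 then v else 0)) \<le>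
      (\<Sum>i<length x. (if i = 0 then 1 else 0) * number x (f x e) + 0))"
    by (rule decidable_linear_le[where D = D])
      (use v in \<open>auto intro!: definable_if decidable_eq c c[unfolded One_nat_def] definable_arg definable_drop f\<close>)
  \<comment> \<open>For empty input the sums have no index 0 and both vanish, so this case is
    decided separately.\<close>
  have "decidable (\<lambda>x e. if length x = 0 then 0 = v else
     (\<Sum>i<length x. (if i = 0 then 1 else 0) * number x (f x e) + 0)
      \<le> (\<Sum>i<length x. 0 * number x 0 + (if i = 0 then v else 0)) \<and>
     (\<Sum>i<length x. 0 * number x 0 + (if i = 0 then v else 0)) \<le>
      (\<Sum>i<length x. (if i = 0 then 1 else 0) * number x (f x e) + 0))"
    by (intro decidable_if decidable_conj 1 2 decidable_const decidable_eq definable_length c)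
  then show ?thesis
  proof (rule decidable_cong, goal_cases)
    case (1 x e)
    show ?case
    proof (cases "length x = 0")
      case False
      then show ?thesis
        using sum_first[of "length x" 1 "\<lambda>_. number x (f x e)" 0]
          sum_first[of "length x" 0 "\<lambda>_. number x 0" v] by auto
    qed (simp add: number_eq_0)
  qed
qed

end

subsection \<open>Greedy choices\<close>

definition strict_order_on :: "'a set \<Rightarrow> ('a \<Rightarrow> 'a \<Rightarrow> bool) \<Rightarrow> bool" where
  "strict_order_on S R \<longleftrightarrow> (\<forall>a\<in>S. \<not> R a a) \<and> (\<forall>a\<in>S. \<forall>b\<in>S. \<forall>c\<in>S. R a b \<longrightarrow> R b c \<longrightarrow> R a c) \<and>
     (\<forall>a\<in>S. \<forall>b\<in>S. a \<noteq> b \<longrightarrow> R a b \<or> R b a)"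

text \<open>The first \<open>u\<close> elements in the order \<open>R\<close>, expressed by their
  rank: membership is decided by counting predecessors, and nothing has to be sorted.\<close>

definition top_set :: "'a set \<Rightarrow> ('a \<Rightarrow> 'a \<Rightarrow> bool) \<Rightarrow> nat \<Rightarrow> 'a set" where
  "top_set S R u = {j \<in> S. card {i \<in> S. R i j} < u}"

lemma rank_strict:
  assumes "finite S" "strict_order_on S R" "a \<in> S" "b \<in> S" "R a b"
  shows "card {i \<in> S. R i a} < card {i \<in> S. R i b}"
proof (rule psubset_card_mono)
  show "finite {i \<in> S. R i b}" using assms(1) by simp
  have "a \<in> {i \<in> S. R i b}" "a \<notin> {i \<in> S. R i a}" "{i \<in> S. R i a} \<subseteq> {i \<in> S. R i b}"
    using assms unfolding strict_order_on_def by blast+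
  then show "{i \<in> S. R i a} \<subset> {i \<in> S. R i b}" by blast
qed

text \<open>Ranks are distinct and smaller than \<open>card S\<close>, so they fill the initial
  segment of that length.\<close>

lemma card_top_set:
  assumes fin: "finite S" and R: "strict_order_on S R"
  shows "card (top_set S R u) = min u (card S)"
proof -
  define rk where "rk j = card {i \<in> S. R i j}" for j
  have inj: "inj_on rk S"
  proof (rule inj_onI)
    fix a b assume ab: "a \<in> S" "b \<in> S" "rk a = rk b"
    show "a = b"
    proof (rule ccontr)
      assume "a \<noteq> b"
      then have "R a b \<or> R b a" using R ab unfolding strict_order_on_def by blast
      then show False using rank_strict[OF fin R ab(1,2)] rank_strict[OF fin R ab(2,1)] ab(3)
        unfolding rk_def by auto
    qed
  qed
  have lt: "rk j < card S" if "j \<in> S" for j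
  proof -
    have "\<not> R j j" using R that unfolding strict_order_on_def by blast
    then have "{i \<in> S. R i j} \<subset> S" using that by blast
    then show ?thesis unfolding rk_def by (rule psubset_card_mono[OF fin])
  qed
  have "rk ` S \<subseteq> {..<card S}" using lt by auto
  moreover have "card (rk ` S) = card {..<card S}" using inj by (simp add: card_image)
  ultimately have img: "rk ` S = {..<card S}" by (intro card_subset_eq) auto
  have "rk ` top_set S R u = rk ` S \<inter> {..<u}"
    unfolding top_set_def rk_def by auto
  also have "\<dots> = {..<min u (card S)}" unfolding img by auto
  finally have "card (rk ` top_set S R u) = min u (card S)" by simp
  moreover have "inj_on rk (top_set S R u)" using inj by (rule inj_on_subset) (auto simp: top_set_def)
  ultimately show ?thesis by (simp add: card_image)
qed

lemma top_set_above:
  assumes "finite S" "strict_order_on S R" "a \<in> top_set S R u" "b \<in> S" "b \<notin> top_set S R u"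
  shows "R a b"
proof -
  have a: "a \<in> S" "card {i \<in> S. R i a} < u" and b: "\<not> card {i \<in> S. R i b} < u"
    using assms(3-5) by (auto simp: top_set_def)
  have "\<not> R b a" using rank_strict[OF assms(1,2,4) a(1)] a(2) b by linarith
  moreover have "a \<noteq> b" using assms by blast
  ultimately show ?thesis using assms(2,4) a(1) unfolding strict_order_on_def by blast
qed

lemma sum_le_inj:
  fixes v :: "'a \<Rightarrow> nat"
  assumes "finite B" "inj_on f A" "f ` A \<subseteq> B" "\<And>a. a \<in> A \<Longrightarrow> v a \<le> v (f a)"
  shows "sum v A \<le> sum v B"
proof -
  have "sum v A \<le> sum (v \<circ> f) A" using assms(4) by (intro sum_mono) simp
  also have "\<dots> = sum v (f ` A)" using assms(2) by (simp add: sum.reindex)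
  also have "\<dots> \<le> sum v B" using assms(1,3) by (intro sum_mono2) auto
  finally show ?thesis .
qed

text \<open>\<open>A\<close> has no more elements outside the top set than the top set has outside
  \<open>A\<close>. An injection between these differences can only increase \<open>v\<close>,
  because members of the top set precede all other elements.\<close>

lemma top_set_maximal:
  fixes v :: "'a \<Rightarrow> nat"
  assumes fin: "finite S" and R: "strict_order_on S R"
    and v: "\<And>a b. a \<in> S \<Longrightarrow> b \<in> S \<Longrightarrow> R a b \<Longrightarrow> v b \<le> v a"
    and A: "A \<subseteq> S" "card A \<le> u"
  shows "sum v A \<le> sum v (top_set S R u)"
proof -
  let ?T = "top_set S R u"
  have T: "?T \<subseteq> S" by (auto simp: top_set_def)
  have finA: "finite A" and finT: "finite ?T" using A(1) T fin finite_subset by blast+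
  have "card A \<le> card ?T"
    unfolding card_top_set[OF fin R] using A card_mono[OF fin A(1)] by simp
  moreover have "card A = card (A \<inter> ?T) + card (A - ?T)" "card ?T = card (A \<inter> ?T) + card (?T - A)"
    using card_Int_Diff[OF finA, of ?T] card_Int_Diff[OF finT, of A] by (simp_all add: Int_commute)
  ultimately have "card (A - ?T) \<le> card (?T - A)" by linarith
  then obtain f where f: "f ` (A - ?T) \<subseteq> ?T - A" "inj_on f (A - ?T)"
    using card_le_inj[of "A - ?T" "?T - A"] finA finT by auto
  have "sum v (A - ?T) \<le> sum v (?T - A)"
  proof (rule sum_le_inj[OF _ f(2,1)])
    show "v a \<le> v (f a)" if a: "a \<in> A - ?T" for a
    proof (rule v)
      have "f a \<in> ?T" using f(1) a by blast
      then show "R (f a) a" using top_set_above[OF fin R] a A(1) by blast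
      show "f a \<in> S" "a \<in> S" using \<open>f a \<in> ?T\<close> T a A(1) by blast+
    qed
  qed (use finT in simp)
  moreover have "sum v A = sum v (A \<inter> ?T) + sum v (A - ?T)" "sum v ?T = sum v (A \<inter> ?T) + sum v (?T - A)"
    using sum.Int_Diff[OF finA, of v ?T] sum.Int_Diff[OF finT, of v A] by (simp_all add: Int_commute)
  ultimately show ?thesis by linarith
qed

text \<open>Ties are broken by the index, which makes the comparison of values a strict total order.\<close>

definition ahead :: "(nat \<Rightarrow> nat) \<Rightarrow> nat \<Rightarrow> nat \<Rightarrow> bool" where
  "ahead v i j \<longleftrightarrow> v j < v i \<or> v i = v j \<and> i < j"

lemma strict_order_ahead: "strict_order_on S (ahead v)"
  unfolding strict_order_on_def
proof (intro conjI ballI impI)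
  show "ahead v a c" if "ahead v a b" "ahead v b c" for a b c using that by (auto simp: ahead_def)
qed (auto simp: ahead_def)

lemma ahead_le: "ahead v i j \<Longrightarrow> v j \<le> v i"
  by (auto simp: ahead_def)

text \<open>In each class of \<open>ty\<close> this is a \<open>top_set\<close> with respect to
  weight, so an award of this form is determined by its counters \<open>u\<close>.\<close>

definition heaviest :: "nat \<Rightarrow> (nat \<Rightarrow> nat) \<Rightarrow> (nat \<Rightarrow> 'b) \<Rightarrow> ('b \<Rightarrow> nat) \<Rightarrow> nat set" where
  "heaviest n w ty u = {j. j < n \<and> card {i. i < n \<and> ty i = ty j \<and> ahead w i j} < u (ty j)}"

text \<open>\<open>f\<close> transports attacks on the award \<open>heaviest\<close> to attacks on
  \<open>VF\<close>. A target not in \<open>VF\<close> stays; a target in \<open>VF\<close> moves to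
  a voter of its class that only \<open>heaviest\<close> protects, which is therefore at least as
  heavy.\<close>

lemma exchange:
  fixes ty :: "nat \<Rightarrow> 'b"
  assumes VF: "VF \<subseteq> {..<n}"
  obtains u f where "card (heaviest n w ty u) = card VF" "\<And>t. u t \<le> n"
    "inj_on f ({..<n} - heaviest n w ty u)" "f ` ({..<n} - heaviest n w ty u) \<subseteq> {..<n} - VF"
    "\<And>j. j \<in> {..<n} - heaviest n w ty u \<Longrightarrow> ty (f j) = ty j \<and> w j \<le> w (f j)"
proof -
  define S where "S t = {j. j < n \<and> ty j = t}" for t
  define u where "u t = card (VF \<inter> S t)" for t
  define A where "A = heaviest n w ty u"
  have fin: "finite (S t)" "finite VF" "finite A" for t
    using VF finite_subset by (auto simp: S_def A_def heaviest_def)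
  have AS: "A \<inter> S t = top_set (S t) (ahead w) (u t)" for t
    unfolding A_def heaviest_def top_set_def S_def by (auto intro!: arg_cong[where f = card] simp: conj_assoc)
  have "u t \<le> card (S t)" for t unfolding u_def by (intro card_mono fin) simp
  then have cardt: "card (A \<inter> S t) = card (VF \<inter> S t)" for t
    unfolding AS card_top_set[OF fin(1) strict_order_ahead] by (simp add: u_def min_def)
  have split: "card X = (\<Sum>t\<in>ty ` {..<n}. card (X \<inter> S t))" if X: "X \<subseteq> {..<n}" for X
  proof -
    have "X = (\<Union>t\<in>ty ` {..<n}. X \<inter> S t)" using X by (auto simp: S_def)
    then have "card X = card (\<Union>t\<in>ty ` {..<n}. X \<inter> S t)" by simp
    also have "\<dots> = (\<Sum>t\<in>ty ` {..<n}. card (X \<inter> S t))"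
      by (rule card_UN_disjoint) (auto simp: S_def)
    finally show ?thesis .
  qed
  have A: "A \<subseteq> {..<n}" by (auto simp: A_def heaviest_def)
  have card: "card A = card VF" unfolding split[OF A] split[OF VF] cardt ..
  have "card (S t) \<le> card {..<n}" for t by (intro card_mono) (auto simp: S_def)
  then have un: "u t \<le> n" for t using \<open>\<And>t. u t \<le> card (S t)\<close>[of t] by (metis card_lessThan order.trans)
  \<comment> \<open>Both awards take equally many voters from each class, so the voters taken by
    only one of them can be matched.\<close>
  have "\<exists>g. bij_betw g (VF \<inter> S t - A) (A \<inter> S t - VF)" for t
  proof -
    have "card (VF \<inter> S t) = card (VF \<inter> S t \<inter> A) + card (VF \<inter> S t - A)"
      "card (A \<inter> S t) = card (A \<inter> S t \<inter> VF) + card (A \<inter> S t - VF)"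
      by (intro card_Int_Diff; simp add: fin)+
    moreover have "VF \<inter> S t \<inter> A = A \<inter> S t \<inter> VF" by blast
    ultimately have "card (VF \<inter> S t - A) = card (A \<inter> S t - VF)" using cardt[of t] by simp
    then show ?thesis by (intro finite_same_card_bij) (simp_all add: fin)
  qed
  then obtain g where g: "\<And>t. bij_betw (g t) (VF \<inter> S t - A) (A \<inter> S t - VF)" by metis
  define f where "f j = (if j \<in> VF then g (ty j) j else j)" for j
  have gj: "g (ty j) j \<in> A - VF" "ty (g (ty j) j) = ty j" "j \<in> VF \<inter> S (ty j) - A" "g (ty j) j \<in> A \<inter> S (ty j)"
    if "j \<in> VF" "j \<notin> A" for j
  proof -
    show 1: "j \<in> VF \<inter> S (ty j) - A" using that VF by (auto simp: S_def)
    then have "g (ty j) j \<in> A \<inter> S (ty j) - VF" using bij_betwE[OF g] by blast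
    then show "g (ty j) j \<in> A - VF" "ty (g (ty j) j) = ty j" "g (ty j) j \<in> A \<inter> S (ty j)" by (auto simp: S_def)
  qed
  show thesis
  proof (rule that[of u f], unfold A_def[symmetric])
    show "inj_on f ({..<n} - A)"
    proof (rule inj_onI)
      fix i j assume ij: "i \<in> {..<n} - A" "j \<in> {..<n} - A" "f i = f j"
      show "i = j"
      proof (cases "i \<in> VF"; cases "j \<in> VF")
        assume v: "i \<in> VF" "j \<in> VF"
        then have "g (ty i) i = g (ty j) j" using ij by (simp add: f_def)
        moreover have "ty i = ty j" using gj(2)[of i] gj(2)[of j] calculation v ij by auto
        ultimately show ?thesis
          using bij_betw_imp_inj_on[OF g[of "ty i"]] gj(3)[of i] gj(3)[of j] v ij unfolding inj_on_def by fastforce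
      next
        assume v: "i \<in> VF" "j \<notin> VF"
        then show ?thesis using ij gj(1)[of i] by (auto simp: f_def)
      next
        assume v: "i \<notin> VF" "j \<in> VF"
        then show ?thesis using ij gj(1)[of j] by (auto simp: f_def)
      next
        assume v: "i \<notin> VF" "j \<notin> VF"
        then show ?thesis using ij by (auto simp: f_def)
      qed
    qed
    show "f ` ({..<n} - A) \<subseteq> {..<n} - VF"
    proof
      fix y assume "y \<in> f ` ({..<n} - A)"
      then obtain j where j: "j \<in> {..<n} - A" "y = f j" by blast
      then show "y \<in> {..<n} - VF" using gj(1)[of j] A by (cases "j \<in> VF") (auto simp: f_def)
    qed
    show "ty (f j) = ty j \<and> w j \<le> w (f j)" if j: "j \<in> {..<n} - A" for j
    proof (cases "j \<in> VF")
      case True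
      then have "j \<notin> A" using j by blast
      note G = gj[OF True this]
      have "ahead w (g (ty j) j) j"
        using top_set_above[OF fin(1) strict_order_ahead, of "g (ty j) j" "ty j" w "u (ty j)" j]
        G(3,4) \<open>j \<notin> A\<close> AS[of "ty j"] by blast
      then show ?thesis using True G(2) ahead_le by (auto simp: f_def)
    qed (simp add: f_def)
  qed (use card un in auto)
qed

section \<open>Scores and optimal attacks\<close>

definition points :: "nat list \<Rightarrow> nat list \<Rightarrow> nat \<Rightarrow> nat" where
  "points alpha p c = voter_score alpha 1 p c"

text \<open>The largest shift of the difference between \<open>c\<close> and \<open>m - 1\<close>
  that bribing one voter of weight 1 can achieve: from its present value up to
  \<open>alpha ! 0 - alpha ! (m - 1)\<close>. For nonincreasing \<open>alpha\<close>, a preference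
  list \<open>p\<close> and a candidate \<open>c\<close>, the grouping makes the subtraction
  exact.\<close>

definition gain :: "nat \<Rightarrow> nat list \<Rightarrow> nat \<Rightarrow> nat list \<Rightarrow> nat" where
  "gain m alpha c p = (alpha ! 0 + points alpha p (m - 1)) - (alpha ! (m - 1) + points alpha p c)"

lemma voter_score_eq: "voter_score alpha w p c = w * points alpha p c"
  unfolding points_def voter_score_def sum_distrib_left by (intro sum.cong) auto

lemma points_nth: "distinct p \<Longrightarrow> z < length p \<Longrightarrow> points alpha p (p ! z) = alpha ! z"
  unfolding points_def voter_score_def
proof -
  assume p: "distinct p" "z < length p"
  have "(\<Sum>y<length p. if p ! y = p ! z then 1 * alpha ! y else 0) = (\<Sum>y<length p. if y = z then alpha ! y else 0)"
    using p by (intro sum.cong) (auto simp: nth_eq_iff_index_eq)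
  then show "(\<Sum>y<length p. if p ! y = p ! z then 1 * alpha ! y else 0) = alpha ! z" using p by simp
qed

lemma points_bounds:
  assumes mono: "\<forall>i j. i \<le> j \<longrightarrow> j < m \<longrightarrow> alpha ! j \<le> alpha ! i" and p: "is_pref m p" and c: "c < m"
  shows "alpha ! (m - 1) \<le> points alpha p c" "points alpha p c \<le> alpha ! 0"
proof -
  have "c \<in> set p" using p c by (simp add: is_pref_def)
  then obtain z where z: "z < length p" "p ! z = c" by (auto simp: in_set_conv_nth)
  have m: "length p = m" "distinct p" using p by (auto simp: is_pref_def)
  have "points alpha p c = alpha ! z" using points_nth[OF m(2) z(1)] z(2) by simp
  then show "alpha ! (m - 1) \<le> points alpha p c" "points alpha p c \<le> alpha ! 0"
    using mono z(1) m(1) by auto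
qed

text \<open>The witness ranks \<open>c\<close> first and \<open>m - 1\<close> last, with the
  remaining candidates between them.\<close>

lemma best_reply:
  assumes c: "c < m - 1"
  obtains p where "is_pref m p" "points alpha p c = alpha ! 0" "points alpha p (m - 1) = alpha ! (m - 1)"
proof -
  define q where "q = filter (\<lambda>i. i \<noteq> c) [0..<m - 1]"
  define p where "p = c # q @ [m - 1]"
  have q: "set q = {0..<m - 1} - {c}" "distinct q" by (auto simp: q_def)
  have "length q = card ({0..<m - 1} - {c})" using q distinct_card by metis
  also have "\<dots> = m - 2" using c by simp
  finally have len: "length q = m - 2" .
  have m: "{0..<m} = insert (m - 1) {0..<m - 1}" using c by auto
  have ins: "insert c ({0..<m - 1} - {c}) = {0..<m - 1}" using c by auto
  have "set p = insert (m - 1) (insert c (set q))" by (auto simp: p_def)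
  then have "set p = {0..<m}" unfolding q(1) ins m .
  moreover have "length p = m" using len c by (simp add: p_def)
  ultimately have pref: "is_pref m p" by (simp add: is_pref_def card_distinct)
  have "points alpha p (p ! 0) = alpha ! 0" "points alpha p (p ! (m - 1)) = alpha ! (m - 1)"
    using pref c by (auto intro!: points_nth simp: is_pref_def)
  moreover have "p ! 0 = c" by (simp add: p_def)
  moreover have "p ! (m - 1) = m - 1"
  proof -
    have "m - 1 = Suc (length q)" using len c by simp
    then show ?thesis by (simp add: p_def)
  qed
  ultimately show thesis using that pref by simp
qed

lemma total_score_eq:
  "total_score alpha vs P c = (\<Sum>j<length vs. points alpha (P j) c * fst (vs ! j))"
  unfolding total_score_def voter_score_eq by (simp add: mult.commute)

text \<open>Against a fixed rival \<open>c\<close> one list is optimal for every bribed voter, so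
  the choice of new lists disappears and an attack is measured by its total weighted gain.\<close>

lemma attack_iff:
  assumes mono: "\<forall>i j. i \<le> j \<longrightarrow> j < m \<longrightarrow> alpha ! j \<le> alpha ! i"
    and prefs: "\<forall>j<length vs. is_pref m (snd (vs ! j))"
    and c: "c < m - 1" and VB: "VB \<subseteq> {..<length vs}"
  shows "(\<forall>L. (\<forall>j\<in>VB. is_pref m (L j)) \<longrightarrow>
       total_score alpha vs (\<lambda>j. if j \<in> VB then L j else snd (vs ! j)) c
       \<le> total_score alpha vs (\<lambda>j. if j \<in> VB then L j else snd (vs ! j)) (m - 1)) \<longleftrightarrow>
    (\<Sum>j<length vs. points alpha (snd (vs ! j)) c * fst (vs ! j)) + (\<Sum>j\<in>VB. gain m alpha c (snd (vs ! j)) * fst (vs ! j))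
      \<le> (\<Sum>j<length vs. points alpha (snd (vs ! j)) (m - 1) * fst (vs ! j))"
    (is "(\<forall>L. ?pref L \<longrightarrow> ?T L c \<le> ?T L (m - 1)) \<longleftrightarrow> ?D c + ?G \<le> ?D (m - 1)")
proof -
  let ?n = "length vs" and ?w = "\<lambda>j. fst (vs ! j)" and ?p = "\<lambda>j. snd (vs ! j)"
  let ?P = "\<lambda>L j. if j \<in> VB then L j else ?p j"
  have G: "?G = (\<Sum>j<?n. if j \<in> VB then gain m alpha c (?p j) * ?w j else 0)"
    using VB by (simp add: sum.inter_restrict[symmetric] Int_absorb1)
  have gain_eq: "gain m alpha c (?p j) + (alpha ! (m - 1) + points alpha (?p j) c) = alpha ! 0 + points alpha (?p j) (m - 1)"
    if "j < ?n" for j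
  proof -
    have pj: "is_pref m (?p j)" using prefs that by blast
    have "points alpha (?p j) c \<le> alpha ! 0" "alpha ! (m - 1) \<le> points alpha (?p j) (m - 1)"
      using points_bounds[OF mono pj, of c] points_bounds[OF mono pj, of "m - 1"] c by auto
    then show ?thesis unfolding gain_def by linarith
  qed
  show ?thesis
  proof
    assume attack: "\<forall>L. ?pref L \<longrightarrow> ?T L c \<le> ?T L (m - 1)"
    obtain p where p: "is_pref m p" "points alpha p c = alpha ! 0" "points alpha p (m - 1) = alpha ! (m - 1)"
      using best_reply[OF c] by blast
    \<comment> \<open>Voter by voter, the reply \<open>p\<close> shifts the difference by exactly
      the gain; the equation is arranged without subtraction.\<close>
    have eq: "points alpha (?P (\<lambda>_. p) j) c * ?w j + points alpha (?p j) (m - 1) * ?w j =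
        points alpha (?P (\<lambda>_. p) j) (m - 1) * ?w j + points alpha (?p j) c * ?w j +
        (if j \<in> VB then gain m alpha c (?p j) * ?w j else 0)" if "j < ?n" for j
    proof (cases "j \<in> VB")
      case True
      have "(alpha ! 0 + points alpha (?p j) (m - 1)) * ?w j =
          (alpha ! (m - 1) + points alpha (?p j) c + gain m alpha c (?p j)) * ?w j"
        using gain_eq[OF that] by (intro arg_cong[where f = "\<lambda>z. z * ?w j"]) linarith
      then show ?thesis unfolding add_mult_distrib using True p by simp
    qed simp
    have "?T (\<lambda>_. p) c + ?D (m - 1) = ?T (\<lambda>_. p) (m - 1) + ?D c + ?G"
      unfolding total_score_eq G sum.distrib[symmetric] by (rule sum.cong[OF refl]) (rule eq, simp)
    moreover have "?T (\<lambda>_. p) c \<le> ?T (\<lambda>_. p) (m - 1)" using attack p(1) by simp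
    ultimately show "?D c + ?G \<le> ?D (m - 1)" by linarith
  next
    assume le: "?D c + ?G \<le> ?D (m - 1)"
    show "\<forall>L. ?pref L \<longrightarrow> ?T L c \<le> ?T L (m - 1)"
    proof (intro allI impI)
      fix L assume L: "?pref L"
      have ineq: "points alpha (?P L j) c * ?w j + points alpha (?p j) (m - 1) * ?w j \<le>
        points alpha (?P L j) (m - 1) * ?w j + points alpha (?p j) c * ?w j +
        (if j \<in> VB then gain m alpha c (?p j) * ?w j else 0)" if "j < ?n" for j
      proof (cases "j \<in> VB")
        case True
        then have Lj: "is_pref m (L j)" using L by blast
        have "points alpha (L j) c \<le> alpha ! 0" "alpha ! (m - 1) \<le> points alpha (L j) (m - 1)"
          using points_bounds[OF mono Lj, of c] points_bounds[OF mono Lj, of "m - 1"] c by auto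
        then have "points alpha (L j) c + points alpha (?p j) (m - 1) \<le>
          points alpha (L j) (m - 1) + points alpha (?p j) c + gain m alpha c (?p j)"
          using gain_eq[OF that] by linarith
        then have "(points alpha (L j) c + points alpha (?p j) (m - 1)) * ?w j \<le>
          (points alpha (L j) (m - 1) + points alpha (?p j) c + gain m alpha c (?p j)) * ?w j"
          by (rule mult_le_mono1)
        then show ?thesis using True by (simp add: add_mult_distrib)
      qed simp
      have "?T L c + ?D (m - 1) \<le> ?T L (m - 1) + ?D c + ?G"
        unfolding total_score_eq G sum.distrib[symmetric] by (intro sum_mono ineq) simp
      then show "?T L c \<le> ?T L (m - 1)" using le by linarith
    qed
  qed
qed

text \<open>The attack budget limits only the number of bribed voters, so for a fixed rival the
  voters of largest weighted gain form a worst attack; \<open>resists_iff\<close> justifies testing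
  it alone.\<close>

definition resists :: "nat \<Rightarrow> nat list \<Rightarrow> pinst \<Rightarrow> nat set \<Rightarrow> nat \<Rightarrow> bool" where
  "resists m alpha I VF c \<longleftrightarrow> (let n = length (voters I); w = (\<lambda>j. fst (voters I ! j)); p = (\<lambda>j. snd (voters I ! j));
     v = (\<lambda>j. gain m alpha c (p j) * w j) in
     (\<Sum>j<n. points alpha (p j) c * w j) + sum v (top_set ({..<n} - VF) (ahead v) (attB I))
      \<le> (\<Sum>j<n. points alpha (p j) (m - 1) * w j))"

lemma resists_iff:
  "resists m alpha I VF c \<longleftrightarrow> (\<forall>VB. VB \<subseteq> {..<length (voters I)} - VF \<longrightarrow> card VB \<le> attB I \<longrightarrow>
     (\<Sum>j<length (voters I). points alpha (snd (voters I ! j)) c * fst (voters I ! j))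
     + (\<Sum>j\<in>VB. gain m alpha c (snd (voters I ! j)) * fst (voters I ! j))
      \<le> (\<Sum>j<length (voters I). points alpha (snd (voters I ! j)) (m - 1) * fst (voters I ! j)))"
    (is "_ \<longleftrightarrow> (\<forall>VB. ?adm VB \<longrightarrow> card VB \<le> _ \<longrightarrow> ?X + sum ?v VB \<le> ?Y)")
proof -
  let ?S = "{..<length (voters I)} - VF" and ?T = "top_set ({..<length (voters I)} - VF) (ahead ?v) (attB I)"
  have T: "?T \<subseteq> ?S" by (auto simp: top_set_def)
  have T': "card ?T \<le> attB I" using card_top_set[OF _ strict_order_ahead, of ?S] by simp
  have max: "sum ?v VB \<le> sum ?v ?T" if "VB \<subseteq> ?S" "card VB \<le> attB I" for VB
    by (rule top_set_maximal[OF _ strict_order_ahead ahead_le that]) simp_all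
  have "resists m alpha I VF c \<longleftrightarrow> ?X + sum ?v ?T \<le> ?Y" by (simp add: resists_def Let_def)
  also have "\<dots> \<longleftrightarrow> (\<forall>VB. ?adm VB \<longrightarrow> card VB \<le> attB I \<longrightarrow> ?X + sum ?v VB \<le> ?Y)"
  proof
    assume le: "?X + sum ?v ?T \<le> ?Y"
    show "\<forall>VB. ?adm VB \<longrightarrow> card VB \<le> attB I \<longrightarrow> ?X + sum ?v VB \<le> ?Y"
      using order.trans[OF add_left_mono[OF max] le] by blast
  next
    assume "\<forall>VB. ?adm VB \<longrightarrow> card VB \<le> attB I \<longrightarrow> ?X + sum ?v VB \<le> ?Y"
    then show "?X + sum ?v ?T \<le> ?Y" using T T' by blast
  qed
  finally show ?thesis .
qed

text \<open>Safety is a conjunction over the rivals, so each of them may be tested with its own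
  worst attack, although the award is shared.\<close>

lemma protectable_iff_resists:
  assumes mono: "\<forall>i j. i \<le> j \<longrightarrow> j < m \<longrightarrow> alpha ! j \<le> alpha ! i" and valid: "valid_instance m alpha I"
  shows "protectable m alpha I \<longleftrightarrow>
    (\<exists>VF. VF \<subseteq> {..<length (voters I)} \<and> card VF \<le> defB I \<and> (\<forall>c<m - 1. resists m alpha I VF c))"
proof -
  have prefs: "\<forall>j<length (voters I). is_pref m (snd (voters I ! j))"
    using valid by (simp add: valid_instance_def)
  have c: "c < m \<and> c \<noteq> m - 1 \<longleftrightarrow> c < m - 1" for c by auto
  have "(\<forall>VB L. VB \<subseteq> {0..<length (voters I)} - VF \<longrightarrow> card VB \<le> attB I \<longrightarrow> (\<forall>j\<in>VB. is_pref m (L j)) \<longrightarrow>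
          (let prefs = (\<lambda>j. if j \<in> VB then L j else orig_prefs (voters I) j) in
           \<forall>c<m. c \<noteq> m - 1 \<longrightarrow>
             total_score alpha (voters I) prefs c \<le> total_score alpha (voters I) prefs (m - 1)))
      \<longleftrightarrow> (\<forall>c<m - 1. resists m alpha I VF c)" (is "?L \<longleftrightarrow> _") for VF
  proof -
    have "?L \<longleftrightarrow> (\<forall>c<m - 1. \<forall>VB. VB \<subseteq> {..<length (voters I)} - VF \<longrightarrow> card VB \<le> attB I \<longrightarrow>
       (\<forall>L. (\<forall>j\<in>VB. is_pref m (L j)) \<longrightarrow>
       total_score alpha (voters I) (\<lambda>j. if j \<in> VB then L j else snd (voters I ! j)) c
       \<le> total_score alpha (voters I) (\<lambda>j. if j \<in> VB then L j else snd (voters I ! j)) (m - 1)))"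
      unfolding Let_def orig_prefs_def atLeast0LessThan imp_conjL[symmetric] c by blast
    also have "\<dots> \<longleftrightarrow> (\<forall>c<m - 1. resists m alpha I VF c)"
      unfolding resists_iff using attack_iff[OF mono prefs] by (intro all_cong imp_cong refl) blast
    finally show ?thesis .
  qed
  then show ?thesis unfolding protectable_def atLeast0LessThan by simp
qed

text \<open>The injection from \<open>exchange\<close> preserves lists, hence gains for every rival,
  and does not decrease weights. An attack that beats the replacing award would therefore be mapped
  to one that beats the original.\<close>

lemma protectable_iff_heaviest:
  assumes mono: "\<forall>i j. i \<le> j \<longrightarrow> j < m \<longrightarrow> alpha ! j \<le> alpha ! i" and valid: "valid_instance m alpha I"
  defines "A \<equiv> heaviest (length (voters I)) (\<lambda>j. fst (voters I ! j)) (\<lambda>j. snd (voters I ! j))"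
  shows "protectable m alpha I \<longleftrightarrow>
    (\<exists>u. (\<forall>t. u t \<le> length (voters I)) \<and> card (A u) \<le> defB I \<and> (\<forall>c<m - 1. resists m alpha I (A u) c))"
proof
  assume "protectable m alpha I"
  then obtain VF where VF: "VF \<subseteq> {..<length (voters I)}" "card VF \<le> defB I" "\<forall>c<m - 1. resists m alpha I VF c"
    unfolding protectable_iff_resists[OF mono valid] by blast
  let ?n = "length (voters I)" and ?w = "\<lambda>j. fst (voters I ! j)" and ?p = "\<lambda>j. snd (voters I ! j)"
  obtain u f where u: "card (A u) = card VF" "\<And>t. u t \<le> ?n"
    and f: "inj_on f ({..<?n} - A u)" "f ` ({..<?n} - A u) \<subseteq> {..<?n} - VF"
      "\<And>j. j \<in> {..<?n} - A u \<Longrightarrow> ?p (f j) = ?p j \<and> ?w j \<le> ?w (f j)"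
    using exchange[OF VF(1), of ?w ?p] unfolding A_def by blast
  have "resists m alpha I (A u) c" if "c < m - 1" for c
    unfolding resists_iff
  proof (intro allI impI)
    fix VB assume VB: "VB \<subseteq> {..<?n} - A u" "card VB \<le> attB I"
    have "f ` VB \<subseteq> {..<?n} - VF" using VB(1) f(2) by blast
    moreover have "card (f ` VB) \<le> attB I"
      using VB card_image_le[of VB f] finite_subset[OF VB(1)] by simp
    ultimately have "(\<Sum>j<?n. points alpha (?p j) c * ?w j) + (\<Sum>j\<in>f ` VB. gain m alpha c (?p j) * ?w j)
       \<le> (\<Sum>j<?n. points alpha (?p j) (m - 1) * ?w j)"
      using VF(3) that unfolding resists_iff by blast
    moreover have "(\<Sum>j\<in>VB. gain m alpha c (?p j) * ?w j) \<le> (\<Sum>j\<in>f ` VB. gain m alpha c (?p j) * ?w j)"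
    proof (rule sum_le_inj[where f = f])
      show "finite (f ` VB)" using finite_subset[OF VB(1)] by simp
      show "inj_on f VB" using f(1) VB(1) by (rule inj_on_subset)
      show "gain m alpha c (?p j) * ?w j \<le> gain m alpha c (?p (f j)) * ?w (f j)" if "j \<in> VB" for j
      proof -
        have "?p (f j) = ?p j" "?w j \<le> ?w (f j)" using f(3)[of j] that VB(1) by blast+
        then show ?thesis by simp
      qed
    qed simp
    ultimately show "(\<Sum>j<?n. points alpha (?p j) c * ?w j) + (\<Sum>j\<in>VB. gain m alpha c (?p j) * ?w j)
       \<le> (\<Sum>j<?n. points alpha (?p j) (m - 1) * ?w j)" by linarith
  qed
  then show "\<exists>u. (\<forall>t. u t \<le> ?n) \<and> card (A u) \<le> defB I \<and> (\<forall>c<m - 1. resists m alpha I (A u) c)"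
    using u VF(2) by (intro exI[of _ u]) simp
next
  assume "\<exists>u. (\<forall>t. u t \<le> length (voters I)) \<and> card (A u) \<le> defB I \<and> (\<forall>c<m - 1. resists m alpha I (A u) c)"
  moreover have "A u \<subseteq> {..<length (voters I)}" for u by (auto simp: A_def heaviest_def)
  ultimately show "protectable m alpha I" unfolding protectable_iff_resists[OF mono valid] by blast
qed

subsection \<open>The decision procedure\<close>

context machine begin

text \<open>A budget may be larger than any register value and is never loaded. Instead the count is
  written as a linear form of indicators and compared with the number in binary.\<close>

lemma decidable_count_less_number:
  assumes p: "decidable (\<lambda>x e. p x (drop 1 e) (arg e 0))" and k: "k < C" "4 < C"
  shows "decidable (\<lambda>x e. card {i. i < length x \<and> p x e i} < number x k)"
    and "decidable (\<lambda>x e. card {i. i < length x \<and> p x e i} \<le> number x k)"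
proof -
  have c: "definable (\<lambda>x e. 0)" "definable (\<lambda>x e. Suc 0)" "definable (\<lambda>x e. k)"
    using k by (auto intro: definable_const)
  have ind: "definable (\<lambda>x e. if arg e 0 = 0 then Suc 0 else 0)"
    "definable (\<lambda>x e. if p x (drop 1 e) (arg e 0) then Suc 0 else 0)"
    by (intro definable_if decidable_eq c definable_arg p)+
  have count: "(\<Sum>i<length x. 0 * number x 0 + (if p x e i then Suc 0 else 0)) = card {i. i < length x \<and> p x e i}" for x e
    by (simp add: sum.If_cases Int_def)
  have num: "(\<Sum>i<length x. (if i = 0 then Suc 0 else 0) * number x k + 0) = number x k" for x
    using sum_first[of "length x" "Suc 0" "\<lambda>_. number x k" 0] number_eq_0[of x k] by (cases "length x = 0") simp_all
  have "decidable (\<lambda>x e. (\<Sum>i<length x. (if i = 0 then Suc 0 else 0) * number x k + 0)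
      \<le> (\<Sum>i<length x. 0 * number x 0 + (if p x e i then Suc 0 else 0)))"
    by (rule decidable_linear_le[where D = 1]) (use k in \<open>auto intro: c ind[unfolded One_nat_def]\<close>)
  then have "decidable (\<lambda>x e. \<not> number x k \<le> card {i. i < length x \<and> p x e i})"
    unfolding count num by (rule decidable_not)
  then show "decidable (\<lambda>x e. card {i. i < length x \<and> p x e i} < number x k)"
    by (simp add: not_le)
  have "decidable (\<lambda>x e. (\<Sum>i<length x. 0 * number x 0 + (if p x e i then Suc 0 else 0))
      \<le> (\<Sum>i<length x. (if i = 0 then Suc 0 else 0) * number x k + 0))"
    by (rule decidable_linear_le[where D = 1]) (use k in \<open>auto intro: c ind[unfolded One_nat_def]\<close>)
  then show "decidable (\<lambda>x e. card {i. i < length x \<and> p x e i} \<le> number x k)"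
    unfolding count num .
qed

text \<open>One nested search for each entry of the list; the depth \<open>n\<close> is a constant
  of the program, so the cost stays polynomial.\<close>

lemma decidable_ex_list:
  assumes "decidable p"
  shows "decidable (\<lambda>x e. \<exists>u. length u = n \<and> (\<forall>v\<in>set u. v < length x) \<and> p x (u @ e))"
proof (induction n)
  case 0 then show ?case using assms by simp
next
  case (Suc n)
  have "(\<exists>i<length x. \<exists>u. length u = n \<and> (\<forall>v\<in>set u. v < length x) \<and> p x (u @ i # e)) \<longleftrightarrow>
    (\<exists>u. length u = Suc n \<and> (\<forall>v\<in>set u. v < length x) \<and> p x (u @ e))" (is "?l \<longleftrightarrow> ?r") for x e
  proof
    assume ?l
    then obtain i u where iu: "i < length x" "length u = n" "\<forall>v\<in>set u. v < length x" "p x (u @ i # e)" by blast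
    show ?r by (rule exI[of _ "u @ [i]"]) (use iu in auto)
  next
    assume ?r
    then obtain u where u: "length u = Suc n" "\<forall>v\<in>set u. v < length x" "p x (u @ e)" by blast
    obtain w i where wi: "u = w @ [i]" using u(1) by (metis length_Suc_conv_rev)
    show ?l by (rule exI[of _ i], rule conjI, use u wi in simp, rule exI[of _ w]) (use u wi in simp)
  qed
  moreover have "decidable (\<lambda>x e. \<exists>i<length x. \<exists>u. length u = n \<and> (\<forall>v\<in>set u. v < length x) \<and> p x (u @ i # e))"
    using decidable_ex_env[OF Suc] .
  ultimately show ?case by presburger
qed

lemma definable_mult_const_mod: "definable (\<lambda>x e. (n * arg e i) mod width C x)"
proof (induction n)
  case 0
  then show ?case using definable_const[of 0] C by simp
next
  case (Suc n)
  have "definable (\<lambda>x e. ((n * arg e i) mod width C x + arg e i) mod width C x)"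
    by (rule definable_add_mod[OF Suc definable_arg])
  then show ?case by (rule definable_cong) (simp add: mod_simps add.commute)
qed

end

text \<open>Number 0 of the input is the defence budget,
  number 1 the attack budget, and voter j occupies the numbers from (m + 1) * j + 2 on.\<close>

locale voting = machine +
  fixes m :: nat and alpha :: "nat list" and T :: "nat list list" and D :: nat
  assumes types: "\<And>t z. t \<in> set T \<Longrightarrow> z < m \<Longrightarrow> t ! z \<le> D"
    and bounds: "\<And>t c. t \<in> set T \<Longrightarrow> points alpha t c + gain m alpha c t \<le> D"
    and D: "0 < D" "4 * D < C" "m + 3 \<le> C"
begin

text \<open>The index of number \<open>z\<close> in the block of voter \<open>j\<close>. The
  remainder makes it definable for all register values; \<open>slot_eq\<close> shows that nothing
  overflows on encodings.\<close>

definition slot :: "nat \<Rightarrow> nat list \<Rightarrow> nat \<Rightarrow> nat" where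
  "slot z x j = ((m + 1) * j + (2 + z)) mod width C x"

definition weight :: "nat list \<Rightarrow> nat \<Rightarrow> nat" where
  "weight x j = number x (slot 0 x j)"

definition has_type :: "nat list \<Rightarrow> nat list \<Rightarrow> nat \<Rightarrow> bool" where
  "has_type t x j \<longleftrightarrow> (\<forall>z\<in>{..<m}. number x (slot (Suc z) x j) = t ! z)"

definition is_voter :: "nat list \<Rightarrow> nat \<Rightarrow> bool" where
  "is_voter x j \<longleftrightarrow> slot 0 x j < commas x (length x)"

text \<open>A function of the preference list becomes a finite case distinction whose values
  \<open>h t\<close> are constants of the program. Blocks that match no list receive 0.\<close>

fun by_type :: "(nat list \<Rightarrow> nat) \<Rightarrow> nat list list \<Rightarrow> nat list \<Rightarrow> nat \<Rightarrow> nat" where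
  "by_type h [] x j = 0"
| "by_type h (t # ts) x j = (if has_type t x j then h t else by_type h ts x j)"

definition awarded :: "nat list \<Rightarrow> nat list \<Rightarrow> nat \<Rightarrow> bool" where
  "awarded x u j \<longleftrightarrow> (\<exists>k\<in>{..<length T}. has_type (T ! k) x j \<and>
     card {i. i < length x \<and> (is_voter x i \<and> has_type (T ! k) x i \<and> ahead (weight x) i j)} < arg u k)"

definition unprotected :: "nat list \<Rightarrow> nat list \<Rightarrow> nat \<Rightarrow> bool" where
  "unprotected x u j \<longleftrightarrow> is_voter x j \<and> \<not> awarded x u j"

definition damage :: "nat \<Rightarrow> nat list \<Rightarrow> nat \<Rightarrow> nat" where
  "damage c x j = by_type (gain m alpha c) T x j * weight x j"

text \<open>The rank condition of \<open>top_set\<close>, spelled out as a count that is compared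
  with the binary attack budget.\<close>

definition bribed :: "nat \<Rightarrow> nat list \<Rightarrow> nat list \<Rightarrow> nat \<Rightarrow> bool" where
  "bribed c x u j \<longleftrightarrow> unprotected x u j \<and>
     card {i. i < length x \<and> (unprotected x u i \<and> ahead (damage c x) i j)} < number x 1"

definition affordable :: "nat list \<Rightarrow> nat list \<Rightarrow> bool" where
  "affordable x u \<longleftrightarrow> card {j. j < length x \<and> (is_voter x j \<and> awarded x u j)} \<le> number x 0"

text \<open>Points and gain of a voter are merged into one coefficient of its weight, so each side
  is a single linear form; this is why the locale bounds their sum.\<close>

definition survives :: "nat \<Rightarrow> nat list \<Rightarrow> nat list \<Rightarrow> bool" where
  "survives c x u \<longleftrightarrow>
     (\<Sum>j<length x. (if is_voter x j then by_type (\<lambda>t. points alpha t c) T x j +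
        (if bribed c x u j then by_type (gain m alpha c) T x j else 0) else 0) * number x (slot 0 x j) + 0)
     \<le> (\<Sum>j<length x. (if is_voter x j then by_type (\<lambda>t. points alpha t (m - 1)) T x j else 0)
        * number x (slot 0 x j) + 0)"

definition accepted :: "nat list \<Rightarrow> nat list \<Rightarrow> bool" where
  "accepted x e \<longleftrightarrow> (\<exists>u. length u = length T \<and> (\<forall>v\<in>set u. v < length x) \<and>
     affordable x (u @ e) \<and> (\<forall>c\<in>{..<m - 1}. survives c x (u @ e)))"

lemma definable_slot: "z \<le> m \<Longrightarrow> definable f \<Longrightarrow> definable (\<lambda>x e. slot z x (f x e))"
proof (rule definable_comp1[of "slot z"])
  assume z: "z \<le> m"
  have "definable (\<lambda>x e. (((m + 1) * arg e 0) mod width C x + (2 + z)) mod width C x)"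
    by (rule definable_add_mod[OF definable_mult_const_mod definable_const]) (use z D in linarith)
  then show "definable (\<lambda>x e. slot z x (arg e 0))"
    by (rule definable_cong) (simp only: slot_def mod_add_left_eq)
qed

lemma decidable_has_type: "t \<in> set T \<Longrightarrow> definable f \<Longrightarrow> decidable (\<lambda>x e. has_type t x (f x e))"
  unfolding has_type_def
  by (intro decidable_ball decidable_number_eq_const[where D = D] definable_slot) (use types D in auto)

lemma decidable_is_voter: "definable f \<Longrightarrow> decidable (\<lambda>x e. is_voter x (f x e))"
  unfolding is_voter_def by (intro decidable_less definable_slot definable_commas definable_length) simp_all

lemma by_type_le: "(\<And>t. t \<in> set ts \<Longrightarrow> h t \<le> b) \<Longrightarrow> by_type h ts x j \<le> b"
  by (induction ts) auto

lemma definable_by_type: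
  "(\<And>t. t \<in> set T \<Longrightarrow> h t \<le> D) \<Longrightarrow> definable f \<Longrightarrow> definable (\<lambda>x e. by_type h T x (f x e))"
proof -
  assume h: "\<And>t. t \<in> set T \<Longrightarrow> h t \<le> D" and f: "definable f"
  have "set ts \<subseteq> set T \<Longrightarrow> definable (\<lambda>x e. by_type h ts x (f x e))" for ts
  proof (induction ts)
    case Nil then show ?case using definable_const[of 0] C by simp
  next
    case (Cons t ts)
    then have t: "t \<in> set T" and IH: "definable (\<lambda>x e. by_type h ts x (f x e))" by simp_all
    have "h t < C" using h[OF t] D by linarith
    then show ?case unfolding by_type.simps by (intro definable_if decidable_has_type t f IH definable_const)
  qed
  then show ?thesis by simp
qed

lemma points_le: "t \<in> set T \<Longrightarrow> points alpha t c \<le> D" and gain_le: "t \<in> set T \<Longrightarrow> gain m alpha c t \<le> D"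
  using bounds[of t c] by linarith+

lemma decidable_ahead_scaled:
  assumes "\<And>t. t \<in> set T \<Longrightarrow> h t \<le> D" "definable f" "definable g"
  shows "decidable (\<lambda>x e. ahead (\<lambda>j. by_type h T x j * weight x j) (f x e) (g x e))"
proof -
  have le: "decidable (\<lambda>x e. by_type h T x (f x e) * number x (slot 0 x (f x e))
      \<le> by_type h T x (g x e) * number x (slot 0 x (g x e)))"
    if "definable f" "definable g" for f g
    by (rule decidable_scaled_le[where D = D])
      (use that D assms(1) in \<open>auto intro!: definable_by_type definable_slot by_type_le\<close>)
  \<comment> \<open>\<open>ahead\<close> is expressed by \<open>\<le>\<close> alone: if the first
    comparison fails, the value of \<open>f\<close> is strictly larger; otherwise the values must be
    equal and the index decides.\<close>
  have "decidable (\<lambda>x e. if by_type h T x (f x e) * number x (slot 0 x (f x e))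
      \<le> by_type h T x (g x e) * number x (slot 0 x (g x e)) then
        by_type h T x (g x e) * number x (slot 0 x (g x e)) \<le> by_type h T x (f x e) * number x (slot 0 x (f x e))
        \<and> f x e < g x e else True)"
    by (intro decidable_if decidable_conj le assms decidable_less decidable_const)
  then show ?thesis
    by (rule decidable_cong) (auto simp: ahead_def weight_def)
qed

lemma decidable_ahead_weight:
  assumes "definable f" "definable g"
  shows "decidable (\<lambda>x e. ahead (weight x) (f x e) (g x e))"
proof -
  have le: "decidable (\<lambda>x e. 1 * number x (slot 0 x (f x e)) \<le> 1 * number x (slot 0 x (g x e)))"
    if "definable f" "definable g" for f g
    by (rule decidable_scaled_le[where D = D])
      (use that D C in \<open>auto intro!: definable_const[of "Suc 0"] definable_slot\<close>)
  have "decidable (\<lambda>x e. if 1 * number x (slot 0 x (f x e)) \<le> 1 * number x (slot 0 x (g x e)) then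
        1 * number x (slot 0 x (g x e)) \<le> 1 * number x (slot 0 x (f x e)) \<and> f x e < g x e else True)"
    by (intro decidable_if decidable_conj le assms decidable_less decidable_const)
  then show ?thesis
    by (rule decidable_cong) (auto simp: ahead_def weight_def)
qed

lemma decidable_awarded: "decidable (\<lambda>x e. awarded x (drop 1 e) (arg e 0))"
  unfolding awarded_def
  by (intro decidable_bex decidable_conj decidable_less definable_count decidable_has_type decidable_is_voter
      decidable_ahead_weight) (auto intro: definable_arg)

lemma decidable_unprotected: "decidable (\<lambda>x e. unprotected x (drop 1 e) (arg e 0))"
  unfolding unprotected_def
  by (intro decidable_conj decidable_not decidable_is_voter definable_arg decidable_awarded)

lemma decidable_bribed: "decidable (\<lambda>x e. bribed c x (drop 1 e) (arg e 0))"
  unfolding bribed_def damage_def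
proof (intro decidable_conj decidable_unprotected decidable_count_less_number(1))
  show "decidable (\<lambda>x e. unprotected x (drop 1 (drop 1 e)) (arg e 0))"
    using decidable_bound_var[OF decidable_unprotected definable_arg, of 2 0] by (simp add: numeral_2_eq_2)
  show "decidable (\<lambda>x e. ahead (\<lambda>j. by_type (gain m alpha c) T x j * weight x j) (arg e 0) (arg (drop 1 e) 0))"
    by (rule decidable_ahead_scaled) (simp_all add: gain_le definable_arg)
qed (use D in simp_all)

lemma decidable_affordable: "decidable affordable"
  unfolding affordable_def
  by (intro decidable_count_less_number(2) decidable_conj decidable_is_voter definable_arg decidable_awarded)
    (use D in simp_all)

lemma decidable_survives: "decidable (survives c)"
proof -
  have c0: "definable (\<lambda>x e. 0)" using C by (intro definable_const) simp
  have lt: "by_type (\<lambda>t. points alpha t c) T x j + by_type (gain m alpha c) T x j \<le> D" for x j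
  proof -
    have "set ts \<subseteq> set T \<Longrightarrow> by_type (\<lambda>t. points alpha t c) ts x j + by_type (gain m alpha c) ts x j \<le> D" for ts
      by (induction ts) (auto simp: bounds)
    then show ?thesis by simp
  qed
  have W: "D < width C x" for x using C_le_width[of x] D by linarith
  have "decidable (\<lambda>x e. survives c x e)"
    unfolding survives_def
  proof (rule decidable_linear_le[where D = D])
    show "definable (\<lambda>x e. if is_voter x (arg e 0) then by_type (\<lambda>t. points alpha t c) T x (arg e 0) +
        (if bribed c x (drop 1 e) (arg e 0) then by_type (gain m alpha c) T x (arg e 0) else 0) else 0)"
    proof (intro definable_if decidable_is_voter definable_add definable_by_type decidable_bribed definable_arg c0 points_le gain_le)
      show "by_type (\<lambda>t. points alpha t c) T x (arg e 0) +
        (if bribed c x (drop 1 e) (arg e 0) then by_type (gain m alpha c) T x (arg e 0) else 0) < width C x" for x e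
        using lt[of x "arg e 0"] W[of x] by (auto intro: order.strict_trans1)
    qed
    show "definable (\<lambda>x e. if is_voter x (arg e 0) then by_type (\<lambda>t. points alpha t (m - 1)) T x (arg e 0) else 0)"
      by (intro definable_if decidable_is_voter definable_by_type definable_arg c0 points_le)
    show "(if is_voter x j then by_type (\<lambda>t. points alpha t c) T x j +
        (if bribed c x u j then by_type (gain m alpha c) T x j else 0) else 0) \<le> D" for x u j
      using lt[of x j] by auto
    show "(if is_voter x j then by_type (\<lambda>t. points alpha t (m - 1)) T x j else 0) \<le> D" for x j
      using by_type_le[of T "\<lambda>t. points alpha t (m - 1)" D x j] points_le by auto
  qed (use D in \<open>auto intro: c0 definable_slot definable_arg\<close>)
  then show ?thesis .
qed

lemma decidable_accepted: "decidable accepted"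
proof -
  have "decidable (\<lambda>x e. affordable x e \<and> (\<forall>c\<in>{..<m - 1}. survives c x e))"
    by (intro decidable_conj decidable_affordable decidable_ball decidable_survives) simp
  from decidable_ex_list[OF this, of "length T"] show ?thesis
    unfolding accepted_def .
qed

end

section \<open>Correctness on encoded instances\<close>

definition input_numbers :: "pinst \<Rightarrow> nat list" where
  "input_numbers I = defB I # attB I # concat (map (\<lambda>v. fst v # snd v) (voters I))"

lemma encode_eq: "encode I = concat (map enc_num (input_numbers I))"
proof -
  have "concat (map enc_voter vs) = concat (map enc_num (concat (map (\<lambda>v. fst v # snd v) vs)))" for vs
    by (induction vs) (simp_all add: enc_voter_def)
  then show ?thesis by (simp add: encode_def input_numbers_def)
qed

lemma nth_concat_blocks:
  "\<forall>xs\<in>set xss. length xs = k \<Longrightarrow> j < length xss \<Longrightarrow> z < k \<Longrightarrow> concat xss ! (k * j + z) = xss ! j ! z"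
proof (induction xss arbitrary: j)
  case (Cons xs xss)
  then show ?case by (cases j) (auto simp: nth_append)
qed simp

lemma length_concat_blocks: "\<forall>xs\<in>set xss. length xs = k \<Longrightarrow> length (concat xss) = k * length xss"
  by (induction xss) auto

locale voting_instance = voting +
  fixes I :: pinst
  assumes pos: "1 \<le> m" and valid: "valid_instance m alpha I"
    and all_types: "set T = {p. is_pref m p}" "distinct T"
begin

abbreviation "vs \<equiv> voters I"
abbreviation "x \<equiv> encode I"
abbreviation "n \<equiv> length vs"
abbreviation "w j \<equiv> fst (vs ! j)"
abbreviation "p j \<equiv> snd (vs ! j)"

lemma pref: "j < n \<Longrightarrow> is_pref m (p j)"
  using valid by (simp add: valid_instance_def)

lemma blocks: "\<forall>b\<in>set (map (\<lambda>v. fst v # snd v) vs). length b = m + 1"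
proof
  fix b assume "b \<in> set (map (\<lambda>v. fst v # snd v) vs)"
  then obtain j where "j < n" "b = w j # p j" by (auto simp: in_set_conv_nth)
  then show "length b = m + 1" using pref[of j] by (simp add: is_pref_def)
qed

lemma length_input_numbers: "length (input_numbers I) = (m + 1) * n + 2"
  using length_concat_blocks[OF blocks] by (simp add: input_numbers_def)

lemma commas_x: "commas x (length x) = (m + 1) * n + 2"
  unfolding encode_eq commas_concat length_input_numbers ..

text \<open>Strictness matters: a class counter can be as large as \<open>n\<close>, and the search
  guesses values below \<open>length x\<close>.\<close>

lemma n_less: "n < length x"
proof -
  have "2 * ((m + 1) * n + 2) \<le> length x"
    unfolding encode_eq length_input_numbers[symmetric] by (rule length_concat_enc_num)
  then show ?thesis by simp
qed

lemma x_alphabet: "set x \<subseteq> {1, 2, 3}"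
  unfolding encode_eq by (rule set_concat_enc_num)

lemma number_0: "number x 0 = defB I" and number_1: "number x 1 = attB I"
  unfolding encode_eq using number_concat[of 0 "input_numbers I"] number_concat[of 1 "input_numbers I"]
  by (simp_all add: input_numbers_def)

text \<open>The indices in question stay below \<open>(m + 3) * (length x + 1)\<close>, hence the
  requirement \<open>m + 3 \<le> C\<close>.\<close>

lemma slot_eq: "z \<le> m \<Longrightarrow> j < length x \<Longrightarrow> slot z x j = (m + 1) * j + (2 + z)"
proof -
  assume z: "z \<le> m" and j: "j < length x"
  have "(m + 1) * j \<le> (m + 1) * length x" using j by (intro mult_le_mono2) simp
  then have "(m + 1) * j + (2 + z) < (m + 3) * (length x + 1)" using z by (simp add: algebra_simps)
  also have "\<dots> \<le> width C x" unfolding width_def using D(3) by (rule mult_le_mono1)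
  finally show ?thesis by (simp add: slot_def)
qed

lemma number_slot: "z \<le> m \<Longrightarrow> j < n \<Longrightarrow> number x (slot z x j) = (w j # p j) ! z"
proof -
  assume z: "z \<le> m" and j: "j < n"
  have "(m + 1) * (j + 1) \<le> (m + 1) * n" using j by (intro mult_le_mono2) simp
  then have lt: "(m + 1) * j + (2 + z) < length (input_numbers I)"
    unfolding length_input_numbers using z by simp
  have "slot z x j = (m + 1) * j + (2 + z)" using slot_eq[OF z] j n_less by simp
  then have "number x (slot z x j) = input_numbers I ! ((m + 1) * j + (2 + z))"
    unfolding encode_eq using number_concat[OF lt] by simp
  also have "\<dots> = concat (map (\<lambda>v. fst v # snd v) vs) ! ((m + 1) * j + z)"
    by (simp add: input_numbers_def)
  also have "\<dots> = map (\<lambda>v. fst v # snd v) vs ! j ! z"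
    by (rule nth_concat_blocks[OF blocks]) (use z j in simp_all)
  finally show ?thesis using j by simp
qed

lemma is_voter_iff: "j < length x \<Longrightarrow> is_voter x j \<longleftrightarrow> j < n"
proof -
  assume j: "j < length x"
  have "is_voter x j \<longleftrightarrow> (m + 1) * j + 2 < (m + 1) * n + 2"
    unfolding is_voter_def commas_x slot_eq[OF le0 j] by simp
  also have "\<dots> \<longleftrightarrow> (m + 1) * j < (m + 1) * n" by simp
  also have "\<dots> \<longleftrightarrow> j < n" by (simp only: mult_less_cancel1) simp
  finally show ?thesis .
qed

lemma weight_eq: "j < n \<Longrightarrow> weight x j = w j"
  unfolding weight_def using number_slot[of 0 j] by simp

lemma has_type_iff: "j < n \<Longrightarrow> t \<in> set T \<Longrightarrow> has_type t x j \<longleftrightarrow> p j = t"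
proof -
  assume j: "j < n" and t: "t \<in> set T"
  have "length t = m" "length (p j) = m" using t all_types(1) pref[OF j] by (auto simp: is_pref_def)
  then have "p j = t \<longleftrightarrow> (\<forall>z<m. p j ! z = t ! z)" by (auto simp: list_eq_iff_nth_eq)
  moreover have "number x (slot (Suc z) x j) = p j ! z" if "z < m" for z
    using number_slot[of "Suc z" j] that j by simp
  ultimately show ?thesis unfolding has_type_def by auto
qed

lemma by_type_eq: "j < n \<Longrightarrow> by_type h T x j = h (p j)"
proof -
  assume j: "j < n"
  have "set ts \<subseteq> set T \<Longrightarrow> p j \<in> set ts \<Longrightarrow> by_type h ts x j = h (p j)" for ts
    by (induction ts) (auto simp: has_type_iff[OF j])
  then show ?thesis using pref[OF j] all_types(1) by blast
qed

lemma ahead_cong: "v i = v' i \<Longrightarrow> v j = v' j \<Longrightarrow> ahead v i j = ahead v' i j"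
  by (simp add: ahead_def)

context
  fixes u :: "nat list" and U :: "nat list \<Rightarrow> nat"
  assumes U: "\<And>k. k < length T \<Longrightarrow> U (T ! k) = arg u k"
begin

abbreviation "A \<equiv> heaviest n w p U"
abbreviation "v c \<equiv> \<lambda>j. gain m alpha c (p j) * w j"

lemma awarded_iff: "j < n \<Longrightarrow> awarded x u j \<longleftrightarrow> j \<in> A"
proof -
  assume j: "j < n"
  have "{i. i < length x \<and> (is_voter x i \<and> has_type (T ! k) x i \<and> ahead (weight x) i j)}
      = {i. i < n \<and> p i = T ! k \<and> ahead w i j}" if "k < length T" for k
  proof (rule Collect_cong)
    fix i
    show "(i < length x \<and> (is_voter x i \<and> has_type (T ! k) x i \<and> ahead (weight x) i j))
      \<longleftrightarrow> (i < n \<and> p i = T ! k \<and> ahead w i j)"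
    proof (cases "i < n")
      case True
      then show ?thesis
        using n_less is_voter_iff[of i] has_type_iff[OF True, of "T ! k"] that
          ahead_cong[of "weight x" i w j] weight_eq j by simp
    qed (use is_voter_iff[of i] in auto)
  qed
  then have aw: "awarded x u j \<longleftrightarrow> (\<exists>k<length T. p j = T ! k \<and> card {i. i < n \<and> p i = T ! k \<and> ahead w i j} < U (T ! k))"
    unfolding awarded_def using has_type_iff[OF j] U by auto
  have "p j \<in> set T" using pref[OF j] all_types(1) by blast
  then obtain k where "k < length T" "p j = T ! k" by (auto simp: in_set_conv_nth)
  then show ?thesis unfolding aw heaviest_def using j by auto
qed

lemma unprotected_iff: "j < length x \<Longrightarrow> unprotected x u j \<longleftrightarrow> j \<in> {..<n} - A"
  unfolding unprotected_def using is_voter_iff awarded_iff by auto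

lemma bribed_iff: "j < n \<Longrightarrow> bribed c x u j \<longleftrightarrow> j \<in> top_set ({..<n} - A) (ahead (v c)) (attB I)"
proof -
  assume j: "j < n"
  have dam: "damage c x i = v c i" if "i < n" for i
    unfolding damage_def using by_type_eq[OF that] weight_eq[OF that] by simp
  have "{i. i < length x \<and> (unprotected x u i \<and> ahead (damage c x) i j)}
      = {i \<in> {..<n} - A. ahead (v c) i j}"
  proof (rule Collect_cong)
    fix i
    show "(i < length x \<and> (unprotected x u i \<and> ahead (damage c x) i j)) \<longleftrightarrow> (i \<in> {..<n} - A \<and> ahead (v c) i j)"
    proof (cases "i < n")
      case True
      then show ?thesis
        using n_less unprotected_iff[of i] ahead_cong[of "damage c x" i "v c" j] dam j by simp
    qed (use unprotected_iff[of i] in auto)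
  qed
  then show ?thesis
    unfolding bribed_def top_set_def number_1 using unprotected_iff[of j] j n_less by simp
qed

lemma affordable_iff: "affordable x u \<longleftrightarrow> card A \<le> defB I"
proof -
  have "{j. j < length x \<and> (is_voter x j \<and> awarded x u j)} = A"
    using is_voter_iff awarded_iff n_less by (auto simp: heaviest_def)
  then show ?thesis unfolding affordable_def number_0 by simp
qed

lemma sum_voters:
  "(\<Sum>j<length x. (if is_voter x j then f j else 0) * number x (slot 0 x j) + 0) = (\<Sum>j<n. f j * w j)"
  by (rule sum.mono_neutral_cong_right)
    (use n_less is_voter_iff weight_eq in \<open>auto simp: weight_def[symmetric]\<close>)

lemma survives_iff: "survives c x u \<longleftrightarrow> resists m alpha I A c"
proof -
  let ?S = "top_set ({..<n} - A) (ahead (v c)) (attB I)"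
  have S: "?S \<subseteq> {..<n}" by (auto simp: top_set_def)
  have "(\<Sum>j<n. (by_type (\<lambda>t. points alpha t c) T x j + (if bribed c x u j then by_type (gain m alpha c) T x j else 0)) * w j)
    = (\<Sum>j<n. points alpha (p j) c * w j + (if j \<in> ?S then v c j else 0))"
    by (intro sum.cong refl) (simp add: by_type_eq bribed_iff add_mult_distrib)
  also have "\<dots> = (\<Sum>j<n. points alpha (p j) c * w j) + sum (v c) ?S"
    unfolding sum.distrib using S by (simp add: sum.inter_restrict[symmetric] Int_absorb1)
  finally show ?thesis
    unfolding survives_def sum_voters resists_def Let_def by (simp add: by_type_eq)
qed

end

text \<open>Any accepted counters already describe a resisting award. Conversely,
  \<open>protectable_iff_heaviest\<close> supplies counters small enough to be found by the
  search.\<close>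

lemma accepted_iff_protectable:
  assumes mono: "\<forall>i j. i \<le> j \<longrightarrow> j < m \<longrightarrow> alpha ! j \<le> alpha ! i"
  shows "accepted x [] \<longleftrightarrow> protectable m alpha I"
proof
  assume "accepted x []"
  then obtain u where u: "affordable x u" "\<And>c. c < m - 1 \<Longrightarrow> survives c x u"
    unfolding accepted_def by auto
  \<comment> \<open>The guessed counters are listed in the order of \<open>T\<close>; since
    \<open>T\<close> is distinct, they can be read as a function of the preference list.\<close>
  define U where "U t = arg u (inv_into {..<length T} ((!) T) t)" for t
  have "inj_on ((!) T) {..<length T}" using all_types(2) by (simp add: inj_on_def nth_eq_iff_index_eq)
  then have U: "U (T ! k) = arg u k" if "k < length T" for k using that by (simp add: U_def)
  have "heaviest n (\<lambda>j. w j) (\<lambda>j. p j) U \<subseteq> {..<n}" by (auto simp: heaviest_def)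
  then show "protectable m alpha I"
    unfolding protectable_iff_resists[OF mono valid]
    using u affordable_iff[of U u, OF U] survives_iff[of U u, OF U] by blast
next
  assume "protectable m alpha I"
  then obtain U where U: "\<And>t. U t \<le> n" "card (heaviest n (\<lambda>j. w j) (\<lambda>j. p j) U) \<le> defB I"
    "\<And>c. c < m - 1 \<Longrightarrow> resists m alpha I (heaviest n (\<lambda>j. w j) (\<lambda>j. p j) U) c"
    unfolding protectable_iff_heaviest[OF mono valid] by blast
  have u: "U (T ! k) = arg (map U T) k" if "k < length T" for k using that by (simp add: arg_def)
  have "\<forall>y\<in>set (map U T). y < length x" using U(1) n_less by (auto intro: order.strict_trans1)
  then show "accepted x []"
    unfolding accepted_def
    using affordable_iff[of U "map U T", OF u] survives_iff[of U "map U T", OF u] U(2,3)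
    by (intro exI[of _ "map U T"]) simp
qed

end

lemma finite_prefs: "finite {p. is_pref m p}"
  by (rule finite_subset[OF _ finite_lists_length_eq[of "{0..<m}" m]]) (auto simp: is_pref_def)

theorem theorem3:
  fixes m :: nat and alpha :: "nat list"
  assumes "m \<ge> 1"
    and "length alpha = m"
    and "\<forall>i j. i \<le> j \<longrightarrow> j < m \<longrightarrow> alpha ! j \<le> alpha ! i"
  shows "poly_time_solvable (valid_instance m alpha) (protectable m alpha)"
proof -
  obtain T where T: "set T = {p. is_pref m p}" "distinct T"
    using finite_distinct_list[OF finite_prefs] by blast
  \<comment> \<open>Entries of lists are below \<open>m\<close>, points are at most
    \<open>alpha ! 0\<close> and a gain is at most twice that; the final 1 makes \<open>D\<close>
    positive.\<close>
  define D where "D = m + 3 * alpha ! 0 + 1"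
  \<comment> \<open>\<open>4 * D + 1\<close> keeps columns and carries within registers,
    \<open>m + 3\<close> does the same for \<open>slot\<close>.\<close>
  define C where "C = 4 * D + 1 + (m + 3)"
  interpret voting C m alpha T D
  proof
    show "t ! z \<le> D" if "t \<in> set T" "z < m" for t z
    proof -
      have "t ! z \<in> set t" using that T(1) by (auto simp: is_pref_def)
      then show ?thesis using that T(1) by (auto simp: is_pref_def D_def)
    qed
    show "points alpha t c + gain m alpha c t \<le> D" if "t \<in> set T" for t c
    proof -
      \<comment> \<open>The locale asks for the bound at all numbers \<open>d\<close>; one that is
        not a candidate occurs at no position and receives 0 points.\<close>
      have "points alpha t d \<le> alpha ! 0" for d
      proof (cases "d < m")
        case True
        then show ?thesis using points_bounds(2)[OF assms(3) _ True] that T(1) by simp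
      next
        case False
        have len: "length t = m" and st: "set t = {0..<m}" using that T(1) by (auto simp: is_pref_def)
        have "t ! z \<noteq> d" if "z < m" for z
        proof -
          have "t ! z \<in> set t" using that len by simp
          then show ?thesis using st False by auto
        qed
        then have "points alpha t d = 0" unfolding points_def voter_score_def len by (intro sum.neutral) simp
        then show ?thesis by simp
      qed
      from this[of c] this[of "m - 1"] show ?thesis unfolding gain_def D_def by linarith
    qed
  qed (auto simp: C_def D_def)
  obtain G where G: "computes (\<lambda>x e. if accepted x e then 1 else 0) G"
    using decidable_accepted unfolding decidable_def definable_def by blast
  \<comment> \<open>The program has no arguments and leaves its result in register 0, where the
    machine reads the verdict.\<close>
  have P: "well_formed (G [] 0)" using computes_static(1)[OF G] by simp
  have ex: "exec C x (G [] 0) (\<lambda>_. 0) 0 \<noteq> 0 \<longleftrightarrow> accepted x []" if "set x \<subseteq> {1, 2, 3}" for x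
    using computes_exec(1)[OF G _ that, of "[]" 0 "\<lambda>_. 0"] by (simp add: width_def C_def)
  have "0 < C" by (simp add: C_def)
  from program_poly_time[OF this P] obtain M c k where M: "wf_tm M"
    "\<And>x. set x \<subseteq> {1, 2, 3} \<Longrightarrow> halts_within M x (c * length x ^ k + c) \<and> (accepts M x \<longleftrightarrow> exec C x (G [] 0) (\<lambda>_. 0) 0 \<noteq> 0)"
    by blast
  have "accepts M (encode I) \<longleftrightarrow> protectable m alpha I" if I: "valid_instance m alpha I" for I
  proof -
    interpret voting_instance C m alpha T D I
      by unfold_locales (use assms(1) I T in auto)
    show ?thesis using M(2)[OF x_alphabet] ex[OF x_alphabet] accepted_iff_protectable[OF assms(3)] by simp
  qed
  then show ?thesis unfolding poly_time_solvable_def using M by blast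
qed

end
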